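(* Let $d\in\mathbb N$, $r>0$ and $\varepsilon>0$. Then $$K(r,\varepsilon)\ \ge\ \frac{2\varepsilon}{M_{2,d}\,r^2}.$$ Explicitly: let $0<\tau<\frac{2\varepsilon}{M_{2,d}r^2}$ and let $\mathcal A$ be any compact set of real $d\times d$ matrices, each having only real eigenvalues, with $\max_{A\in\mathcal A}\rho(A)\le r$. If $\rho(I+\tau\mathcal A)\ge 1$, then $\sigma(\mathcal A)\ge-\varepsilon$ (equivalently: if $\sigma(\mathcal A)<-\varepsilon$, then $\rho(I+\tau\mathcal A)<1$).
   Context: For a compact set $\mathcal A$ of real $d\times d$ matrices, a trajectory of the associated linear switching system is an absolutely continuous $x:[0,\infty)\to\mathbb R^d$ with $\dot x(t)=A(t)x(t)$ for almost every $t$, where $A(\cdot)$ is any Lebesgue measurable function from $[0,\infty)$ to $\mathcal A$. The (worst-case) Lyapunov exponent $\sigma(\mathcal A)$ is the infimum of all $\alpha\in\mathbb R$ such that for every trajectory $x$ there is a constant $C$ with $\|x(t)\|\le Ce^{\alpha t}$ for all $t\ge0$. For a bounded set of matrices $\mathcal M$, the joint spectral radius is $\rho(\mathcal M)=\lim_{k\to\infty}\sup_{M_1,\dots,M_k\in\mathcal M}\|M_1\cdots M_k\|^{1/k}$; for a single matrix, $\rho(A)$ is its spectral radius. $I+\tau\mathcal A=\{I+\tau A: A\in\mathcal A\}$. $K(r,\varepsilon)$ denotes the largest number such that for every $\tau\in(0,K(r,\varepsilon))$ and every compact set $\mathcal A$ of real $d\times d$ matrices with only real eigenvalues and $\max_{A\in\mathcal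 A}\rho(A)\le r$, the inequality $\rho(I+\tau\mathcal A)\ge1$ implies $\sigma(\mathcal A)\ge-\varepsilon$. Finally $M_{2,d}=\max\{\sup_{t\ge0}|p''(t)|: p(t)=e^{-t}q(t),\ q \text{ a real polynomial of degree}\le d-1,\ \sup_{t\ge 0}|p(t)|\le1\}$. *)

theory Defs
  imports "HOL-Analysis.Analysis" "HOL-Computational_Algebra.Polynomial"
begin

text \<open>Absolute continuity of a vector-valued function on a compact interval [a,b]
  (classical epsilon-delta definition with finitely many non-overlapping subintervals).\<close>
definition abs_cont_on :: "real \<Rightarrow> real \<Rightarrow> (real \<Rightarrow> 'a::real_normed_vector) \<Rightarrow> bool" where
  "abs_cont_on a b x \<longleftrightarrow>
     (\<forall>e>0. \<exists>\<delta>>0. \<forall>(n::nat) (u::nat \<Rightarrow> real) (v::nat \<Rightarrow> real).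
        (\<forall>i<n. a \<le> u i \<and> u i \<le> v i \<and> v i \<le> b) \<longrightarrow>
        (\<forall>i<n. \<forall>j<n. i \<noteq> j \<longrightarrow> v i \<le> u j \<or> v j \<le> u i) \<longrightarrow>
        (\<Sum>i<n. v i - u i) < \<delta> \<longrightarrow>
        (\<Sum>i<n. norm (x (v i) - x (u i))) < e)"

text \<open>Trajectories of the linear switching system: x absolutely continuous on [0,\<infinity>)
  (i.e. on every [0,T]), with x'(t) = A(t) x(t) for a.e. t \<ge> 0, where A : [0,\<infinity>) \<rightarrow> \<A>
  is Lebesgue(-Borel) measurable.\<close>
definition trajectory :: "(real^'n^'n) set \<Rightarrow> (real \<Rightarrow> real^'n) \<Rightarrow> bool" where
  "trajectory \<A> x \<longleftrightarrow>
     (\<forall>T\<ge>0. abs_cont_on 0 T x) \<and>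
     (\<exists>A :: real \<Rightarrow> real^'n^'n.
        A \<in> borel_measurable (restrict_space lebesgue {0..}) \<and>
        (\<forall>t\<ge>0. A t \<in> \<A>) \<and>
        (AE t in lebesgue. t \<ge> 0 \<longrightarrow> (x has_vector_derivative (A t *v x t)) (at t)))"

text \<open>Worst-case Lyapunov exponent.\<close>
definition lyap_exp :: "(real^'n^'n) set \<Rightarrow> real" where
  "lyap_exp \<A> = Inf {\<alpha>::real. \<forall>x. trajectory \<A> x \<longrightarrow>
                      (\<exists>C. \<forall>t\<ge>0. norm (x t) \<le> C * exp (\<alpha> * t))}"

text \<open>Joint spectral radius (with the Frobenius norm; the limit is norm-independent).\<close>
definition jsr :: "(real^'n^'n) set \<Rightarrow> real" where
  "jsr \<M> = lim (\<lambda>k. root k (SUP Ms \<in> {Ms. length Ms = k \<and> set Ms \<subseteq> \<M>}.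
                                norm (foldr (**) Ms (mat 1))))"

text \<open>Complex eigenvalues of a real square matrix.\<close>
definition cmat :: "real^'n^'n \<Rightarrow> complex^'n^'n" where
  "cmat A = (\<chi> i j. complex_of_real (A $ i $ j))"

definition eigenvalues :: "real^'n^'n \<Rightarrow> complex set" where
  "eigenvalues A = {c. det (mat c - cmat A) = 0}"

definition only_real_eigenvalues :: "real^'n^'n \<Rightarrow> bool" where
  "only_real_eigenvalues A \<longleftrightarrow> eigenvalues A \<subseteq> \<real>"

definition spec_rad :: "real^'n^'n \<Rightarrow> real" where
  "spec_rad A = Sup (cmod ` eigenvalues A)"

text \<open>M_{2,d}.\<close>
definition M2 :: "nat \<Rightarrow> real" where
  "M2 d = Sup { Sup { \<bar>deriv (deriv (\<lambda>t. exp (- t) * poly q t)) t\<bar> | t. t \<ge> 0 }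
              | q :: real poly. degree q \<le> d - 1 \<and> (\<forall>t\<ge>0. \<bar>exp (- t) * poly q t\<bar> \<le> 1) }"

end

theory Submission
  imports Defs "HOL-Computational_Algebra.Fundamental_Theorem_Algebra"
begin

text \<open>If \<open>lyap_exp \<A> < -\<epsilon>\<close>, then \<open>V v = sup exp (\<beta> t) |x(t)|\<close>, over all piecewise constant trajectories starting
  in \<open>v\<close>, is a finite norm for some \<open>\<beta> > \<epsilon>\<close>, and it decays like \<open>exp (-\<beta> t)\<close> along every \<open>exp (t A)\<close>. Being a supremum
  of linear functionals \<open>y\<close>, it is contracted by \<open>I + \<tau> A\<close> if \<open>|p(0) + \<tau> p'(0)| \<le> \<gamma> V x\<close> for all
  \<open>p(t) = y (exp (t A) x)\<close>. Such a \<open>p\<close> is an exponential sum of order at most \<open>d\<close> with real exponents in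
  \<open>[-r, -\<beta>]\<close>, so by Taylor's formula it suffices to bound its second derivative.

  The key point is that among exponential sums of order \<open>d\<close> with exponents in \<open>[-1, 0)\<close> and sup norm \<open>1\<close> on
  \<open>[0, \<infinity>)\<close> the second derivative is largest when all exponents equal \<open>-1\<close>. Let \<open>T\<close> be extremal among the functions
  \<open>exp (-t) q(t)\<close>; it takes the values \<open>1, -1, 1, ...\<close> at \<open>d\<close> nodes \<open>0 = t\<^sub>0 < t\<^sub>1 < ...\<close>. For every choice of
  exponents let \<open>S\<close> be the exponential sum with these values at the nodes. Counting zeros by Rolle's theorem gives
  \<open>g''(0) \<le> S''(0)\<close> for every \<open>g\<close> of sup norm \<open>1\<close> with the same exponents, and shows that \<open>S''(0)\<close> increases when
  one exponent at a time is moved to \<open>-1\<close>, where \<open>S = T\<close>.\<close>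

text \<open>The sharp constant rules out the obvious Taylor estimate: at \<tau> = 2 \<epsilon> / (M
  r^2) the sum of exp (- \<epsilon> \<tau>) and \<tau>^2 M r^2 / 2 already exceeds 1, because exp
  lies above its tangent. Expanding exp (\<epsilon> t) p(t) instead gains enough as soon as M \<ge>
  2. This covers d \<ge> 2, where exp (- t) (1 - t) shows M \<ge> 3. For d = 1 the constant is 1,
  and the Euler step is estimated directly.

  Exponents may coincide, and the comparison makes them coincide on purpose. Describing exponential
  sums by annihilating first order operators instead of a basis avoids case distinctions on
  multiplicities and turns every zero count into an induction on a list.

  The gap between \<epsilon> and \<beta> keeps all exponents strictly negative after weighting. The
  weighted sums thus vanish at infinity, which supplies the zeros that Rolle's theorem loses under
  differentiation.

  Real \<open>Inf\<close>, \<open>Sup\<close> and \<open>lim\<close> are total, so non-emptiness for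
  \<open>lyap_exp\<close>, boundedness for \<open>M2\<close> and convergence for \<open>jsr\<close>
  have to be proved before the definitions can be exploited.\<close>

section \<open>Exponential sums as solutions of linear differential equations\<close>

text \<open>The solutions of (D + a_1) ... (D + a_n) f = 0: exponents are the negatives of the list
  entries, and repetition encodes multiplicity.\<close>

primrec exp_sol :: "real list \<Rightarrow> (real \<Rightarrow> real) \<Rightarrow> bool" where
  "exp_sol [] f \<longleftrightarrow> f = (\<lambda>_. 0)"
| "exp_sol (a # as) f \<longleftrightarrow>
     (\<exists>g. exp_sol as g \<and> (\<forall>t. (f has_real_derivative g t - a * f t) (at t)))"

lemma exp_sol_lincomb:
  "exp_sol as f \<Longrightarrow> exp_sol as g \<Longrightarrow> exp_sol as (\<lambda>t. c * f t + d * g t)"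
proof (induction as arbitrary: f g)
  case (Cons a as)
  from Cons.prems obtain f1 g1 where
    f1: "exp_sol as f1" "\<And>t. (f has_real_derivative f1 t - a * f t) (at t)" and
    g1: "exp_sol as g1" "\<And>t. (g has_real_derivative g1 t - a * g t) (at t)" by auto
  have "((\<lambda>t. c * f t + d * g t) has_real_derivative
      (c * f1 t + d * g1 t) - a * (c * f t + d * g t)) (at t)" for t
    by (rule derivative_eq_intros f1 g1 refl | simp add: algebra_simps)+
  with Cons.IH[OF f1(1) g1(1)] show ?case by auto
qed simp

lemma exp_sol_cmult: "exp_sol as f \<Longrightarrow> exp_sol as (\<lambda>t. c * f t)"
  using exp_sol_lincomb[of as f f c 0] by simp

lemma exp_sol_diff: "exp_sol as f \<Longrightarrow> exp_sol as g \<Longrightarrow> exp_sol as (\<lambda>t. f t - g t)"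
  using exp_sol_lincomb[of as f g 1 "-1"] by simp

lemma exp_sol_zero: "exp_sol as (\<lambda>_. 0)"
  by (induction as) (auto intro!: exI[of _ "\<lambda>_. 0"])

lemma exp_sol_derivative:
  "exp_sol as f \<Longrightarrow> \<exists>f'. exp_sol as f' \<and> (\<forall>t. (f has_real_derivative f' t) (at t))"
proof (induction as arbitrary: f)
  case Nil then show ?case by (auto intro!: exI[of _ "\<lambda>_. 0"])
next
  case (Cons a as)
  then obtain g where g: "exp_sol as g" "\<And>t. (f has_real_derivative g t - a * f t) (at t)" by auto
  obtain g' where g': "exp_sol as g'" "\<And>t. (g has_real_derivative g' t) (at t)"
    using Cons.IH[OF g(1)] by auto
  have "((\<lambda>t. g t - a * f t) has_real_derivative g' t - a * (g t - a * f t)) (at t)" for t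
    by (rule derivative_eq_intros g g' refl | simp)+
  with g g'(1) show ?case by (intro exI[of _ "\<lambda>t. g t - a * f t"]) auto
qed

lemma exp_sol_DERIV: "exp_sol as f \<Longrightarrow> (f has_real_derivative deriv f t) (at t)"
  using exp_sol_derivative DERIV_imp_deriv by metis

lemma exp_sol_deriv:
  assumes "exp_sol as f" shows "exp_sol as (deriv f)"
proof -
  obtain f' where f': "exp_sol as f'" "\<forall>t. (f has_real_derivative f' t) (at t)"
    using exp_sol_derivative[OF assms] by blast
  then have "deriv f = f'" by (auto intro: DERIV_imp_deriv)
  with f' show ?thesis by simp
qed

lemma exp_sol_isCont: "exp_sol as f \<Longrightarrow> isCont f t"
  using exp_sol_DERIV DERIV_isCont by blast

lemma exp_sol_continuous_on: "exp_sol as f \<Longrightarrow> continuous_on X f"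
  using exp_sol_isCont continuous_at_imp_continuous_on by blast

lemma exp_sol_ConsD:
  assumes "exp_sol (a # as) f"
  shows "exp_sol as (\<lambda>t. deriv f t + a * f t)"
proof -
  obtain g where g: "exp_sol as g" "\<And>t. (f has_real_derivative g t - a * f t) (at t)"
    using assms by auto
  have "deriv f t + a * f t = g t" for t using DERIV_imp_deriv[OF g(2)] by simp
  then have "(\<lambda>t. deriv f t + a * f t) = g" by blast
  with g(1) show ?thesis by simp
qed

lemma exp_sol_ConsI:
  assumes "exp_sol as g" "\<And>t. (f has_real_derivative g t - a * f t) (at t)"
  shows "exp_sol (a # as) f"
  using assms by auto

lemma exp_sol_Cons_mono:
  assumes "exp_sol as f" shows "exp_sol (a # as) f"
proof (rule exp_sol_ConsI)
  show "exp_sol as (\<lambda>t. 1 * deriv f t + a * f t)"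
    by (rule exp_sol_lincomb[OF exp_sol_deriv[OF assms] assms])
qed (use exp_sol_DERIV[OF assms] in simp)

lemma exp_sol_append_mono: "exp_sol as f \<Longrightarrow> exp_sol (bs @ as) f"
  by (induction bs) (auto simp del: exp_sol.simps intro: exp_sol_Cons_mono)

lemma exp_sol_swap:
  assumes "exp_sol (a # b # as) f" shows "exp_sol (b # a # as) f"
proof -
  obtain g h where g: "\<And>t. (f has_real_derivative g t - a * f t) (at t)"
    and h: "exp_sol as h" "\<And>t. (g has_real_derivative h t - b * g t) (at t)"
    using assms by auto
  \<comment> \<open>\<open>k\<close> is (D + b) f expressed through \<open>g\<close> = (D + a) f;
    operators with constant coefficients commute.\<close>
  define k where "k = (\<lambda>t. g t + (b - a) * f t)"
  have "(k has_real_derivative h t - a * k t) (at t)" for t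
    unfolding k_def by (rule derivative_eq_intros g h refl | simp add: algebra_simps)+
  then have "exp_sol (a # as) k" by (rule exp_sol_ConsI[OF h(1)])
  moreover have "(f has_real_derivative k t - b * f t) (at t)" for t
    using g[of t] by (simp add: k_def algebra_simps)
  ultimately show ?thesis by (rule exp_sol_ConsI)
qed

lemma exp_sol_move: "exp_sol (b # as @ bs) f \<longleftrightarrow> exp_sol (as @ b # bs) f"
proof (induction as arbitrary: f)
  case (Cons a as)
  have "exp_sol (b # (a # as) @ bs) f \<longleftrightarrow> exp_sol (a # b # as @ bs) f"
    using exp_sol_swap by (metis append_Cons)
  also have "\<dots> \<longleftrightarrow> exp_sol ((a # as) @ b # bs) f" using Cons.IH by auto
  finally show ?case .
qed simp

lemma exp_sol_shift: "exp_sol as f \<Longrightarrow> exp_sol as (\<lambda>t. f (t + c))"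
proof (induction as arbitrary: f)
  case (Cons a as)
  then obtain g where g: "exp_sol as g" "\<And>t. (f has_real_derivative g t - a * f t) (at t)" by auto
  have "((\<lambda>t. f (t + c)) has_real_derivative g (t + c) - a * f (t + c)) (at t)" for t
    using g(2)[of "t + c"] by (simp add: DERIV_shift)
  with Cons.IH[OF g(1)] show ?case by (rule exp_sol_ConsI)
qed simp

lemma exp_sol_scale: "exp_sol as f \<Longrightarrow> exp_sol (map ((*) c) as) (\<lambda>t. f (c * t))"
proof (induction as arbitrary: f)
  case (Cons a as)
  then obtain g where g: "exp_sol as g" "\<And>t. (f has_real_derivative g t - a * f t) (at t)" by auto
  have "((\<lambda>t. f (c * t)) has_real_derivative c * g (c * t) - (c * a) * f (c * t)) (at t)" for t
    by (rule DERIV_cong[OF DERIV_chain2[where f = f and g = "\<lambda>t. c * t" and x = t, OF g(2)]]) 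
       (auto intro!: derivative_eq_intros simp: algebra_simps)
  with exp_sol_cmult[OF Cons.IH[OF g(1)]] show ?case
    unfolding list.map by (rule exp_sol_ConsI)
qed simp

lemma exp_sol_exp_mult: "exp_sol as f \<Longrightarrow> exp_sol (map (\<lambda>a. a - c) as) (\<lambda>t. exp (c * t) * f t)"
proof (induction as arbitrary: f)
  case (Cons a as)
  then obtain g where g: "exp_sol as g" "\<And>t. (f has_real_derivative g t - a * f t) (at t)" by auto
  have "((\<lambda>t. exp (c * t) * f t) has_real_derivative
      exp (c * t) * g t - (a - c) * (exp (c * t) * f t)) (at t)" for t
    by (rule derivative_eq_intros g refl | simp add: algebra_simps)+
  with Cons.IH[OF g(1)] show ?case
    unfolding list.map by (rule exp_sol_ConsI)
qed simp

text \<open>D + 1 maps exp (- t) q(t) to exp (- t) q'(t), and n differentiations kill a degree below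
  n. The alternative \<open>q = 0\<close> gives the induction its base at n = 0.\<close>

lemma exp_sol_exp_poly:
  "degree q < n \<or> q = 0 \<Longrightarrow> exp_sol (replicate n 1) (\<lambda>t. exp (- t) * poly q t)"
proof (induction n arbitrary: q)
  case (Suc n)
  have "exp_sol (replicate n 1) (\<lambda>t. exp (- t) * poly (pderiv q) t)"
  proof (rule Suc.IH)
    show "degree (pderiv q) < n \<or> pderiv q = 0"
      using Suc.prems by (cases "degree q") (auto simp: degree_pderiv pderiv_eq_0_iff)
  qed
  then show ?case unfolding replicate_Suc
    by (rule exp_sol_ConsI) (auto intro!: derivative_eq_intros poly_DERIV simp: algebra_simps)
qed simp

text \<open>The integrating factor exp (a t) turns D + a into a plain derivative without moving
  zeros or signs; Rolle and monotonicity arguments for D + a go through it.\<close>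

lemma exp_sol_weighted_DERIV:
  assumes "exp_sol as f"
  shows "((\<lambda>t. exp (a * t) * f t) has_real_derivative exp (a * t) * (deriv f t + a * f t)) (at t)"
  by (rule derivative_eq_intros exp_sol_DERIV[OF assms] refl | simp add: algebra_simps)+

text \<open>L'Hospital's rule for exp (a t) f(t) over exp (a t): the quotient of the derivatives is
  (D + a) f / a, a shorter sum covered by the induction.\<close>

lemma exp_sol_tendsto_0:
  "exp_sol as f \<Longrightarrow> \<forall>a\<in>set as. 0 < a \<Longrightarrow> (f \<longlongrightarrow> 0) at_top"
proof (induction as arbitrary: f)
  case (Cons a as)
  let ?g = "\<lambda>t. deriv f t + a * f t"
  have a: "a > 0" using Cons.prems by simp
  have g: "(?g \<longlongrightarrow> 0) at_top" using Cons.IH[OF exp_sol_ConsD[OF Cons.prems(1)]] Cons.prems(2) by simp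
  have "((\<lambda>t. (exp (a * t) * f t) / exp (a * t)) \<longlongrightarrow> 0) at_top"
  proof (rule lhospital_at_top_at_top)
    show "LIM t at_top. exp (a * t) :> at_top"
      using a by (auto intro!: filterlim_compose[OF exp_at_top] filterlim_tendsto_pos_mult_at_top
          filterlim_ident tendsto_const)
    show "\<forall>\<^sub>F t in at_top. a * exp (a * t) \<noteq> 0" using a by simp
    show "\<forall>\<^sub>F t in at_top. ((\<lambda>t. exp (a * t) * f t) has_real_derivative exp (a * t) * ?g t) (at t)"
      using exp_sol_weighted_DERIV[OF Cons.prems(1)] by simp
    show "\<forall>\<^sub>F t in at_top. ((\<lambda>t. exp (a * t)) has_real_derivative a * exp (a * t)) (at t)"
      by (intro always_eventually allI) (auto intro!: derivative_eq_intros)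
    have "((\<lambda>t. ?g t / a) \<longlongrightarrow> 0 / a) at_top"
      using a by (intro tendsto_divide g tendsto_const) simp
    then show "((\<lambda>t. exp (a * t) * ?g t / (a * exp (a * t))) \<longlongrightarrow> 0) at_top" by simp
  qed
  then show ?case by simp
qed simp

section \<open>Zero counts and signs by Rolle's theorem\<close>

lemma Rolle_finite_set:
  fixes F F' :: "real \<Rightarrow> real"
  assumes "finite Z" "Z \<noteq> {}" "\<And>z. z \<in> Z \<Longrightarrow> F z = 0"
    and "\<And>t. (F has_real_derivative F' t) (at t)"
  shows "\<exists>Y. finite Y \<and> card Y = card Z - 1 \<and> Y \<subseteq> {Min Z<..<Max Z} \<and> (\<forall>y\<in>Y. F' y = 0)"
  using assms
proof (induction Z rule: finite_linorder_max_induct)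
  case (insert b A)
  show ?case
  proof (cases "A = {}")
    case True
    then show ?thesis by (intro exI[of _ "{}"]) auto
  next
    case False
    then obtain Y where Y: "finite Y" "card Y = card A - 1" "Y \<subseteq> {Min A<..<Max A}" "\<forall>y\<in>Y. F' y = 0"
      using insert by auto
    have mx: "Max A < b" using insert False by auto
    have "\<exists>z>Max A. z < b \<and> F' z = 0"
    proof (rule Rolle_deriv[where f = F and f' = "\<lambda>x h. F' x * h", THEN exE])
      show "Max A < b" by fact
      show "F (Max A) = F b" using insert.prems False insert.hyps by auto
      show "continuous_on {Max A..b} F"
        using insert.prems(3) DERIV_isCont continuous_at_imp_continuous_on by blast
      show "(F has_derivative (\<lambda>h. F' x * h)) (at x)" for x
        using insert.prems(3)[of x] by (simp add: has_field_derivative_def)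
      fix z assume "Max A < z \<and> z < b \<and> (\<lambda>h. F' z * h) = (\<lambda>v. 0)"
      then show ?thesis by (auto simp: fun_eq_iff intro!: exI[of _ z] dest: spec[of _ 1])
    qed
    then obtain z where z: "z > Max A" "z < b" "F' z = 0" by blast
    have mn: "Min (insert b A) = Min A" using insert False mx
      by (metis Min_insert Max_ge Min_in min.absorb2 order.strict_trans1 less_imp_le)
    have mxb: "Max (insert b A) = b" using insert False mx by simp
    have le: "Min A \<le> Max A" using insert False by simp
    have "card A > 0" using insert False by (simp add: card_gt_0_iff)
    moreover have "z \<notin> Y" using Y z by auto
    ultimately have "card (insert z Y) = card (insert b A) - 1" using Y insert.hyps by auto
    then show ?thesis unfolding mn mxb using Y z le mx
      by (intro exI[of _ "insert z Y"]) auto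
  qed
qed simp

lemma exp_sol_Rolle:
  assumes f: "exp_sol (a # as) f" and Z: "finite Z" "Z \<noteq> {}" "\<And>z. z \<in> Z \<Longrightarrow> f z = 0"
  shows "\<exists>Y. finite Y \<and> card Y = card Z - 1 \<and> Y \<subseteq> {Min Z<..<Max Z} \<and>
    (\<forall>y\<in>Y. deriv f y + a * f y = 0)"
  using Rolle_finite_set[OF Z(1,2) _ exp_sol_weighted_DERIV[OF f, of a]] Z(3) by simp

lemma exp_sol_eq_0_if_first_order_eq_0:
  assumes f: "exp_sol as f" and "\<And>t. deriv f t + a * f t = 0" "f z = 0"
  shows "f t = 0"
proof -
  have "((\<lambda>t. exp (a * t) * f t) has_real_derivative 0) (at t)" for t
    using exp_sol_weighted_DERIV[OF f, of a t] assms(2) by simp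
  then have "exp (a * t) * f t = exp (a * z) * f z"
    by (intro DERIV_isconst_all) auto
  then show ?thesis using assms(3) by simp
qed

text \<open>Rolle's theorem costs one zero while passing to (D + a) f shortens the list by one. And
  (D + a) f is not identically 0: otherwise exp (a t) f would be constant, hence 0 because f has a
  zero.\<close>

lemma exp_sol_zeros_less:
  "exp_sol as f \<Longrightarrow> f t0 \<noteq> 0 \<Longrightarrow> finite Z \<Longrightarrow> (\<And>z. z \<in> Z \<Longrightarrow> f z = 0) \<Longrightarrow> card Z < length as"
proof (induction as arbitrary: f Z t0)
  case (Cons a as)
  show ?case
  proof (cases "Z = {}")
    case False
    let ?g = "\<lambda>t. deriv f t + a * f t"
    obtain Y where Y: "finite Y" "card Y = card Z - 1" "\<forall>y\<in>Y. ?g y = 0"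
      using exp_sol_Rolle[OF Cons.prems(1,3) False Cons.prems(4)] by blast
    obtain z where z: "z \<in> Z" using False by auto
    obtain t1 where "?g t1 \<noteq> 0"
      using exp_sol_eq_0_if_first_order_eq_0[OF Cons.prems(1), of a z t0] Cons.prems(2,4) z by blast
    from Cons.IH[OF exp_sol_ConsD[OF Cons.prems(1)] this Y(1)] Y(3) have "card Y < length as" by blast
    then show ?thesis using Y(2) by simp
  qed simp
qed simp

text \<open>If f has the maximal number of zeros, so does (D + a) f, and its zeros lie strictly
  between the extreme zeros of f. Outside these exp (a t) f is strictly monotone: to the right f
  takes the sign of (D + a) f, to the left the opposite one, so every removed factor contributes one
  power of -1.\<close>

lemma exp_sol_sign:
  "exp_sol as f \<Longrightarrow> f t0 \<noteq> 0 \<Longrightarrow> finite Z \<Longrightarrow> (\<And>z. z \<in> Z \<Longrightarrow> f z = 0) \<Longrightarrow> length as = Suc (card Z) \<Longrightarrow>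
   \<exists>s\<in>{1,-1}. (\<forall>t. (\<forall>z\<in>Z. z < t) \<longrightarrow> s * f t > 0) \<and>
     (\<forall>t. (\<forall>z\<in>Z. t < z) \<longrightarrow> (-1) ^ card Z * s * f t > 0)"
proof (induction as arbitrary: f Z t0)
  case (Cons a as)
  let ?g = "\<lambda>t. deriv f t + a * f t"
  let ?F = "\<lambda>t. exp (a * t) * f t"
  note f = Cons.prems(1)
  have g: "exp_sol as ?g" by (rule exp_sol_ConsD[OF f])
  have F: "(?F has_real_derivative exp (a * t) * ?g t) (at t)" for t by (rule exp_sol_weighted_DERIV[OF f])
  show ?case
  proof (cases "Z = {}")
    case True
    then have "as = []" using Cons.prems by simp
    with g have "?g t = 0" for t by (auto dest: fun_cong[of _ _ t])
    with exp_sol_eq_0_if_first_order_eq_0[OF f this] Cons.prems(2) have nz: "f t \<noteq> 0" for t by blast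
    have c: "continuous_on X f" for X by (rule exp_sol_continuous_on[OF f])
    have "\<not> (f u < 0 \<and> f v > 0)" for u v
    proof
      assume *: "f u < 0 \<and> f v > 0"
      have "\<exists>x. f x = 0"
      proof (cases "u \<le> v")
        case True then show ?thesis using IVT'[of f u 0 v] * c by force
      next
        case False then show ?thesis using IVT2'[of f u 0 v] * c by force
      qed
      with nz show False by blast
    qed
    then have "(\<forall>t. f t > 0) \<or> (\<forall>t. f t < 0)" using nz by (meson linorder_neqE)
    then show ?thesis using True by auto
  next
    case False
    obtain Y where Y: "finite Y" "card Y = card Z - 1" "Y \<subseteq> {Min Z<..<Max Z}" "\<forall>y\<in>Y. ?g y = 0"
      using exp_sol_Rolle[OF f Cons.prems(3) False Cons.prems(4)] by blast
    have cZ: "card Z > 0" using False Cons.prems(3) by (simp add: card_gt_0_iff)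
    obtain z where z: "z \<in> Z" using False by auto
    obtain t1 where t1: "?g t1 \<noteq> 0"
      using exp_sol_eq_0_if_first_order_eq_0[OF f, of a z t0] Cons.prems(2,4) z by blast
    have "length as = Suc (card Y)" using Cons.prems(5) Y(2) cZ by simp
    from Cons.IH[OF g t1 Y(1) _ this] Y(4)
    obtain s where s: "s \<in> {1,-1}" and r: "\<And>t. (\<forall>z\<in>Y. z < t) \<Longrightarrow> s * ?g t > 0"
      and l: "\<And>t. (\<forall>z\<in>Y. t < z) \<Longrightarrow> (-1) ^ card Y * s * ?g t > 0" by blast
    have mx: "Max Z \<in> Z" "f (Max Z) = 0" and mn: "Min Z \<in> Z" "f (Min Z) = 0"
      using False Cons.prems by auto
    show ?thesis
    proof (intro bexI[OF _ s] conjI allI impI)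
      fix t assume "\<forall>z\<in>Z. z < t"
      then have t: "Max Z < t" using mx by auto
      have "s * ?F (Max Z) < s * ?F t"
      proof (rule DERIV_pos_imp_increasing[OF t])
        fix x assume "Max Z \<le> x" "x \<le> t"
        then have "s * ?g x > 0" using Y(3) by (intro r) auto
        then show "\<exists>y. ((\<lambda>t. s * ?F t) has_real_derivative y) (at x) \<and> 0 < y"
          by (intro exI[of _ "s * (exp (a * x) * ?g x)"] conjI DERIV_cmult F)
             (metis exp_gt_zero mult.left_commute mult_pos_pos)
      qed
      then have "0 < exp (a * t) * (s * f t)" using mx by (simp add: algebra_simps)
      then show "0 < s * f t" by (simp add: zero_less_mult_iff)
    next
      fix t assume "\<forall>z\<in>Z. t < z"
      then have t: "t < Min Z" using mn by auto
      let ?c = "(-1) ^ card Y * s"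
      have "?c * ?F t < ?c * ?F (Min Z)"
      proof (rule DERIV_pos_imp_increasing[OF t])
        fix x assume "t \<le> x" "x \<le> Min Z"
        then have "?c * ?g x > 0" using Y(3) by (intro l) auto
        then show "\<exists>y. ((\<lambda>t. ?c * ?F t) has_real_derivative y) (at x) \<and> 0 < y"
          by (intro exI[of _ "?c * (exp (a * x) * ?g x)"] conjI DERIV_cmult F)
             (metis exp_gt_zero mult.left_commute mult_pos_pos)
      qed
      then have "exp (a * t) * (?c * f t) < 0" using mn by (simp add: algebra_simps)
      then have "?c * f t < 0" by (simp add: mult_less_0_iff)
      moreover have "(-1) ^ card Z = - ((-1::real) ^ card Y)" using Y(2) cZ
        by (metis Suc_pred' diff_Suc_1 mult_minus1 power_Suc)
      ultimately show "0 < (-1) ^ card Z * s * f t" by simp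
    qed
  qed
qed simp

section \<open>Sign patterns and the comparison of exponents\<close>

lemma exp_sol_right_sign:
  assumes "exp_sol as f" "f t0 \<noteq> 0" "finite Z" "\<And>z. z \<in> Z \<Longrightarrow> f z = 0" "length as = Suc (card Z)"
  obtains s where "s \<in> {1,-1}" "\<And>t. (\<forall>z\<in>Z. z < t) \<Longrightarrow> s * f t > 0" "\<forall>\<^sub>F t in at_top. s * f t > 0"
proof -
  obtain s where s: "s \<in> {1,-1}" "\<And>t. (\<forall>z\<in>Z. z < t) \<Longrightarrow> s * f t > 0"
    using exp_sol_sign[OF assms] by blast
  have "\<forall>\<^sub>F t in at_top. \<forall>z\<in>Z. z < t"
    using assms(3) eventually_gt_at_top by (intro eventually_ball_finite) auto
  then have "\<forall>\<^sub>F t in at_top. s * f t > 0" by eventually_elim (rule s(2))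
  with s show ?thesis by (rule that)
qed

text \<open>The limit 0 at infinity acts as one more zero and makes up for the one that Rolle's
  theorem loses, so the derivative keeps the maximal number of zeros. The sign at infinity flips
  because \<open>s * f\<close> is eventually positive and tends to 0.\<close>

lemma exp_sol_deriv_step:
  assumes f: "exp_sol as f" and pos: "\<forall>a\<in>set as. 0 < a"
    and Z: "finite Z" "\<And>z. z \<in> Z \<Longrightarrow> f z = 0 \<and> z0 \<le> z" "length as = Suc (card Z)"
    and s: "s \<in> {1,-1}" "\<forall>\<^sub>F t in at_top. s * f t > 0"
  shows "\<exists>Y. finite Y \<and> card Y = card Z \<and> (\<forall>y\<in>Y. deriv f y = 0 \<and> z0 < y) \<and>
    (\<forall>\<^sub>F t in at_top. - s * deriv f t > 0)"
proof -
  have D: "(f has_real_derivative deriv f t) (at t)" for t by (rule exp_sol_DERIV[OF f])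
  have lim: "((\<lambda>t. s * f t) \<longlongrightarrow> 0) at_top"
    using tendsto_mult[OF tendsto_const exp_sol_tendsto_0[OF f pos], of s] by simp
  obtain T where T: "\<And>t. t \<ge> T \<Longrightarrow> s * f t > 0"
    using s(2) by (auto simp: eventually_at_top_linorder)
  have smaller: "\<exists>u>t. s * f u < s * f t" if "t \<ge> T" for t
  proof -
    have "\<forall>\<^sub>F u in at_top. s * f u < s * f t" using order_tendstoD(2)[OF lim] T[OF that] by blast
    with eventually_gt_at_top[of t] have "\<forall>\<^sub>F u in at_top. u > t \<and> s * f u < s * f t"
      by eventually_elim auto
    from eventually_happens[OF this] show ?thesis by auto
  qed
  have "\<exists>Y. finite Y \<and> card Y = card Z \<and> (\<forall>y\<in>Y. deriv f y = 0 \<and> z0 < y)"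
  proof (cases "Z = {}")
    case False
    obtain Y where Y: "finite Y" "card Y = card Z - 1" "Y \<subseteq> {Min Z<..<Max Z}" "\<forall>y\<in>Y. deriv f y = 0"
      using Rolle_finite_set[OF Z(1) False _ D] Z(2) by blast
    define t1 where "t1 = max T (Max Z + 1)"
    obtain t2 where t2: "t2 > t1" "s * f t2 < s * f t1" using smaller[of t1] by (auto simp: t1_def)
    have fz: "f (Max Z) = 0" using Z False by simp
    \<comment> \<open>\<open>s * f\<close> climbs from 0 at \<open>Max Z\<close> above its later
      value at \<open>t2\<close>, so it takes that value already at some \<open>t0\<close>; the
      critical point between \<open>t0\<close> and \<open>t2\<close> is the additional one.\<close>
    have "\<exists>t0\<ge>Max Z. t0 \<le> t1 \<and> s * f t0 = s * f t2"
    proof (rule IVT')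
      show "s * f (Max Z) \<le> s * f t2" using fz T[of t2] t2 by (simp add: t1_def)
      show "continuous_on {Max Z..t1} (\<lambda>t. s * f t)"
        by (intro continuous_intros exp_sol_continuous_on[OF f])
    qed (use t2 in \<open>auto simp: t1_def\<close>)
    then obtain t0 where t0: "t0 \<ge> Max Z" "t0 \<le> t1" "f t0 = f t2" using s(1) by auto
    have "\<exists>z>t0. z < t2 \<and> (\<lambda>h. deriv f z * h) = (\<lambda>v. 0)"
      using t0 t2 D by (intro Rolle_deriv[of _ _ f] exp_sol_continuous_on[OF f])
        (auto simp: has_field_derivative_def)
    then obtain y where y: "y > t0" "deriv f y = 0" by (auto simp: fun_eq_iff dest: spec[of _ 1])
    have "card Z > 0" using False Z(1) by (simp add: card_gt_0_iff)
    moreover have "y \<notin> Y" using Y y t0 by auto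
    moreover have "z0 < u" if "u \<in> insert y Y" for u
    proof -
      have "z0 \<le> Min Z" "Min Z \<le> Max Z" using Z(1,2) False by auto
      then show ?thesis using that Y(3) y t0 by auto
    qed
    ultimately show ?thesis using Y y
      by (intro exI[of _ "insert y Y"]) auto
  qed (auto intro!: exI[of _ "{}"])
  then obtain Y where Y: "finite Y" "card Y = card Z"
      "\<And>y. y \<in> Y \<Longrightarrow> deriv f y = 0" "\<And>y. y \<in> Y \<Longrightarrow> z0 < y" by auto
  have "\<exists>t. deriv f t \<noteq> 0"
  proof (rule ccontr)
    assume "\<nexists>t. deriv f t \<noteq> 0"
    then have "f t = f u" for t u using D DERIV_isconst_all[of f t u] by simp
    with smaller[of T] show False by (metis order_refl less_irrefl)
  qed
  then obtain t1 where "deriv f t1 \<noteq> 0" by blast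
  moreover have "length as = Suc (card Y)" using Y(2) Z(3) by simp
  ultimately obtain s' where s': "s' \<in> {1,-1}" and ev: "\<forall>\<^sub>F t in at_top. s' * deriv f t > 0"
    using exp_sol_right_sign[OF exp_sol_deriv[OF f] _ Y(1,3)] by blast
  have "s' = - s"
  proof (rule ccontr)
    assume "s' \<noteq> - s"
    then have [simp]: "s' = s" using s(1) s' by auto
    from ev obtain T' where T': "\<And>t. t \<ge> T' \<Longrightarrow> s * deriv f t > 0"
      by (auto simp: eventually_at_top_linorder)
    obtain u where u: "u > max T T'" "s * f u < s * f (max T T')" using smaller[of "max T T'"] by auto
    have "s * f (max T T') < s * f u"
      using u(1) T' D by (intro DERIV_pos_imp_increasing[of "max T T'" u "\<lambda>t. s * f t"])
        (auto intro!: exI DERIV_cmult)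
    with u show False by simp
  qed
  with ev Y show ?thesis by blast
qed

text \<open>Two differentiations keep the number of zeros, move them strictly right of 0 and flip
  the sign at infinity twice. Hence 0 lies to the left of \<open>card Z\<close> zeros of
  f''.\<close>

lemma exp_sol_second_deriv_sign:
  assumes f: "exp_sol as f" and pos: "\<forall>a\<in>set as. 0 < a"
    and Z: "finite Z" "\<And>z. z \<in> Z \<Longrightarrow> f z = 0 \<and> 0 \<le> z" "length as = Suc (card Z)"
    and s: "s \<in> {1,-1}" "\<forall>\<^sub>F t in at_top. s * f t > 0"
  shows "(-1) ^ card Z * s * deriv (deriv f) 0 > 0"
proof -
  obtain Y where Y: "finite Y" "card Y = card Z" "\<And>y. y \<in> Y \<Longrightarrow> deriv f y = 0 \<and> 0 < y"
    "\<forall>\<^sub>F t in at_top. - s * deriv f t > 0"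
    using exp_sol_deriv_step[OF f pos Z s] by blast
  note f' = exp_sol_deriv[OF f]
  have "length as = Suc (card Y)" "- s \<in> {1,-1}" using Y(2) Z(3) s(1) by auto
  from exp_sol_deriv_step[OF f' pos Y(1) _ this Y(4), of 0] Y(3)
  obtain X where X: "finite X" "card X = card Y" "\<And>x. x \<in> X \<Longrightarrow> deriv (deriv f) x = 0 \<and> 0 < x"
    "\<forall>\<^sub>F t in at_top. s * deriv (deriv f) t > 0"
    by (auto dest: less_imp_le)
  obtain T where T: "\<And>t. t \<ge> T \<Longrightarrow> s * deriv (deriv f) t > 0"
    using X(4) by (auto simp: eventually_at_top_linorder)
  have "deriv (deriv f) T \<noteq> 0" using T[of T] by auto
  moreover have "length as = Suc (card X)" using X(2) Y(2) Z(3) by simp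
  moreover have "deriv (deriv f) z = 0" if "z \<in> X" for z using X(3)[OF that] by blast
  ultimately obtain s' where s': "s' \<in> {1,-1}"
    "\<And>t. (\<forall>z\<in>X. z < t) \<Longrightarrow> s' * deriv (deriv f) t > 0"
    "\<And>t. (\<forall>z\<in>X. t < z) \<Longrightarrow> (-1) ^ card X * s' * deriv (deriv f) t > 0"
    using exp_sol_sign[OF exp_sol_deriv[OF f'] _ X(1), of T] by blast
  \<comment> \<open>Both sign statements apply at this point, which identifies \<open>s'\<close>
    with \<open>s\<close>.\<close>
  define u where "u = Max (insert T X) + 1"
  have "z \<le> Max (insert T X)" if "z \<in> insert T X" for z using that X(1) by (intro Max_ge) auto
  then have "\<forall>z\<in>X. z < u" "u \<ge> T" by (force simp: u_def)+
  then have "s' * deriv (deriv f) u > 0" "s * deriv (deriv f) u > 0" using s'(2) T by auto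
  then have "s' = s" using s'(1) s(1) by auto
  moreover have "(-1) ^ card X * s' * deriv (deriv f) 0 > 0" using X(3) by (intro s'(3)) blast
  moreover have "card X = card Z" using X(2) Y(2) by simp
  ultimately show ?thesis by simp
qed

lemma upto_Suc_mono_less:
  fixes x :: "nat \<Rightarrow> real"
  assumes "\<And>i. i < m \<Longrightarrow> x i < x (Suc i)" "i < j" "j \<le> m"
  shows "x i < x j"
  using assms(2,3)
proof (induction j)
  case (Suc j)
  show ?case
  proof (cases "i = j")
    case False
    then have "x i < x j" using Suc by simp
    then show ?thesis using assms(1)[of j] Suc.prems by simp
  qed (use assms(1)[of j] Suc.prems in simp)
qed simp

lemma upto_Suc_mono_inj:
  fixes x :: "nat \<Rightarrow> real"
  assumes "\<And>i. i < m \<Longrightarrow> x i < x (Suc i)"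
  shows "inj_on x {..m}"
proof (rule linorder_inj_onI')
  fix i j assume "i \<in> {..m}" "j \<in> {..m}" "i < j"
  then show "x i \<noteq> x j" using upto_Suc_mono_less[of m x i j, OF assms] by simp
qed

lemma alternating_zeros:
  fixes h :: "real \<Rightarrow> real" and x :: "nat \<Rightarrow> real"
  assumes "continuous_on UNIV h"
  shows "(\<And>i. i < m \<Longrightarrow> x i < x (Suc i)) \<Longrightarrow> (\<And>i. i \<le> m \<Longrightarrow> (-1) ^ i * h (x i) > 0) \<Longrightarrow>
    \<exists>Z. finite Z \<and> card Z = m \<and> (\<forall>z\<in>Z. h z = 0 \<and> x 0 < z \<and> z < x m)"
proof (induction m)
  case (Suc m)
  then obtain Z where Z: "finite Z" "card Z = m" "\<forall>z\<in>Z. h z = 0 \<and> x 0 < z \<and> z < x m" by auto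
  have lt: "x m < x (Suc m)" using Suc.prems(1) by simp
  have p: "(-1) ^ m * h (x m) > 0" "(-1) ^ m * h (x (Suc m)) < 0"
    using Suc.prems(2)[of m] Suc.prems(2)[of "Suc m"] by auto
  have "\<exists>z\<ge>x m. z \<le> x (Suc m) \<and> (-1) ^ m * h z = 0"
    using p lt assms by (intro IVT2') (auto intro!: continuous_intros intro: continuous_on_subset)
  then obtain z where z: "z \<ge> x m" "z \<le> x (Suc m)" "h z = 0" by auto
  have "h (x m) \<noteq> 0" "h (x (Suc m)) \<noteq> 0" using p by auto
  then have "z \<noteq> x m" "z \<noteq> x (Suc m)" using z(3) by metis+
  with z have z': "x m < z" "z < x (Suc m)" by auto
  have "x 0 \<le> x m"
    using upto_Suc_mono_less[of "Suc m" x 0 m] Suc.prems(1) by (cases m) auto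
  moreover have "u < x (Suc m)" if "u \<in> Z" for u using Z(3) that lt by force
  moreover have "z \<notin> Z" using Z(3) z' by force
  ultimately show ?case using Z z z' lt by (intro exI[of _ "insert z Z"]) auto
qed (auto intro: exI[of _ "{}"])

text \<open>The m sign changes already produce all zeros that order \<open>Suc m\<close> allows, so
  the sign at the last node persists to infinity.\<close>

lemma exp_sol_alternating:
  assumes h: "exp_sol as h" and len: "length as = Suc m"
    and x: "\<And>i. i < m \<Longrightarrow> x i < x (Suc i)" "\<And>i. i \<le> m \<Longrightarrow> (-1) ^ i * h (x i) > 0"
  shows "\<exists>Z. finite Z \<and> card Z = m \<and> (\<forall>z\<in>Z. h z = 0 \<and> x 0 < z) \<and>
    (\<forall>\<^sub>F t in at_top. (-1) ^ m * h t > 0)"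
proof -
  obtain Z where Z: "finite Z" "card Z = m" "\<And>z. z \<in> Z \<Longrightarrow> h z = 0 \<and> x 0 < z \<and> z < x m"
    using alternating_zeros[where h = h and m = m and x = x, OF exp_sol_continuous_on[OF h]] x by auto
  have "h (x 0) \<noteq> 0" using x(2)[of 0] by auto
  then obtain s where s: "s \<in> {1,-1}" "\<And>t. (\<forall>z\<in>Z. z < t) \<Longrightarrow> s * h t > 0"
    "\<forall>\<^sub>F t in at_top. s * h t > 0"
    by (rule exp_sol_right_sign[OF h _ Z(1)]) (use Z(2,3) len in auto)
  have "s * h (x m) > 0" "(-1) ^ m * h (x m) > 0" using s(2) Z(3) x(2) by auto
  then have "s = (-1) ^ m" using s(1) by (cases "even m") auto
  then show ?thesis using Z s(3) by blast
qed

text \<open>The sign at infinity is \<open>(-1) ^ m\<close>, and passing m zeros of h'' on the way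
  back to 0 contributes \<open>(-1) ^ m\<close> again.\<close>

lemma exp_sol_alternating_second_deriv:
  assumes h: "exp_sol as h" and pos: "\<forall>a\<in>set as. 0 < a" and len: "length as = Suc m"
    and x: "\<And>i. i < m \<Longrightarrow> x i < x (Suc i)" "x 0 \<ge> 0" "\<And>i. i \<le> m \<Longrightarrow> (-1) ^ i * h (x i) > 0"
  shows "deriv (deriv h) 0 > 0"
proof -
  obtain Z where Z: "finite Z" "card Z = m" "\<And>z. z \<in> Z \<Longrightarrow> h z = 0 \<and> x 0 < z"
    "\<forall>\<^sub>F t in at_top. (-1) ^ m * h t > 0"
    using exp_sol_alternating[of as h m x] h len x by blast
  have "(-1) ^ m \<in> {1,-1::real}" by (simp add: minus_one_power_iff)
  moreover have "h z = 0 \<and> 0 \<le> z" if "z \<in> Z" for z using Z(3)[OF that] x(2) by linarith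
  ultimately have "(-1) ^ card Z * (-1) ^ m * deriv (deriv h) 0 > 0"
    using Z(2,4) len by (intro exp_sol_second_deriv_sign[OF h pos Z(1)]) simp_all
  then show ?thesis by (simp add: Z(2))
qed

lemma deriv2_lincomb:
  assumes "exp_sol as f" "exp_sol bs g"
  shows "deriv (deriv (\<lambda>t. c * f t + d * g t)) t = c * deriv (deriv f) t + d * deriv (deriv g) t"
proof -
  have "deriv (\<lambda>t. c * f t + d * g t) t = c * deriv f t + d * deriv g t" for t
    by (rule DERIV_imp_deriv[OF DERIV_add[OF DERIV_cmult[OF exp_sol_DERIV[OF assms(1)]]
          DERIV_cmult[OF exp_sol_DERIV[OF assms(2)]]]])
  then have "deriv (\<lambda>t. c * f t + d * g t) = (\<lambda>t. c * deriv f t + d * deriv g t)" by blast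
  then show ?thesis
    using DERIV_imp_deriv[OF DERIV_add[OF DERIV_cmult[OF exp_sol_DERIV[OF exp_sol_deriv[OF assms(1)]]]
          DERIV_cmult[OF exp_sol_DERIV[OF exp_sol_deriv[OF assms(2)]]]], of c d t] by simp
qed

text \<open>At the nodes S takes the extreme values permitted to g, so (1 + \<delta>) S - g strictly
  alternates there for every \<delta> > 0; then \<delta> is made small.\<close>

lemma exp_sol_second_deriv_le_interpolant:
  assumes S: "exp_sol as S" and g: "exp_sol as g" and pos: "\<forall>a\<in>set as. 0 < a"
    and len: "length as = Suc m"
    and x: "\<And>i. i < m \<Longrightarrow> x i < x (Suc i)" "x 0 \<ge> 0"
    and Sx: "\<And>i. i \<le> m \<Longrightarrow> S (x i) = (-1) ^ i" and gx: "\<And>i. i \<le> m \<Longrightarrow> \<bar>g (x i)\<bar> \<le> 1"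
  shows "deriv (deriv g) 0 \<le> deriv (deriv S) 0"
proof (rule field_le_epsilon)
  fix e :: real assume "e > 0"
  define \<delta> where "\<delta> = e / (1 + \<bar>deriv (deriv S) 0\<bar>)"
  have \<delta>: "\<delta> > 0" using \<open>e > 0\<close> by (simp add: \<delta>_def add_pos_nonneg)
  have "deriv (deriv (\<lambda>t. (1 + \<delta>) * S t + (-1) * g t)) 0 > 0"
  proof (rule exp_sol_alternating_second_deriv[OF exp_sol_lincomb[OF S g] pos len x])
    fix i assume i: "i \<le> m"
    have "((-1) ^ i * g (x i)) \<le> 1" using gx[OF i] by (cases "even i") auto
    then show "0 < (-1) ^ i * ((1 + \<delta>) * S (x i) + (-1) * g (x i))"
      using \<delta> Sx[OF i] by (simp add: algebra_simps)
  qed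
  then have "deriv (deriv g) 0 < deriv (deriv S) 0 + \<delta> * deriv (deriv S) 0"
    unfolding deriv2_lincomb[OF S g] by (simp add: algebra_simps)
  moreover have "\<delta> * deriv (deriv S) 0 \<le> e"
  proof -
    have "\<delta> * deriv (deriv S) 0 \<le> \<delta> * (1 + \<bar>deriv (deriv S) 0\<bar>)" using \<delta> by (intro mult_left_mono) auto
    also have "\<dots> = e" by (simp add: \<delta>_def)
    finally show ?thesis .
  qed
  ultimately show "deriv (deriv g) 0 \<le> deriv (deriv S) 0 + e" by simp
qed

text \<open>Right of \<open>Max Z\<close> the function exp (a t) f starts from 0 and moves strictly
  in the direction given by (D + a) f, so f and (D + a) f share their sign at infinity. The zero
  count stays maximal for the shortened list.\<close>

lemma exp_sol_peel:
  assumes f: "exp_sol (a # as) f" and Z: "finite Z" "Z \<noteq> {}" "\<And>z. z \<in> Z \<Longrightarrow> f z = 0"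
    and len: "length as = card Z" and s: "s \<in> {1,-1}" "\<forall>\<^sub>F t in at_top. s * f t > 0"
  shows "\<exists>Y. finite Y \<and> Suc (card Y) = card Z \<and> (\<forall>y\<in>Y. deriv f y + a * f y = 0) \<and>
    (\<forall>\<^sub>F t in at_top. s * (deriv f t + a * f t) > 0)"
proof -
  let ?g = "\<lambda>t. deriv f t + a * f t"
  let ?F = "\<lambda>t. exp (a * t) * f t"
  have F: "(?F has_real_derivative exp (a * t) * ?g t) (at t)" for t by (rule exp_sol_weighted_DERIV[OF f])
  obtain Y where Y: "finite Y" "card Y = card Z - 1" "Y \<subseteq> {Min Z<..<Max Z}" "\<forall>y\<in>Y. ?g y = 0"
    using exp_sol_Rolle[OF f Z] by blast
  have cY: "Suc (card Y) = card Z" using Y(2) Z by (simp add: card_gt_0_iff)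
  obtain T where T: "\<And>t. t \<ge> T \<Longrightarrow> s * f t > 0" using s(2) by (auto simp: eventually_at_top_linorder)
  then have "f T \<noteq> 0" by force
  then obtain t1 where "?g t1 \<noteq> 0"
    using exp_sol_eq_0_if_first_order_eq_0[OF f] Z by (metis all_not_in_conv)
  then obtain s' where s': "s' \<in> {1,-1}" "\<And>t. (\<forall>z\<in>Y. z < t) \<Longrightarrow> s' * ?g t > 0"
    "\<forall>\<^sub>F t in at_top. s' * ?g t > 0"
    by (rule exp_sol_right_sign[OF exp_sol_ConsD[OF f] _ Y(1)]) (use Y(4) cY len in auto)
  have pos: "s' * f t > 0" if "t > Max Z" for t
  proof -
    have "s' * ?F (Max Z) < s' * ?F t"
    proof (rule DERIV_pos_imp_increasing[OF that])
      fix x assume "Max Z \<le> x" "x \<le> t"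
      then have "s' * ?g x > 0" using Y(3) by (intro s') auto
      then show "\<exists>y. ((\<lambda>t. s' * ?F t) has_real_derivative y) (at x) \<and> 0 < y"
        by (intro exI[of _ "s' * (exp (a * x) * ?g x)"] conjI DERIV_cmult F)
           (metis exp_gt_zero mult.left_commute mult_pos_pos)
    qed
    then have "0 < exp (a * t) * (s' * f t)" using Z by (simp add: algebra_simps)
    then show ?thesis by (simp add: zero_less_mult_iff)
  qed
  have "s' * f (max T (Max Z + 1)) > 0" "s * f (max T (Max Z + 1)) > 0" using pos T by auto
  then have "s' = s" using s(1) s'(1) by auto
  then show ?thesis using Y cY s'(3) by blast
qed

lemma exp_sol_singleton:
  assumes "exp_sol [a] f" shows "f t = f 0 * exp (- a * t)"
proof -
  have "deriv f t + a * f t = 0" for t using exp_sol_ConsD[OF assms] by (auto dest: fun_cong)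
  then have "((\<lambda>t. exp (a * t) * f t) has_real_derivative 0) (at t)" for t
    using exp_sol_weighted_DERIV[OF assms, of a t] by simp
  then have "exp (a * t) * f t = exp (a * 0) * f 0" by (intro DERIV_isconst_all) auto
  then show ?thesis by (simp add: exp_minus field_simps)
qed

text \<open>The slower exponential dominates at infinity, so \<open>s S\<close> eventually exceeds \<open>s T\<close> in the
  case of order 1; the zero counts are maximal, so the signs at infinity survive the peeling of first order
  factors that reduces to this case.\<close>
lemma exp_sol_eventually_less:
  assumes "b < c"
  shows "exp_sol (as @ [c]) T \<Longrightarrow> exp_sol (as @ [b]) S \<Longrightarrow>
    finite ZT \<Longrightarrow> card ZT = length as \<Longrightarrow> (\<And>z. z \<in> ZT \<Longrightarrow> T z = 0) \<Longrightarrow>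
    finite ZS \<Longrightarrow> card ZS = length as \<Longrightarrow> (\<And>z. z \<in> ZS \<Longrightarrow> S z = 0) \<Longrightarrow>
    finite Z \<Longrightarrow> card Z = Suc (length as) \<Longrightarrow> (\<And>z. z \<in> Z \<Longrightarrow> S z - T z = 0) \<Longrightarrow>
    s \<in> {1,-1} \<Longrightarrow> S t0 \<noteq> T t0 \<Longrightarrow>
    \<forall>\<^sub>F t in at_top. s * T t > 0 \<Longrightarrow> \<forall>\<^sub>F t in at_top. s * S t > 0 \<Longrightarrow>
    \<forall>\<^sub>F t in at_top. s * (S t - T t) > 0"
proof (induction as arbitrary: T S ZT ZS Z t0)
  case Nil
  have T: "T t = T 0 * exp (- c * t)" for t using exp_sol_singleton Nil(1) by simp
  have S: "S t = S 0 * exp (- b * t)" for t using exp_sol_singleton Nil(2) by simp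
  have "\<exists>t. s * S t > 0" using eventually_happens[OF Nil(15)] by auto
  then have S0: "s * S 0 > 0" using S by (metis exp_gt_zero mult.assoc zero_less_mult_pos2)
  have "filterlim (\<lambda>t. (c - b) * t) at_top at_top"
    using assms by (auto intro!: filterlim_tendsto_pos_mult_at_top[OF tendsto_const] filterlim_ident)
  then have "filterlim (\<lambda>t. exp ((c - b) * t)) at_top at_top"
    by (rule filterlim_compose[OF exp_at_top])
  then have "\<forall>\<^sub>F t in at_top. exp ((c - b) * t) > (s * T 0) / (s * S 0)"
    by (simp add: filterlim_at_top_dense)
  then show ?case
  proof eventually_elim
    case (elim t)
    then have "s * T 0 < exp ((c - b) * t) * (s * S 0)" using S0 by (simp only: pos_divide_less_eq)
    then have "s * T 0 < s * S 0 * exp ((c - b) * t)" by (simp only: mult.commute)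
    then have "s * T 0 * exp (- c * t) < s * S 0 * exp ((c - b) * t) * exp (- c * t)"
      by (intro mult_strict_right_mono) simp_all
    also have "\<dots> = s * S 0 * exp (- b * t)" by (simp add: mult.assoc algebra_simps flip: exp_add)
    finally show ?case unfolding S[of t] T[of t] by (simp add: algebra_simps)
  qed
next
  case (Cons a as)
  let ?D = "\<lambda>f t. deriv f t + a * f t"
  note T = Cons.prems(1)[unfolded append_Cons] and S = Cons.prems(2)[unfolded append_Cons]
  have "ZT \<noteq> {}" "ZS \<noteq> {}" using Cons.prems by auto
  from exp_sol_peel[OF T Cons.prems(3) this(1) Cons.prems(5) _ Cons.prems(12,14)] Cons.prems(4)
  obtain YT where YT: "finite YT" "card YT = length as" "\<And>z. z \<in> YT \<Longrightarrow> ?D T z = 0"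
    "\<forall>\<^sub>F t in at_top. s * ?D T t > 0" by auto
  from exp_sol_peel[OF S Cons.prems(6) \<open>ZS \<noteq> {}\<close> Cons.prems(8) _ Cons.prems(12,15)] Cons.prems(7)
  obtain YS where YS: "finite YS" "card YS = length as" "\<And>z. z \<in> YS \<Longrightarrow> ?D S z = 0"
    "\<forall>\<^sub>F t in at_top. s * ?D S t > 0" by auto
  let ?h = "\<lambda>t. S t - T t"
  have Sc: "exp_sol (c # a # as @ [b]) S" by (rule exp_sol_Cons_mono[OF S])
  have Tc: "exp_sol (c # a # as @ [b]) T"
    using exp_sol_Cons_mono[of "(a # as) @ [c]" T b] T exp_sol_move[of b "a # as @ [c]" "[]"]
      exp_sol_move[of c "a # as" "[b]"] by (simp del: exp_sol.simps)
  \<comment> \<open>The difference needs the operators of both sums, one more than either, which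
    matches its one additional zero. \<open>a\<close> is brought to the front so that all three
    functions lose the same factor.\<close>
  have h: "exp_sol (a # c # as @ [b]) ?h" using exp_sol_diff[OF Sc Tc] exp_sol_swap by blast
  have Dh: "?D ?h t = ?D S t - ?D T t" for t
  proof -
    have "deriv ?h t = deriv S t - deriv T t"
      using exp_sol_DERIV[OF S] exp_sol_DERIV[OF T] by (intro DERIV_imp_deriv DERIV_diff)
    then show ?thesis by (simp add: algebra_simps)
  qed
  have Zne: "Z \<noteq> {}" using Cons.prems by auto
  have h0: "?h t0 \<noteq> 0" using Cons.prems(13) by simp
  obtain s' where s': "s' \<in> {1,-1}" "\<forall>\<^sub>F t in at_top. s' * ?h t > 0"
    by (rule exp_sol_right_sign[OF h h0 Cons.prems(9,11)]) (use Cons.prems(10) in auto)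
  from exp_sol_peel[OF h Cons.prems(9) Zne Cons.prems(11) _ s'] Cons.prems(10)
  obtain Y where Y: "finite Y" "card Y = Suc (length as)" "\<And>y. y \<in> Y \<Longrightarrow> ?D ?h y = 0"
    "\<forall>\<^sub>F t in at_top. s' * ?D ?h t > 0" by auto
  obtain t1 where "s' * ?D ?h t1 > 0" using Y(4) by (auto simp: eventually_at_top_linorder)
  then have t1: "?D S t1 \<noteq> ?D T t1" unfolding Dh by auto
  have "\<forall>\<^sub>F t in at_top. s * (?D S t - ?D T t) > 0"
    by (rule Cons.IH[OF exp_sol_ConsD[OF T] exp_sol_ConsD[OF S] YT(1,2,3) YS(1,2,3) Y(1,2) _
          Cons.prems(12) t1 YT(4) YS(4)]) (use Y(3) Dh in auto)
  with Y(4) have "\<forall>\<^sub>F t in at_top. s * (?D S t - ?D T t) > 0 \<and> s' * (?D S t - ?D T t) > 0"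
    unfolding Dh by eventually_elim auto
  then obtain u where "s * (?D S u - ?D T u) > 0 \<and> s' * (?D S u - ?D T u) > 0"
    by (auto simp: eventually_at_top_linorder)
  then have "s = s'" using s'(1) Cons.prems(12) by auto
  with s'(2) show ?case by simp
qed

text \<open>S - T has order m + 2 and, unless it is 0, the maximal number m + 1 of zeros, namely the
  nodes. Its sign at infinity is \<open>(-1) ^ m\<close> because the slower exponential wins, and
  going back across m + 1 zeros makes the second derivative at 0 negative.\<close>

lemma exp_sol_second_deriv_mono_exponent:
  assumes "b \<le> c" and T: "exp_sol (c # as) T" and S: "exp_sol (b # as) S"
    and pos: "0 < b" "\<forall>a\<in>set as. 0 < a" and len: "length as = m"
    and x: "\<And>i. i < m \<Longrightarrow> x i < x (Suc i)" "x 0 \<ge> 0"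
    and Sx: "\<And>i. i \<le> m \<Longrightarrow> S (x i) = (-1) ^ i" and Tx: "\<And>i. i \<le> m \<Longrightarrow> T (x i) = (-1) ^ i"
  shows "deriv (deriv S) 0 \<le> deriv (deriv T) 0"
proof (cases "b = c")
  case True
  then show ?thesis
    using exp_sol_second_deriv_le_interpolant[OF T, of S m x] assms by (auto simp del: exp_sol.simps)
next
  case False
  then have bc: "b < c" using assms(1) by simp
  let ?h = "\<lambda>t. S t - T t"
  show ?thesis
  proof (cases "\<exists>t0. S t0 \<noteq> T t0")
    case True
    then obtain t0 where t0: "S t0 \<noteq> T t0" by blast
    have T': "exp_sol (as @ [c]) T" and S': "exp_sol (as @ [b]) S"
      using exp_sol_move[of _ as "[]"] T S by auto
    have alt: "(-1) ^ i * T (x i) > 0" "(-1) ^ i * S (x i) > 0" if "i \<le> m" for i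
      using Tx[OF that] Sx[OF that] by simp_all
    have len': "length (d # as) = Suc m" for d using len by simp
    obtain ZT where ZT: "finite ZT" "card ZT = m" "\<And>z. z \<in> ZT \<Longrightarrow> T z = 0"
      "\<forall>\<^sub>F t in at_top. (-1) ^ m * T t > 0"
      using exp_sol_alternating[of _ T m x, OF T len' x(1) alt(1)] by blast
    obtain ZS where ZS: "finite ZS" "card ZS = m" "\<And>z. z \<in> ZS \<Longrightarrow> S z = 0"
      "\<forall>\<^sub>F t in at_top. (-1) ^ m * S t > 0"
      using exp_sol_alternating[of _ S m x, OF S len' x(1) alt(2)] by blast
    have sgn: "(-1) ^ m \<in> {1,-1::real}" by (simp add: minus_one_power_iff)
    define Z where "Z = x ` {..m}"
    have inj: "inj_on x {..m}" by (rule upto_Suc_mono_inj[of m x, OF x(1)])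
    have Z: "finite Z" "card Z = Suc m" using inj by (auto simp: Z_def card_image)
    have xge: "x i \<ge> 0" if "i \<le> m" for i
      using that x(2) upto_Suc_mono_less[of m x 0 i, OF x(1)] by (cases i) auto
    have hZ: "?h z = 0" if "z \<in> Z" for z using that Sx Tx by (auto simp: Z_def)
    have "\<forall>\<^sub>F t in at_top. (-1) ^ m * ?h t > 0"
      by (rule exp_sol_eventually_less[OF bc T' S' ZT(1) _ ZT(3) ZS(1) _ ZS(3) Z(1) _ hZ sgn t0 ZT(4) ZS(4)])
        (simp_all add: ZT ZS Z len)
    moreover have h: "exp_sol (b # c # as) ?h"
      using exp_sol_diff[OF exp_sol_Cons_mono[OF S, of c] exp_sol_swap[OF exp_sol_Cons_mono[OF T, of b]]]
        exp_sol_swap by blast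
    ultimately have "(-1) ^ card Z * (-1) ^ m * deriv (deriv ?h) 0 > 0"
      using pos bc len Z
      by (intro exp_sol_second_deriv_sign[OF h _ Z(1) _ _ sgn]) (auto simp: hZ Z_def xge)
    then have "deriv (deriv ?h) 0 < 0" using Z(2) by (cases "even m") auto
    moreover have "deriv (deriv ?h) 0 = deriv (deriv S) 0 - deriv (deriv T) 0"
      using deriv2_lincomb[OF S T, of 1 "-1" 0] by (simp only: mult_1 mult_minus1 add_uminus_conv_diff)
    ultimately show ?thesis by simp
  qed (metis ext order_refl)
qed

section \<open>Interpolation by exponential sums\<close>

lemma antiderivative_real_line:
  fixes u :: "real \<Rightarrow> real"
  assumes "continuous_on UNIV u"
  obtains F where "\<And>t. (F has_real_derivative u t) (at t)"
proof
  fix t :: real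
  let ?a = "- \<bar>t\<bar> - 1" and ?b = "\<bar>t\<bar> + 1"
  have "((\<lambda>v. LBINT y=ereal 0..v. u y) has_vector_derivative u t) (at t within {?a..?b})"
    by (rule interval_integral_FTC2) (auto intro: continuous_on_subset[OF assms])
  moreover have "at t within {?a..?b} = at t" by (rule at_within_Icc_at) auto
  ultimately show "((\<lambda>v. LBINT y=ereal 0..v. u y) has_real_derivative u t) (at t)"
    by (simp add: has_real_derivative_iff_has_vector_derivative)
qed

lemma exp_sol_first_order_solution:
  assumes "exp_sol as u"
  obtains e where "exp_sol (b # as) e" "\<And>t. deriv e t + b * e t = u t"
proof -
  have "continuous_on UNIV (\<lambda>t. exp (b * t) * u t)"
    by (intro continuous_intros exp_sol_continuous_on[OF assms])
  then obtain F where F: "\<And>t. (F has_real_derivative exp (b * t) * u t) (at t)"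
    using antiderivative_real_line by blast
  define e where "e = (\<lambda>t. exp (- b * t) * F t)"
  have e: "(e has_real_derivative u t - b * e t) (at t)" for t
    unfolding e_def
    by (rule derivative_eq_intros F refl | simp add: algebra_simps flip: exp_add)+
  show ?thesis
  proof (rule that)
    show "exp_sol (b # as) e" by (rule exp_sol_ConsI[OF assms e])
    show "deriv e t + b * e t = u t" for t using DERIV_imp_deriv[OF e] by simp
  qed
qed

text \<open>For a repeated entry exp (- a t) is not new. Solving (D + b) e = u with a
  \<open>u\<close> that is new for the shorter list works for all multiplicities: if e were
  annihilated without \<open>a\<close>, so would be \<open>u\<close>.\<close>

lemma exp_sol_Cons_new: "\<exists>e. exp_sol (a # as) e \<and> \<not> exp_sol as e"
proof (induction as)
  case Nil
  have "exp_sol [a] (\<lambda>t. exp (- a * t))"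
    by (rule exp_sol_ConsI[OF exp_sol_zero]) (auto intro!: derivative_eq_intros)
  moreover have "\<not> exp_sol [] (\<lambda>t. exp (- a * t))" by (auto simp: fun_eq_iff)
  ultimately show ?case by blast
next
  case (Cons b bs)
  then obtain u where u: "exp_sol (a # bs) u" "\<not> exp_sol bs u" by blast
  obtain e where e: "exp_sol (b # a # bs) e" "\<And>t. deriv e t + b * e t = u t"
    using exp_sol_first_order_solution[OF u(1)] by blast
  have "\<not> exp_sol (b # bs) e" using exp_sol_ConsD[of b bs e] e(2) u(2) by auto
  with exp_sol_swap[OF e(1)] show ?case by blast
qed

text \<open>Newton's scheme: a new solution minus its own interpolant vanishes at the earlier nodes,
  hence by the zero count not at the next one, and a multiple of it corrects the value
  there.\<close>

lemma exp_sol_interpolate: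
  fixes x y :: "nat \<Rightarrow> real"
  assumes "inj_on x {..<length as}"
  shows "\<exists>S. exp_sol as S \<and> (\<forall>i<length as. S (x i) = y i)"
  using assms
proof (induction as arbitrary: y)
  case (Cons a as)
  have inj: "inj_on x {..<length as}" by (rule inj_on_subset[OF Cons.prems]) auto
  obtain S0 where S0: "exp_sol as S0" "\<forall>i<length as. S0 (x i) = y i" using Cons.IH[OF inj] by blast
  obtain e where e: "exp_sol (a # as) e" "\<not> exp_sol as e" using exp_sol_Cons_new by blast
  obtain I where I: "exp_sol as I" "\<forall>i<length as. I (x i) = e (x i)"
    using Cons.IH[OF inj, of "\<lambda>i. e (x i)"] by blast
  define h where "h = (\<lambda>t. e t - I t)"
  have h: "exp_sol (a # as) h"
    unfolding h_def by (rule exp_sol_diff[OF e(1) exp_sol_Cons_mono[OF I(1)]])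
  have "\<exists>t. h t \<noteq> 0"
  proof (rule ccontr)
    assume "\<nexists>t. h t \<noteq> 0"
    then have "e = I" by (auto simp: h_def fun_eq_iff)
    with I(1) e(2) show False by simp
  qed
  then obtain t0 where t0: "h t0 \<noteq> 0" by blast
  have hx: "h (x (length as)) \<noteq> 0"
  proof
    assume "h (x (length as)) = 0"
    then have "card (x ` {..<length (a # as)}) < length (a # as)"
      using I(2) by (intro exp_sol_zeros_less[OF h t0]) (auto simp: h_def less_Suc_eq)
    with card_image[OF Cons.prems] show False by simp
  qed
  define c where "c = (y (length as) - S0 (x (length as))) / h (x (length as))"
  have "exp_sol (a # as) (\<lambda>t. 1 * S0 t + c * h t)"
    by (rule exp_sol_lincomb[OF exp_sol_Cons_mono[OF S0(1)] h])
  moreover have "1 * S0 (x i) + c * h (x i) = y i" if "i < length (a # as)" for i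
  proof (cases "i < length as")
    case True
    then show ?thesis using S0(2) I(2) by (simp add: h_def)
  next
    case False
    then have "i = length as" using that by simp
    then show ?thesis using hx by (simp add: c_def)
  qed
  ultimately show ?case by blast
qed simp

text \<open>Started with \<open>bs\<close> empty, the induction collects in \<open>bs\<close> the
  exponents already moved to \<open>c\<close>. All intermediate sums take the same values at the
  nodes of T, so the comparisons of single exponents chain together.\<close>

lemma exp_sol_second_deriv_le_equal_exponents:
  assumes x: "\<And>i. i < m \<Longrightarrow> x i < x (Suc i)" "x 0 \<ge> 0"
    and Tx: "\<And>i. i \<le> m \<Longrightarrow> T (x i) = (-1) ^ i"
  shows "exp_sol (as @ bs) S \<Longrightarrow> (\<And>i. i \<le> m \<Longrightarrow> S (x i) = (-1) ^ i) \<Longrightarrow>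
    exp_sol (replicate (length as) c @ bs) T \<Longrightarrow> length as + length bs = Suc m \<Longrightarrow>
    \<forall>a\<in>set as \<union> set bs. 0 < a \<and> a \<le> c \<Longrightarrow> deriv (deriv S) 0 \<le> deriv (deriv T) 0"
proof (induction as arbitrary: bs S)
  case Nil
  then have "exp_sol bs S" "exp_sol bs T" by simp_all
  then show ?case using Nil x Tx by (intro exp_sol_second_deriv_le_interpolant[where x = x and m = m]) auto
next
  case (Cons a as)
  have c: "0 < c" "a \<le> c" "0 < a" using Cons.prems(5) by force+
  have inj: "inj_on x {..m}" by (rule upto_Suc_mono_inj[of m x, OF x(1)])
  moreover have len: "length (c # as @ bs) = Suc m" using Cons.prems(4) by simp
  ultimately obtain T1 where T1: "exp_sol (c # as @ bs) T1" "\<And>i. i \<le> m \<Longrightarrow> T1 (x i) = (-1) ^ i"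
    using exp_sol_interpolate[of x "c # as @ bs" "\<lambda>i. (-1) ^ i"] 
    unfolding len lessThan_Suc_atMost less_Suc_eq_le by blast
  have "deriv (deriv S) 0 \<le> deriv (deriv T1) 0"
    by (rule exp_sol_second_deriv_mono_exponent[OF c(2) T1(1) Cons.prems(1)[unfolded append_Cons] c(3) _ _ x
          Cons.prems(2) T1(2)]) (use Cons.prems(4,5) in auto)
  also have "\<dots> \<le> deriv (deriv T) 0"
  proof (rule Cons.IH)
    show "exp_sol (as @ c # bs) T1" using T1(1) exp_sol_move by blast
    show "exp_sol (replicate (length as) c @ c # bs) T"
      using Cons.prems(3) by (simp add: replicate_app_Cons_same del: exp_sol.simps)
  qed (use T1 Cons.prems c in auto)
  finally show ?case .
qed

section \<open>Second derivatives at arbitrary points and for arbitrary rates\<close>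

lemma deriv2_shift:
  assumes "exp_sol as f" shows "deriv (deriv (\<lambda>t. f (t + c))) t = deriv (deriv f) (t + c)"
proof -
  have *: "deriv (\<lambda>t. g (t + c)) = (\<lambda>t. deriv g (t + c))" if "exp_sol as g" for g
    by (intro ext DERIV_imp_deriv DERIV_shift[THEN iffD1] exp_sol_DERIV[OF that])
  show ?thesis by (simp add: *[OF assms] *[OF exp_sol_deriv[OF assms]])
qed

lemma deriv2_scale:
  assumes "exp_sol as f" shows "deriv (deriv (\<lambda>t. f (c * t))) t = c ^ 2 * deriv (deriv f) (c * t)"
proof -
  have *: "deriv (\<lambda>t. d * g (c * t)) = (\<lambda>t. (d * c) * deriv g (c * t))" if "exp_sol as g" for g d
  proof (intro ext DERIV_imp_deriv)
    fix t
    have "((\<lambda>t. g (c * t)) has_real_derivative deriv g (c * t) * c) (at t)"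
      by (rule DERIV_chain2[OF exp_sol_DERIV[OF that]]) (auto intro!: derivative_eq_intros)
    from DERIV_cmult[OF this, of d]
    show "((\<lambda>t. d * g (c * t)) has_real_derivative d * c * deriv g (c * t)) (at t)"
      by (simp add: mult_ac)
  qed
  show ?thesis using *[OF assms, of 1] *[OF exp_sol_deriv[OF assms], of c]
    by (simp add: power2_eq_square)
qed

text \<open>Translation by t and scaling of time by 1 / R lead to the second derivative at 0 and to
  rates in (0, 1], at the cost of R^2. Division by B normalises, and entries 1 in front fill the
  list up to order \<open>Suc m\<close>.\<close>

lemma exp_sol_second_deriv_bound:
  assumes T: "exp_sol (replicate (Suc m) 1) T"
    and x: "\<And>i. i < m \<Longrightarrow> x i < x (Suc i)" "x 0 \<ge> 0" and Tx: "\<And>i. i \<le> m \<Longrightarrow> T (x i) = (-1) ^ i"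
    and g: "exp_sol as g" "length as \<le> Suc m" "\<forall>a\<in>set as. 0 < a \<and> a \<le> R" "R > 0"
    and bd: "\<And>t. t \<ge> 0 \<Longrightarrow> \<bar>g t\<bar> \<le> B" and B: "B > 0" and t: "t \<ge> 0"
  shows "\<bar>deriv (deriv g) t\<bar> \<le> deriv (deriv T) 0 * R ^ 2 * B"
proof -
  have x0: "x i \<ge> 0" if "i \<le> m" for i
    using that x(2) upto_Suc_mono_less[of m x 0 i, OF x(1)] by (cases i) auto
  let ?as = "replicate (Suc m - length as) 1 @ map ((*) (1 / R)) as"
  let ?g = "\<lambda>s. g (1 / R * s + t)"
  have main: "c * deriv (deriv g) t \<le> deriv (deriv T) 0 * R ^ 2 * B" if c: "c \<in> {1,-1}" for c
  proof -
    have gt: "exp_sol as (\<lambda>s. g (s + t))" by (rule exp_sol_shift[OF g(1)])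
    have gs: "exp_sol ?as ?g"
      using exp_sol_append_mono[OF exp_sol_scale[OF gt, of "1 / R"]] by simp
    have cg: "exp_sol ?as (\<lambda>s. c / B * ?g s)" by (rule exp_sol_cmult[OF gs])
    have len: "length ?as = Suc m" using g(2) by simp
    have as: "\<forall>a\<in>set ?as. 0 < a \<and> a \<le> 1" using g(3,4) by auto
    have inj: "inj_on x {..m}" by (rule upto_Suc_mono_inj[of m x, OF x(1)])
    then obtain S where S: "exp_sol ?as S" "\<And>i. i \<le> m \<Longrightarrow> S (x i) = (-1) ^ i"
      using exp_sol_interpolate[of x ?as "\<lambda>i. (-1) ^ i"]
      unfolding len lessThan_Suc_atMost less_Suc_eq_le by blast
    have "deriv (deriv (\<lambda>s. c / B * ?g s)) 0 \<le> deriv (deriv S) 0"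
    proof (rule exp_sol_second_deriv_le_interpolant[where x = x and m = m, OF S(1) cg _ len x S(2)])
      fix i assume "i \<le> m"
      then have "\<bar>?g (x i)\<bar> \<le> B" using x0[of i] t g(4) by (intro bd) auto
      then show "\<bar>c / B * ?g (x i)\<bar> \<le> 1" using c B by (auto simp: abs_mult divide_le_eq)
    qed (use as in auto)
    also have "\<dots> \<le> deriv (deriv T) 0"
      using exp_sol_second_deriv_le_equal_exponents[where x = x and m = m and as = ?as and bs = "[]" and c = 1
          and S = S and T = T] x Tx S T len as by (simp del: exp_sol.simps replicate.simps)
    also have "deriv (deriv (\<lambda>s. c / B * ?g s)) 0 = c / B * ((1 / R) ^ 2 * deriv (deriv g) t)"
      using deriv2_lincomb[OF gs gs, of "c / B" 0 0] deriv2_scale[OF gt, of "1 / R" 0] deriv2_shift[OF g(1), of t 0]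
      by simp
    finally show ?thesis using B g(4) by (simp add: field_simps)
  qed
  show ?thesis using main[of 1] main[of "-1"] by (simp add: abs_le_iff)
qed

section \<open>Equioscillation of the extremal exponential polynomial\<close>

lemma prod_list_pos_real:
  "(\<And>x. x \<in> set xs \<Longrightarrow> (0::real) < f x) \<Longrightarrow> 0 < prod_list (map f xs)"
  by (induction xs) auto

text \<open>Chebyshev's dichotomy. X is cut at y, its first point whose sign differs from that at
  the minimum a, and the part from y on is treated by induction. Factors z - t with z beyond
  \<open>Inf X\<close> keep the product positive at the left end.\<close>

lemma alternation_or_separating_polynomial:
  fixes f :: "real \<Rightarrow> real"
  assumes cont: "continuous_on UNIV f"
  shows "closed X \<Longrightarrow> bdd_below X \<Longrightarrow> X \<noteq> {} \<Longrightarrow> (\<And>t. t \<in> X \<Longrightarrow> f t \<noteq> 0) \<Longrightarrow>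
    (\<exists>x. (\<forall>i\<le>n. x i \<in> X) \<and> (\<forall>i<n. x i < x (Suc i) \<and> f (x i) * f (x (Suc i)) < 0)) \<or>
    (\<exists>zs \<sigma>. length zs < n \<and> (\<forall>z\<in>set zs. Inf X < z) \<and> (\<forall>t\<in>X. \<sigma> * prod_list (map (\<lambda>z. z - t) zs) * f t > 0))"
proof (induction n arbitrary: X)
  case 0
  then show ?case using closed_contains_Inf[of X] by (auto intro!: exI[of _ "\<lambda>_. Inf X"])
next
  case (Suc n)
  note X = Suc.prems
  define a where "a = Inf X"
  have a: "a \<in> X" unfolding a_def using X by (intro closed_contains_Inf)
  have aX: "a \<le> t" if "t \<in> X" for t unfolding a_def using X that by (intro cInf_lower)
  define Y where "Y = X \<inter> {t. f a * f t \<le> 0}"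
  have Y: "t \<in> Y \<longleftrightarrow> t \<in> X \<and> f a * f t < 0" for t
    using X(4)[OF a] X(4)[of t] by (auto simp: Y_def less_le)
  show ?case
  proof (cases "Y = {}")
    case True
    then have "f a * f t > 0" if "t \<in> X" for t
      using that Y[of t] X(4)[OF a] X(4)[OF that] by (metis empty_iff linorder_neqE_linordered_idom mult_eq_0_iff)
    then show ?thesis by (intro disjI2 exI[of _ "[]"] exI[of _ "f a"]) auto
  next
    case False
    have "closed Y" unfolding Y_def
      using X(1) by (intro closed_Int closed_Collect_le continuous_intros cont)
    moreover have bY: "bdd_below Y" using X(2) by (auto simp: Y_def bdd_below_def)
    ultimately have yY: "Inf Y \<in> Y" using False by (intro closed_contains_Inf)
    define y where "y = Inf Y"
    have y: "y \<in> X" "f a * f y < 0" using yY Y by (auto simp: y_def)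
    have yle: "y \<le> t" if "t \<in> X" "f a * f t < 0" for t
      unfolding y_def using that Y bY by (intro cInf_lower) auto
    have "f a * f a > 0" using X(4)[OF a] by (metis not_real_square_gt_zero)
    then have "a \<noteq> y" using y(2) by auto
    then have ay: "a < y" using aX[OF y(1)] by simp
    define W where "W = X \<inter> {t. f a * f t \<ge> 0} \<inter> {..y}"
    have "closed W" unfolding W_def
      using X(1) by (intro closed_Int closed_Collect_le continuous_intros cont closed_atMost)
    moreover have "a \<in> W" using a ay \<open>f a * f a > 0\<close> by (auto simp: W_def)
    moreover have bW: "bdd_above W" by (auto simp: W_def)
    ultimately have x0: "Sup W \<in> W" by (intro closed_contains_Sup) auto
    have x0y: "Sup W < y" using x0 y by (auto simp: W_def less_le)
    \<comment> \<open>\<open>Sup W\<close> is the last point of X before y, and f has the sign of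
      f(a) up to there; z lies in the gap between this block and y.\<close>
    define z where "z = (Sup W + y) / 2"
    have z: "Sup W < z" "z < y" using x0y by (auto simp: z_def)
    have "a \<le> Sup W" using \<open>a \<in> W\<close> bW by (intro cSup_upper)
    with z have az: "a < z" by simp
    have left: "f a * f t > 0 \<and> t < z" if "t \<in> X" "t < y" for t
    proof -
      have "\<not> f a * f t < 0" using yle[of t] that by auto
      then have p: "f a * f t > 0" using X(4)[OF a] X(4)[OF that(1)]
        by (metis linorder_neqE_linordered_idom mult_eq_0_iff)
      then have "t \<in> W" using that by (auto simp: W_def)
      then have "t \<le> Sup W" using bW by (intro cSup_upper)
      with p z show ?thesis by simp
    qed
    define X' where "X' = X \<inter> {y..}"
    have X': "closed X'" "bdd_below X'" "X' \<noteq> {}" "\<And>t. t \<in> X' \<Longrightarrow> f t \<noteq> 0"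
      using X y by (auto simp: X'_def)
    have InfX': "Inf X' = y" using y(1) by (intro cInf_eq_minimum) (auto simp: X'_def)
    show ?thesis
    proof (rule disjE[OF Suc.IH[OF X']])
      assume "\<exists>x. (\<forall>i\<le>n. x i \<in> X') \<and> (\<forall>i<n. x i < x (Suc i) \<and> f (x i) * f (x (Suc i)) < 0)"
      then obtain x where x: "\<And>i. i \<le> n \<Longrightarrow> x i \<in> X'"
        "\<And>i. i < n \<Longrightarrow> x i < x (Suc i) \<and> f (x i) * f (x (Suc i)) < 0" by blast
      \<comment> \<open>The alternation found from y on may start with either sign. It is preceded
        by a if f(a) has the opposite sign, and otherwise by y, where f has the sign opposite to
        f(a).\<close>
      define b where "b = (if f a * f (x 0) < 0 then a else y)"
      have x0: "x 0 \<in> X" "y \<le> x 0" using x(1)[of 0] by (auto simp: X'_def)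
      have b: "b \<in> X" "b < x 0 \<and> f b * f (x 0) < 0"
      proof -
        show "b \<in> X" using a y by (simp add: b_def)
        show "b < x 0 \<and> f b * f (x 0) < 0"
        proof (cases "f a * f (x 0) < 0")
          case False
          then have p: "f a * f (x 0) > 0" using X(4)[OF a] X(4)[OF x0(1)]
            by (metis linorder_neqE_linordered_idom mult_eq_0_iff)
          then have "x 0 \<noteq> y" using y by auto
          moreover have "f y * f (x 0) < 0" using p y(2)
            by (auto simp: mult_less_0_iff zero_less_mult_iff)
          ultimately show ?thesis using False x0 by (simp add: b_def)
        qed (use ay x0 in \<open>simp add: b_def\<close>)
      qed
      let ?x = "\<lambda>i. case i of 0 \<Rightarrow> b | Suc j \<Rightarrow> x j"
      have "\<forall>i\<le>Suc n. ?x i \<in> X" using b x(1) by (auto simp: X'_def split: nat.splits)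
      moreover have "\<forall>i<Suc n. ?x i < ?x (Suc i) \<and> f (?x i) * f (?x (Suc i)) < 0"
        using b(2) x(2) by (auto split: nat.splits)
      ultimately show ?thesis by blast
    next
      assume "\<exists>zs \<sigma>. length zs < n \<and> (\<forall>z\<in>set zs. Inf X' < z) \<and>
        (\<forall>t\<in>X'. \<sigma> * prod_list (map (\<lambda>z. z - t) zs) * f t > 0)"
      then obtain zs \<sigma> where zs: "length zs < n" "\<And>z. z \<in> set zs \<Longrightarrow> y < z"
        "\<And>t. t \<in> X' \<Longrightarrow> \<sigma> * prod_list (map (\<lambda>z. z - t) zs) * f t > 0" unfolding InfX' by blast
      have pos: "prod_list (map (\<lambda>z. z - t) zs) > 0" if "t \<le> y" for t
        using zs(2) that by (intro prod_list_pos_real) force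
      have "y \<in> X'" using y by (simp add: X'_def)
      from zs(3)[OF this] have "(\<sigma> * f y) * prod_list (map (\<lambda>z. z - y) zs) > 0" by (simp add: mult_ac)
      then have "\<sigma> * f y > 0" using pos[of y] by (simp add: zero_less_mult_iff)
      then have \<sigma>: "\<sigma> * f a < 0" using y(2) by (auto simp: mult_less_0_iff zero_less_mult_iff)
      have "- \<sigma> * prod_list (map (\<lambda>z. z - t) (z # zs)) * f t > 0" if t: "t \<in> X" for t
      proof (cases "t < y")
        case True
        then have "f a * f t > 0" "t < z" using left t by auto
        then have "- \<sigma> * f t > 0" using \<sigma> by (auto simp: mult_less_0_iff zero_less_mult_iff)
        moreover have "(z - t) * prod_list (map (\<lambda>z. z - t) zs) > 0"
          using \<open>t < z\<close> pos[of t] True by simp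
        ultimately have "(- \<sigma> * f t) * ((z - t) * prod_list (map (\<lambda>z. z - t) zs)) > 0"
          by (rule mult_pos_pos)
        also have "(- \<sigma> * f t) * ((z - t) * prod_list (map (\<lambda>z. z - t) zs)) =
            - \<sigma> * prod_list (map (\<lambda>z. z - t) (z # zs)) * f t" by (simp add: algebra_simps)
        finally show ?thesis .
      next
        case False
        then have "\<sigma> * prod_list (map (\<lambda>z. z - t) zs) * f t > 0" using zs(3) t by (auto simp: X'_def)
        moreover have "t - z > 0" using False z by simp
        ultimately have "(t - z) * (\<sigma> * prod_list (map (\<lambda>z. z - t) zs) * f t) > 0"
          by (rule mult_pos_pos[rotated])
        also have "(t - z) * (\<sigma> * prod_list (map (\<lambda>z. z - t) zs) * f t) =
            - \<sigma> * prod_list (map (\<lambda>z. z - t) (z # zs)) * f t" by (simp add: algebra_simps)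
        finally show ?thesis .
      qed
      then show ?thesis using zs az z unfolding a_def[symmetric]
        by (intro disjI2 exI[of _ "z # zs"] exI[of _ "- \<sigma>"]) fastforce
    qed
  qed
qed

text \<open>Where f h > 0, subtracting a small multiple of h cannot push |f| above 1. Elsewhere |f|
  stays below some \<rho>' < 1, by compactness on [0, B] and by the limit beyond, and \<eta> is so
  small that \<eta> |h| fits into the remaining gap.\<close>

lemma perturbation_stays_bounded:
  fixes f h :: "real \<Rightarrow> real"
  assumes cont: "continuous_on UNIV f" "continuous_on UNIV h" and lim: "(f \<longlongrightarrow> 0) at_top"
    and f: "\<And>t. t \<ge> 0 \<Longrightarrow> \<bar>f t\<bar> \<le> 1" and h: "\<And>t. t \<ge> 0 \<Longrightarrow> \<bar>h t\<bar> \<le> H"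
    and fh: "\<And>t. t \<ge> 0 \<Longrightarrow> \<bar>f t\<bar> = 1 \<Longrightarrow> f t * h t > 0"
  shows "\<exists>\<eta>>0. \<forall>t\<ge>0. \<bar>f t - \<eta> * h t\<bar> \<le> 1"
proof -
  have "\<forall>\<^sub>F t in at_top. dist (f t) 0 < 1 / 2" using tendstoD[OF lim, of "1 / 2"] by linarith
  then obtain B where B: "\<And>t. t \<ge> B \<Longrightarrow> \<bar>f t\<bar> < 1 / 2" by (auto simp: eventually_at_top_linorder)
  define Y where "Y = {0..B} \<inter> {t. f t * h t \<le> 0}"
  have "compact Y" unfolding Y_def
    by (intro compact_Int_closed compact_Icc closed_Collect_le continuous_intros cont)
  have "\<exists>\<rho><1. \<forall>t\<in>Y. \<bar>f t\<bar> \<le> \<rho>"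
  proof (cases "Y = {}")
    case False
    obtain t where t: "t \<in> Y" "\<forall>u\<in>Y. \<bar>f u\<bar> \<le> \<bar>f t\<bar>"
      using continuous_attains_sup[OF \<open>compact Y\<close> False, of "\<lambda>t. \<bar>f t\<bar>"] cont(1)
      by (auto intro: continuous_intros continuous_on_subset)
    have "\<bar>f t\<bar> < 1" using f[of t] fh[of t] t(1) by (force simp: Y_def less_le)
    with t show ?thesis by blast
  qed (auto intro: exI[of _ 0])
  then obtain \<rho> where \<rho>: "\<rho> < 1" "\<And>t. t \<in> Y \<Longrightarrow> \<bar>f t\<bar> \<le> \<rho>" by blast
  define \<rho>' where "\<rho>' = max \<rho> (1 / 2)"
  have \<rho>': "\<rho>' < 1" "\<rho>' \<ge> 0" "\<And>t. t \<ge> 0 \<Longrightarrow> f t * h t \<le> 0 \<Longrightarrow> \<bar>f t\<bar> \<le> \<rho>'"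
  proof -
    fix t assume t: "t \<ge> 0" "f t * h t \<le> 0"
    show "\<bar>f t\<bar> \<le> \<rho>'"
    proof (cases "t \<le> B")
      case True then show ?thesis using \<rho>(2)[of t] t by (auto simp: Y_def \<rho>'_def)
    next
      case False then show ?thesis using B[of t] by (auto simp: \<rho>'_def)
    qed
  qed (use \<rho> in \<open>auto simp: \<rho>'_def\<close>)
  have H: "H \<ge> 0" using h[of 0] by simp
  define \<eta> where "\<eta> = (1 - \<rho>') / (H + 1)"
  have \<eta>: "\<eta> > 0" using \<rho>' H by (simp add: \<eta>_def)
  have \<eta>h: "\<bar>\<eta> * h t\<bar> \<le> 1 - \<rho>'" if "t \<ge> 0" for t
  proof -
    have "\<bar>\<eta> * h t\<bar> \<le> \<eta> * (H + 1)" using h[OF that] \<eta> by (simp add: abs_mult)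
    also have "\<dots> = 1 - \<rho>'" using H by (simp add: \<eta>_def)
    finally show ?thesis .
  qed
  have "\<bar>f t - \<eta> * h t\<bar> \<le> 1" if t: "t \<ge> 0" for t
  proof (cases "f t * h t \<le> 0")
    case True
    then show ?thesis using \<rho>'(3)[OF t True] \<eta>h[OF t] by linarith
  next
    case False
    then have "(f t > 0 \<and> \<eta> * h t > 0) \<or> (f t < 0 \<and> \<eta> * h t < 0)"
      using \<eta> by (auto simp: not_le zero_less_mult_iff mult_less_0_iff)
    then show ?thesis using f[OF t] \<eta>h[OF t] \<rho>'(2) by linarith
  qed
  with \<eta> show ?thesis by blast
qed

section \<open>The extremal exponential polynomial\<close>

definition exp_poly :: "real poly \<Rightarrow> real \<Rightarrow> real" where
  "exp_poly q t = exp (- t) * poly q t"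

text \<open>The second derivative of \<open>exp_poly q\<close> at 0, as a linear functional of
  q.\<close>

definition exp_poly_deriv2_0 :: "real poly \<Rightarrow> real" where
  "exp_poly_deriv2_0 q = poly (pderiv (pderiv q)) 0 - 2 * poly (pderiv q) 0 + poly q 0"

lemma exp_poly_DERIV: "(exp_poly q has_real_derivative exp_poly (pderiv q - q) t) (at t)"
  unfolding exp_poly_def
  by (auto intro!: derivative_eq_intros poly_DERIV simp: algebra_simps)

lemma deriv_exp_poly: "deriv (exp_poly q) = exp_poly (pderiv q - q)"
  by (intro ext DERIV_imp_deriv exp_poly_DERIV)

lemma deriv2_exp_poly_0: "deriv (deriv (exp_poly q)) 0 = exp_poly_deriv2_0 q"
  unfolding deriv_exp_poly by (simp add: exp_poly_def exp_poly_deriv2_0_def pderiv_diff)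

lemma exp_sol_exp_poly': "degree q < n \<Longrightarrow> exp_sol (replicate n 1) (exp_poly q)"
  unfolding exp_poly_def[abs_def] by (intro exp_sol_exp_poly) simp

lemma continuous_on_exp_poly: "continuous_on X (exp_poly q)"
  unfolding exp_poly_def[abs_def] by (intro continuous_intros)

lemma exp_poly_tendsto_0: "(exp_poly q \<longlongrightarrow> 0) at_top"
  using exp_sol_tendsto_0[OF exp_sol_exp_poly'[OF lessI]] by simp

lemma exp_poly_bounded: obtains H where "\<And>t. t \<ge> 0 \<Longrightarrow> \<bar>exp_poly q t\<bar> \<le> H"
proof -
  have "\<forall>\<^sub>F t in at_top. dist (exp_poly q t) 0 < 1" using tendstoD[OF exp_poly_tendsto_0, of 1] by simp
  then obtain B where B: "\<And>t. t \<ge> B \<Longrightarrow> \<bar>exp_poly q t\<bar> < 1" by (auto simp: eventually_at_top_linorder)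
  have "compact (exp_poly q ` {0..B})"
    by (intro compact_continuous_image continuous_on_exp_poly compact_Icc)
  then have "\<exists>C. \<forall>t\<in>{0..B}. \<bar>exp_poly q t\<bar> \<le> C"
    by (auto dest!: compact_imp_bounded simp: bounded_iff)
  then obtain C where C: "\<And>t. t \<in> {0..B} \<Longrightarrow> \<bar>exp_poly q t\<bar> \<le> C" by blast
  show ?thesis
  proof
    fix t :: real assume "t \<ge> 0"
    then show "\<bar>exp_poly q t\<bar> \<le> max C 1" using B[of t] C[of t] by fastforce
  qed
qed

lemma exp_poly_deriv2_0_coeff:
  "exp_poly_deriv2_0 q = 2 * coeff q 2 - 2 * coeff q 1 + coeff q 0"
  by (simp add: exp_poly_deriv2_0_def poly_0_coeff_0 coeff_pderiv numeral_2_eq_2)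

definition unit_exp_polys :: "nat \<Rightarrow> real poly set" where
  "unit_exp_polys n = {q. degree q < n \<and> (\<forall>t\<ge>0. \<bar>exp_poly q t\<bar> \<le> 1)}"

text \<open>Compactness of the unit ball in coefficient space; \<open>real^'n\<close> can serve as
  that space because n coefficients are needed.\<close>

lemma unit_exp_polys_extremal:
  "\<exists>q\<in>unit_exp_polys CARD('n::finite). \<forall>p\<in>unit_exp_polys CARD('n). exp_poly_deriv2_0 p \<le> exp_poly_deriv2_0 q"
proof -
  obtain idx :: "'n \<Rightarrow> nat" where idx: "bij_betw idx UNIV {..<CARD('n)}"
    using ex_bij_betw_finite_nat[of "UNIV :: 'n set"] by (auto simp: atLeast0LessThan)
  have inj: "idx i = idx j \<longleftrightarrow> i = j" for i j using idx by (auto simp: bij_betw_def inj_def)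
  have idx_less: "idx i < CARD('n)" for i using idx by (auto simp: bij_betw_def)
  define Q where "Q = (\<lambda>c::real^'n. \<Sum>i\<in>UNIV. monom (c $ i) (idx i))"
  have degQ: "degree (Q c) < CARD('n)" for c
    unfolding Q_def using idx_less
    by (intro degree_sum_less) (auto intro: le_less_trans[OF degree_monom_le])
  have surj: "\<exists>c. Q c = p" if p: "degree p < CARD('n)" for p
  proof -
    have "Q (\<chi> i. coeff p (idx i)) = (\<Sum>i\<in>UNIV. monom (coeff p (idx i)) (idx i))" by (simp add: Q_def)
    also have "\<dots> = (\<Sum>j<CARD('n). monom (coeff p j) j)"
      by (rule sum.reindex_bij_betw[OF idx])
    also have "\<dots> = (\<Sum>j\<le>CARD('n) - 1. monom (coeff p j) j)"
      by (intro sum.cong) (use p in auto)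
    also have "\<dots> = p" using p by (intro poly_as_sum_of_monoms') simp
    finally show ?thesis by blast
  qed
  have ep: "exp_poly (Q c) t = (\<Sum>i\<in>UNIV. exp (- t) * t ^ idx i * c $ i)" for c t
    by (simp add: exp_poly_def Q_def poly_sum poly_monom sum_distrib_left mult_ac)
  \<comment> \<open>Evaluation at 0, ..., n - 1 is injective on polynomials of degree below n, so
    values bounded by 1 bound the coefficients.\<close>
  define L where "L = (\<lambda>c. \<chi> k::'n. exp_poly (Q c) (real (idx k)))"
  have "linear L"
    by (rule linearI) (simp_all add: L_def ep vec_eq_iff sum.distrib algebra_simps sum_distrib_left)
  moreover have "inj L"
  proof (rule linear_injective_0[OF \<open>linear L\<close>, THEN iffD2], intro allI impI)
    fix c assume "L c = 0"
    then have root: "poly (Q c) (real (idx k)) = 0" for k by (simp add: L_def vec_eq_iff exp_poly_def)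
    have "Q c = 0"
    proof (rule ccontr)
      assume "Q c \<noteq> 0"
      then have "finite {x. poly (Q c) x = 0}" "card {x. poly (Q c) x = 0} \<le> degree (Q c)"
        using poly_roots_finite card_poly_roots_bound by blast+
      moreover have "card (range (\<lambda>k. real (idx k))) \<le> card {x. poly (Q c) x = 0}"
        using \<open>Q c \<noteq> 0\<close> root poly_roots_finite by (intro card_mono) auto
      moreover have "card (range (\<lambda>k. real (idx k))) = CARD('n)"
        by (intro card_image) (auto simp: inj_on_def inj)
      ultimately show False using degQ[of c] by simp
    qed
    then have "coeff (Q c) (idx k) = 0" for k by simp
    then show "c = 0" by (simp add: Q_def coeff_sum inj vec_eq_iff)
  qed
  ultimately obtain B where B: "B > 0" "\<And>c. B * norm c \<le> norm (L c)"
    using linear_inj_bounded_below_pos by blast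
  define K where "K = {c. \<forall>t\<in>{0..}. \<bar>exp_poly (Q c) t\<bar> \<le> 1}"
  have "K = (\<Inter>t\<in>{0..}. {c. \<bar>exp_poly (Q c) t\<bar> \<le> 1})" by (auto simp: K_def)
  then have "closed K" unfolding ep
    by (auto intro!: closed_INT closed_Collect_le continuous_intros)
  moreover have "norm c \<le> real CARD('n) / B" if "c \<in> K" for c
  proof -
    have "norm (L c) \<le> (\<Sum>k\<in>UNIV. \<bar>L c $ k\<bar>)" by (rule norm_le_l1_cart)
    also have "\<dots> \<le> (\<Sum>k\<in>(UNIV :: 'n set). 1)" using that by (intro sum_mono) (simp add: L_def K_def)
    finally have "B * norm c \<le> real CARD('n)" using B(2)[of c] by simp
    then show ?thesis using B(1) by (simp add: field_simps)
  qed
  ultimately have "compact K" by (auto simp: compact_eq_bounded_closed bounded_iff)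
  moreover have "0 \<in> K" by (simp add: K_def ep)
  moreover have "continuous_on K (\<lambda>c. exp_poly_deriv2_0 (Q c))"
  proof -
    have "coeff (Q c) j = (\<Sum>i\<in>UNIV. (if idx i = j then 1 else 0) * c $ i)" for c j
      unfolding Q_def coeff_sum by (intro sum.cong) auto
    then show ?thesis unfolding exp_poly_deriv2_0_coeff by (auto intro!: continuous_intros)
  qed
  ultimately obtain c where c: "c \<in> K" "\<And>d. d \<in> K \<Longrightarrow> exp_poly_deriv2_0 (Q d) \<le> exp_poly_deriv2_0 (Q c)"
    using continuous_attains_sup[of K "\<lambda>c. exp_poly_deriv2_0 (Q c)"] by auto
  show ?thesis
  proof (intro bexI[of _ "Q c"] ballI)
    show "Q c \<in> unit_exp_polys CARD('n)" using c(1) degQ by (simp add: unit_exp_polys_def K_def)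
    fix p :: "real poly" assume p: "p \<in> unit_exp_polys CARD('n)"
    then obtain d where d: "Q d = p" using surj by (auto simp: unit_exp_polys_def)
    then show "exp_poly_deriv2_0 p \<le> exp_poly_deriv2_0 (Q c)"
      using c(2)[of d] p by (auto simp: K_def unit_exp_polys_def)
  qed
qed

definition linear_factors :: "real list \<Rightarrow> real poly" where
  "linear_factors zs = prod_list (map (\<lambda>z. [:z, -1:]) zs)"

lemma linear_factors_Cons: "linear_factors (z # zs) = [:z, -1:] * linear_factors zs"
  by (simp add: linear_factors_def)

lemma degree_linear_factors: "degree (linear_factors zs) \<le> length zs"
proof (induction zs)
  case (Cons z zs)
  have "degree (linear_factors (z # zs)) \<le> degree [:z, -1:] + degree (linear_factors zs)"
    unfolding linear_factors_Cons by (rule degree_mult_le)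
  with Cons show ?case by simp
qed (simp add: linear_factors_def)

lemma poly_linear_factors: "poly (linear_factors zs) t = prod_list (map (\<lambda>z. z - t) zs)"
  by (induction zs) (auto simp: linear_factors_def algebra_simps)

text \<open>With positive roots the value and the derivatives at 0 alternate in sign, so no term of
  q'' - 2 q' + q is negative and \<open>exp_poly_deriv2_0\<close> is positive on such
  products.\<close>

lemma linear_factors_at_0:
  assumes "\<forall>z\<in>set zs. 0 < z"
  shows "poly (linear_factors zs) 0 > 0 \<and> poly (pderiv (linear_factors zs)) 0 \<le> 0 \<and>
    poly (pderiv (pderiv (linear_factors zs))) 0 \<ge> 0"
  using assms
proof (induction zs)
  case (Cons z zs)
  let ?P = "linear_factors zs"
  have "pderiv [:z, -1:] = [:-1:]" by (simp add: pderiv_pCons)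
  then have d1: "pderiv (linear_factors (z # zs)) = [:z, -1:] * pderiv ?P - ?P"
    unfolding linear_factors_Cons pderiv_mult by simp
  then have d2: "pderiv (pderiv (linear_factors (z # zs))) =
      [:z, -1:] * pderiv (pderiv ?P) - pderiv ?P - pderiv ?P"
    using \<open>pderiv [:z, -1:] = [:-1:]\<close> by (simp add: pderiv_mult pderiv_diff del: mult_pCons_left)
  have z: "z > 0" and IH: "poly ?P 0 > 0" "poly (pderiv ?P) 0 \<le> 0" "poly (pderiv (pderiv ?P)) 0 \<ge> 0"
    using Cons by auto
  then have "z * poly ?P 0 > 0" "z * poly (pderiv ?P) 0 \<le> 0" "z * poly (pderiv (pderiv ?P)) 0 \<ge> 0"
    by (auto simp: mult_le_0_iff)
  moreover have "poly (linear_factors (z # zs)) 0 = z * poly ?P 0" by (simp add: linear_factors_Cons)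
  moreover have "poly (pderiv (linear_factors (z # zs))) 0 = z * poly (pderiv ?P) 0 - poly ?P 0"
    unfolding d1 by simp
  moreover have "poly (pderiv (pderiv (linear_factors (z # zs)))) 0 =
      z * poly (pderiv (pderiv ?P)) 0 - 2 * poly (pderiv ?P) 0" unfolding d2 by simp
  ultimately show ?case using IH by linarith
qed (simp add: linear_factors_def)

lemma exp_poly_diff_smult: "exp_poly (q - smult \<eta> p) t = exp_poly q t - \<eta> * exp_poly p t"
  by (simp add: exp_poly_def algebra_simps)

lemma exp_poly_deriv2_0_diff_smult:
  "exp_poly_deriv2_0 (q - smult \<eta> p) = exp_poly_deriv2_0 q - \<eta> * exp_poly_deriv2_0 p"
  by (simp add: exp_poly_deriv2_0_def pderiv_diff pderiv_smult algebra_simps)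

lemma exp_poly_deriv2_0_smult: "exp_poly_deriv2_0 (smult c p) = c * exp_poly_deriv2_0 p"
  by (simp add: exp_poly_deriv2_0_def pderiv_smult algebra_simps)

text \<open>Kolmogorov's criterion: if p had the sign of the extremal function at all its peaks,
  then q - \<eta> p would stay in the unit ball for some \<eta> > 0 and have a larger
  functional.\<close>

lemma extremal_no_improvement:
  assumes q: "q \<in> unit_exp_polys n" "\<And>p. p \<in> unit_exp_polys n \<Longrightarrow> exp_poly_deriv2_0 p \<le> exp_poly_deriv2_0 q"
    and p: "degree p < n" "exp_poly_deriv2_0 p < 0"
  shows "\<exists>t\<ge>0. \<bar>exp_poly q t\<bar> = 1 \<and> exp_poly q t * poly p t \<le> 0"
proof (rule ccontr)
  assume "\<not> ?thesis"
  then have *: "exp_poly q t * poly p t > 0" if "t \<ge> 0" "\<bar>exp_poly q t\<bar> = 1" for t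
    using that by force
  obtain H where H: "\<And>t. t \<ge> 0 \<Longrightarrow> \<bar>exp_poly p t\<bar> \<le> H" using exp_poly_bounded by blast
  have "exp_poly q t * exp_poly p t > 0" if "t \<ge> 0" "\<bar>exp_poly q t\<bar> = 1" for t
  proof -
    have "exp (- t) * (exp_poly q t * poly p t) > 0" using *[OF that] by simp
    then show ?thesis unfolding exp_poly_def[of p] by (simp only: mult_ac)
  qed
  then obtain \<eta> where \<eta>: "\<eta> > 0" "\<forall>t\<ge>0. \<bar>exp_poly q t - \<eta> * exp_poly p t\<bar> \<le> 1"
    using perturbation_stays_bounded[OF continuous_on_exp_poly continuous_on_exp_poly
        exp_poly_tendsto_0, of q p H] q(1) H by (auto simp: unit_exp_polys_def)
  have "degree (q - smult \<eta> p) < n"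
    using q(1) p(1) by (intro degree_diff_less) (auto simp: unit_exp_polys_def)
  then have "q - smult \<eta> p \<in> unit_exp_polys n"
    using \<eta>(2) by (simp add: unit_exp_polys_def exp_poly_diff_smult)
  from q(2)[OF this] have "\<eta> * exp_poly_deriv2_0 p \<ge> 0" by (simp add: exp_poly_deriv2_0_diff_smult)
  with \<eta>(1) p(2) show False by (simp add: zero_le_mult_iff)
qed

lemma one_in_unit_exp_polys: "n > 0 \<Longrightarrow> [:1:] \<in> unit_exp_polys n"
  by (simp add: unit_exp_polys_def exp_poly_def)

text \<open>Without m + 1 alternating peaks there is a separating polynomial of degree below m. One
  degree is then free, enough to correct the sign of the functional by a factor positive on the
  half-line, against \<open>extremal_no_improvement\<close>.\<close>

lemma exp_poly_equioscillation:
  assumes q: "q \<in> unit_exp_polys (Suc m)"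
    "\<And>p. p \<in> unit_exp_polys (Suc m) \<Longrightarrow> exp_poly_deriv2_0 p \<le> exp_poly_deriv2_0 q"
  shows "\<exists>x. x 0 = 0 \<and> (\<forall>i<m. x i < x (Suc i)) \<and> (\<forall>i\<le>m. exp_poly q (x i) = (-1) ^ i)"
proof -
  let ?f = "exp_poly q"
  have ge1: "exp_poly_deriv2_0 q \<ge> 1"
    using q(2)[OF one_in_unit_exp_polys] by (simp add: exp_poly_deriv2_0_def)
  have f1: "\<bar>?f t\<bar> \<le> 1" if "t \<ge> 0" for t using q(1) that by (simp add: unit_exp_polys_def)
  have fsol: "exp_sol (replicate (Suc m) 1) ?f"
    using q(1) by (intro exp_sol_exp_poly') (simp add: unit_exp_polys_def)
  define X where "X = {0..} \<inter> {t. \<bar>?f t\<bar> = 1}"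
  have Xne: "X \<noteq> {}"
    using extremal_no_improvement[OF q, of "[:-1:]"] by (auto simp: X_def exp_poly_deriv2_0_def)
  have "closed X" unfolding X_def
    by (intro closed_Int closed_atLeast closed_Collect_eq continuous_intros continuous_on_exp_poly)
  moreover have bX: "bdd_below X" by (auto simp: X_def)
  moreover have "?f t \<noteq> 0" if "t \<in> X" for t using that by (auto simp: X_def)
  ultimately have "(\<exists>x. (\<forall>i\<le>m. x i \<in> X) \<and> (\<forall>i<m. x i < x (Suc i) \<and> ?f (x i) * ?f (x (Suc i)) < 0)) \<or>
    (\<exists>zs \<sigma>. length zs < m \<and> (\<forall>z\<in>set zs. Inf X < z) \<and> (\<forall>t\<in>X. \<sigma> * prod_list (map (\<lambda>z. z - t) zs) * ?f t > 0))"
    using Xne by (intro alternation_or_separating_polynomial continuous_on_exp_poly)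
  moreover have False if zs: "length zs < m" "\<forall>z\<in>set zs. Inf X < z"
    "\<forall>t\<in>X. \<sigma> * prod_list (map (\<lambda>z. z - t) zs) * ?f t > 0" for zs \<sigma>
  proof -
    have "Inf X \<ge> 0" using Xne by (intro cInf_greatest) (auto simp: X_def)
    with zs(2) have zpos: "\<forall>z\<in>set zs. 0 < z" by force
    define P where "P = linear_factors zs"
    have P0: "poly P 0 > 0" "poly (pderiv P) 0 \<le> 0" "poly (pderiv (pderiv P)) 0 \<ge> 0"
      using linear_factors_at_0[OF zpos] by (auto simp: P_def)
    then have lP: "exp_poly_deriv2_0 P > 0" by (simp add: exp_poly_deriv2_0_def)
    have degP: "degree P < m" using degree_linear_factors[of zs] zs(1) by (simp add: P_def)
    have Pf: "\<sigma> * poly P t * ?f t > 0" if "t \<ge> 0" "\<bar>?f t\<bar> = 1" for t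
      using zs(3) that by (simp add: X_def P_def poly_linear_factors)
    obtain t0 where "t0 \<ge> 0" "\<bar>?f t0\<bar> = 1" using Xne by (auto simp: X_def)
    from Pf[OF this] have "\<sigma> \<noteq> 0" by auto
    then consider "\<sigma> < 0" | "\<sigma> > 0" by linarith
    then show False
    proof cases
      case 1
      have "exp_poly_deriv2_0 (smult \<sigma> P) < 0"
        using 1 lP by (simp add: exp_poly_deriv2_0_smult mult_less_0_iff)
      then obtain t where "t \<ge> 0" "\<bar>?f t\<bar> = 1" "?f t * poly (smult \<sigma> P) t \<le> 0"
        using extremal_no_improvement[OF q, of "smult \<sigma> P"] degP
          degree_smult_le[of \<sigma> P] by auto
      with Pf[of t] show False by (simp add: mult_ac)
    next
      case 2
      define d where "d = poly P 0 - poly (pderiv P) 0"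
      have d: "d > 0" using P0 by (simp add: d_def)
      \<comment> \<open>The factor 1 + K t preserves signs for t \<ge> 0 and lowers the functional
        by 2 K d; this K turns its value into the negative.\<close>
      define K where "K = exp_poly_deriv2_0 P / d"
      have K: "K > 0" using lP d by (simp add: K_def)
      define W where "W = P * [:1, K:]"
      have dK: "pderiv [:1, K:] = [:K:]" by (simp add: pderiv_pCons)
      have W1: "pderiv W = [:K:] * P + [:1, K:] * pderiv P"
        unfolding W_def pderiv_mult dK by (simp only: mult.commute)
      have dK0: "pderiv [:K:] = 0" by (simp add: pderiv_pCons)
      have W2: "pderiv (pderiv W) =
          ([:K:] * pderiv P + P * 0) + ([:1, K:] * pderiv (pderiv P) + pderiv P * [:K:])"
        unfolding W1 pderiv_add pderiv_mult dK dK0 ..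
      have "exp_poly_deriv2_0 W = exp_poly_deriv2_0 P - 2 * K * d"
        unfolding exp_poly_deriv2_0_def d_def W2 unfolding W1 unfolding W_def
        by (simp add: algebra_simps)
      also have "\<dots> = - exp_poly_deriv2_0 P" using d by (simp add: K_def)
      finally have "exp_poly_deriv2_0 (smult \<sigma> W) < 0"
        using 2 lP by (simp add: exp_poly_deriv2_0_smult)
      moreover have "degree (smult \<sigma> W) < Suc m"
      proof -
        have "degree W \<le> degree P + degree [:1, K:]" unfolding W_def by (rule degree_mult_le)
        with degP degree_smult_le[of \<sigma> W] show ?thesis by (simp split: if_splits)
      qed
      ultimately obtain t where t: "t \<ge> 0" "\<bar>?f t\<bar> = 1" "?f t * poly (smult \<sigma> W) t \<le> 0"
        using extremal_no_improvement[OF q, of "smult \<sigma> W"] by auto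
      have "1 + K * t > 0" using K t by (simp add: add_pos_nonneg)
      with Pf[OF t(1,2)] have "(\<sigma> * poly P t * ?f t) * (1 + K * t) > 0" by (rule mult_pos_pos)
      also have "(\<sigma> * poly P t * ?f t) * (1 + K * t) = ?f t * poly (smult \<sigma> W) t"
        by (simp add: W_def algebra_simps)
      finally show False using t(3) by simp
    qed
  qed
  ultimately obtain x where x: "\<And>i. i \<le> m \<Longrightarrow> x i \<in> X"
    "\<And>i. i < m \<Longrightarrow> x i < x (Suc i)" "\<And>i. i < m \<Longrightarrow> ?f (x i) * ?f (x (Suc i)) < 0" by blast
  have xX: "x i \<ge> 0" "\<bar>?f (x i)\<bar> = 1" if "i \<le> m" for i using x(1)[OF that] by (auto simp: X_def)
  have sgn: "?f (x i) = (-1) ^ i * ?f (x 0)" if "i \<le> m" for i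
    using that
  proof (induction i)
    case (Suc i)
    then have IH: "?f (x i) = (-1) ^ i * ?f (x 0)" by simp
    have "?f (x (Suc i)) = - ?f (x i)"
      using xX(2)[of i] xX(2)[of "Suc i"] x(3)[of i] Suc.prems by (auto simp: abs_if mult_less_0_iff split: if_splits)
    then show ?case by (simp add: IH)
  qed simp
  \<comment> \<open>Otherwise all m + 1 peaks are interior maxima of |f|, and the derivative has m +
    1 zeros, too many for order m + 1.\<close>
  have x0: "x 0 = 0"
  proof (rule ccontr)
    assume "x 0 \<noteq> 0"
    then have "x 0 > 0" using xX(1)[of 0] by simp
    have pos: "x i > 0" if "i \<le> m" for i
      using \<open>x 0 > 0\<close> that upto_Suc_mono_less[of m x 0 i, OF x(2)] by (cases i) auto
    have "deriv ?f (x i) = 0" if i: "i \<le> m" for i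
    proof -
      have D: "((\<lambda>t. ?f (x i) * ?f t) has_real_derivative ?f (x i) * deriv ?f (x i)) (at (x i))"
        by (intro DERIV_cmult exp_sol_DERIV[OF fsol])
      have "?f (x i) * ?f (x i) = 1" using xX(2)[OF i] by (auto simp: abs_if split: if_splits)
      moreover have "?f (x i) * ?f y \<le> 1" if "\<bar>x i - y\<bar> < x i" for y
      proof -
        have "\<bar>?f (x i) * ?f y\<bar> \<le> 1" using f1[of y] xX(2)[OF i] that by (simp add: abs_mult)
        then show ?thesis by simp
      qed
      ultimately have "?f (x i) * deriv ?f (x i) = 0"
        by (intro DERIV_local_max[OF D pos[OF i]]) auto
      then show ?thesis using xX(2)[OF i] by auto
    qed
    moreover have "inj_on x {..m}" by (rule upto_Suc_mono_inj[of m x, OF x(2)])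
    then have "card (x ` {..m}) = Suc m" by (simp add: card_image)
    ultimately have "deriv ?f t = 0" for t
      using exp_sol_zeros_less[OF exp_sol_deriv[OF fsol], of t "x ` {..m}"] by auto
    then have "?f t = ?f (x 0)" for t
      using exp_sol_DERIV[OF fsol] DERIV_isconst_all[of ?f t "x 0"] by simp
    then have "?f = (\<lambda>_. ?f (x 0))" by (rule ext)
    then have "((\<lambda>_. ?f (x 0)) \<longlongrightarrow> 0) (at_top :: real filter)" using exp_poly_tendsto_0[of q] by simp
    then have "?f (x 0) = 0" by (simp add: tendsto_const_iff)
    then show False using xX(2)[of 0] by simp
  qed
  \<comment> \<open>If f started with -1, then - f would alternate from +1 and have a positive
    second derivative at 0, but f itself has one of at least 1.\<close>
  have "?f (x 0) = 1"
  proof (rule ccontr)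
    assume "?f (x 0) \<noteq> 1"
    then have m1: "?f (x 0) = - 1" using xX(2)[of 0] by (auto simp: abs_if split: if_splits)
    have "deriv (deriv (\<lambda>t. (-1) * ?f t + 0 * ?f t)) 0 > 0"
      using x0 sgn m1 by (intro exp_sol_alternating_second_deriv[where x = x and m = m, OF exp_sol_lincomb[OF fsol fsol] _ _ x(2)]) auto
    then show False using deriv2_lincomb[OF fsol fsol, of "-1" 0 0] ge1 by (simp add: deriv2_exp_poly_0)
  qed
  with x0 x(2) sgn show ?thesis by auto
qed

lemma exists_equioscillating_exp_poly:
  obtains m T x where "CARD('n::finite) = Suc m" "T \<in> unit_exp_polys (Suc m)" "x 0 = 0"
    "\<And>i. i < m \<Longrightarrow> x i < x (Suc i)" "\<And>i. i \<le> m \<Longrightarrow> exp_poly T (x i) = (-1) ^ i"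
proof -
  obtain m where m: "CARD('n) = Suc m" by (metis Suc_pred' zero_less_card_finite)
  obtain T where T: "T \<in> unit_exp_polys (Suc m)"
    "\<And>p. p \<in> unit_exp_polys (Suc m) \<Longrightarrow> exp_poly_deriv2_0 p \<le> exp_poly_deriv2_0 T"
    using unit_exp_polys_extremal[where 'n = 'n] unfolding m by blast
  obtain x where "x 0 = 0" "\<And>i. i < m \<Longrightarrow> x i < x (Suc i)" "\<And>i. i \<le> m \<Longrightarrow> exp_poly T (x i) = (-1) ^ i"
    using exp_poly_equioscillation[OF T] by blast
  with m T(1) show ?thesis by (rule that)
qed

text \<open>A real \<open>Sup\<close> is an upper bound only over a bounded set. The comparison
  theorem, applied to exponential polynomials themselves with all rates 1, bounds the inner and the
  outer set by T''(0).\<close>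

lemma exp_poly_deriv2_0_le_M2:
  assumes q: "q \<in> unit_exp_polys CARD('n::finite)"
  shows "\<bar>exp_poly_deriv2_0 q\<bar> \<le> M2 CARD('n)"
proof -
  obtain m T x where m: "CARD('n) = Suc m" and T: "T \<in> unit_exp_polys (Suc m)"
    and x: "x 0 = 0" "\<And>i. i < m \<Longrightarrow> x i < x (Suc i)" "\<And>i. i \<le> m \<Longrightarrow> exp_poly T (x i) = (-1) ^ i"
    by (rule exists_equioscillating_exp_poly[where 'n = 'n]) (rule that)
  have sol: "exp_sol (replicate (Suc m) 1) (exp_poly p)" if "p \<in> unit_exp_polys (Suc m)" for p
    using that by (intro exp_sol_exp_poly') (simp add: unit_exp_polys_def)
  let ?C = "deriv (deriv (exp_poly T)) 0"
  define S where "S = (\<lambda>p. {\<bar>deriv (deriv (exp_poly p)) t\<bar> | t. t \<ge> 0})"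
  have M2: "M2 (Suc m) = Sup ((\<lambda>p. Sup (S p)) ` unit_exp_polys (Suc m))"
    unfolding M2_def S_def unit_exp_polys_def exp_poly_def[abs_def]
    by (rule arg_cong[of _ _ Sup]) (auto simp: less_Suc_eq_le)
  have S_le: "y \<le> ?C" if "p \<in> unit_exp_polys (Suc m)" "y \<in> S p" for p y
    using exp_sol_second_deriv_bound[OF sol[OF T] x(2) _ x(3) sol[OF that(1)], of 1 1] that x(1)
    by (auto simp: S_def unit_exp_polys_def)
  have mem: "\<bar>exp_poly_deriv2_0 p\<bar> \<in> S p" for p
    unfolding deriv2_exp_poly_0[symmetric] S_def by auto
  have "Sup (S p) \<le> ?C" if "p \<in> unit_exp_polys (Suc m)" for p
    using S_le[OF that] mem[of p] by (intro cSup_least) auto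
  then have "Sup (S q) \<le> M2 (Suc m)"
    unfolding M2 using q m by (intro cSup_upper) (auto intro!: bdd_aboveI)
  moreover have "\<bar>exp_poly_deriv2_0 q\<bar> \<le> Sup (S q)"
    using S_le[of q] q m by (intro cSup_upper[OF mem]) (auto intro!: bdd_aboveI)
  ultimately show ?thesis by (simp add: m)
qed

lemma exp_sol_second_deriv_le_M2:
  fixes g :: "real \<Rightarrow> real"
  assumes g: "exp_sol as g" "length as \<le> CARD('n::finite)" "\<forall>a\<in>set as. 0 < a \<and> a \<le> R" "R > 0"
    and bd: "\<And>t. t \<ge> 0 \<Longrightarrow> \<bar>g t\<bar> \<le> B" and B: "B > 0" and t: "t \<ge> 0"
  shows "\<bar>deriv (deriv g) t\<bar> \<le> M2 CARD('n) * R ^ 2 * B"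
proof -
  obtain m T x where m: "CARD('n) = Suc m" and T: "T \<in> unit_exp_polys (Suc m)"
    and x: "x 0 = 0" "\<And>i. i < m \<Longrightarrow> x i < x (Suc i)" "\<And>i. i \<le> m \<Longrightarrow> exp_poly T (x i) = (-1) ^ i"
    by (rule exists_equioscillating_exp_poly[where 'n = 'n]) (rule that)
  have "exp_sol (replicate (Suc m) 1) (exp_poly T)"
    using T by (intro exp_sol_exp_poly') (simp add: unit_exp_polys_def)
  from exp_sol_second_deriv_bound[OF this x(2) _ x(3) g(1) _ g(3,4) bd B t]
  have "\<bar>deriv (deriv g) t\<bar> \<le> exp_poly_deriv2_0 T * R ^ 2 * B"
    using x(1) g(2) by (simp add: m deriv2_exp_poly_0)
  moreover have "exp_poly_deriv2_0 T * (R ^ 2 * B) \<le> M2 CARD('n) * (R ^ 2 * B)"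
    using exp_poly_deriv2_0_le_M2[where 'n = 'n and q = T] T B by (intro mult_right_mono) (auto simp: m)
  ultimately show ?thesis by (simp add: mult.assoc)
qed

lemma M2_ge_1: "M2 CARD('n::finite) \<ge> 1"
  using exp_poly_deriv2_0_le_M2[OF one_in_unit_exp_polys, where 'n = 'n]
  by (simp add: exp_poly_deriv2_0_def)

text \<open>The witness exp (- t) (1 - t) has second derivative 3 at 0. The bound is wanted because
  \<open>euler_step_factor_less_1\<close> asks for a constant of at least 2.\<close>

lemma M2_ge_3:
  assumes "CARD('n::finite) \<ge> 2" shows "M2 CARD('n) \<ge> 3"
proof -
  have "\<bar>exp (- t) * (1 - t)\<bar> \<le> 1" if "t \<ge> 0" for t :: real
  proof -
    have "\<bar>1 - t\<bar> \<le> exp t" using exp_ge_add_one_self[of t] that by linarith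
    then have "exp (- t) * \<bar>1 - t\<bar> \<le> exp (- t) * exp t" by (intro mult_left_mono) auto
    then show ?thesis by (simp add: abs_mult flip: exp_add)
  qed
  then have "[:1, -1:] \<in> unit_exp_polys CARD('n)"
    using assms by (simp add: unit_exp_polys_def exp_poly_def)
  from exp_poly_deriv2_0_le_M2[OF this] show ?thesis
    by (simp add: exp_poly_deriv2_0_def pderiv_pCons)
qed

section \<open>Matrix exponentials and switching trajectories\<close>

text \<open>The vector \<open>exp (t A) v\<close>, as a componentwise power series: the type \<open>real^'n^'n\<close> carries the
  componentwise multiplication, so \<open>exp\<close> of the library does not apply.\<close>
definition mexp :: "real^'n^'n \<Rightarrow> real \<Rightarrow> real^'n \<Rightarrow> real^'n" where
  "mexp A t v = (\<chi> i. \<Sum>k. (((*v) A ^^ k) v $ i / fact k) * t ^ k)"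

lemma norm_matrix_power_le:
  fixes A :: "real^'n^'n"
  shows "norm (((*v) A ^^ k) v) \<le> onorm ((*v) A) ^ k * norm v"
proof (induction k)
  case (Suc k)
  have "norm (((*v) A ^^ Suc k) v) \<le> onorm ((*v) A) * norm (((*v) A ^^ k) v)"
    by (simp add: onorm)
  also have "\<dots> \<le> onorm ((*v) A) * (onorm ((*v) A) ^ k * norm v)"
    by (intro mult_left_mono Suc.IH onorm_pos_le) simp
  finally show ?case by (simp add: mult_ac)
qed simp

lemma mexp_summable:
  fixes A :: "real^'n^'n"
  shows "summable (\<lambda>k. (((*v) A ^^ k) v $ i / fact k) * t ^ k)"
proof (rule summable_comparison_test')
  let ?K = "onorm ((*v) A)"
  show "summable (\<lambda>k. norm v * (inverse (fact k) * (?K * \<bar>t\<bar>) ^ k))"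
    by (intro summable_mult summable_exp)
  fix k
  have "\<bar>((*v) A ^^ k) v $ i\<bar> \<le> ?K ^ k * norm v"
    using component_le_norm_cart norm_matrix_power_le by (rule order_trans)
  then have "\<bar>((*v) A ^^ k) v $ i\<bar> * \<bar>t\<bar> ^ k \<le> (?K ^ k * norm v) * \<bar>t\<bar> ^ k"
    by (intro mult_right_mono) auto
  then show "norm ((((*v) A ^^ k) v $ i / fact k) * t ^ k) \<le> norm v * (inverse (fact k) * (?K * \<bar>t\<bar>) ^ k)"
    by (simp add: abs_mult power_abs power_mult_distrib divide_simps mult_ac)
qed

lemma mexp_0 [simp]: "mexp A 0 v = v"
proof -
  have "(\<Sum>k. (((*v) A ^^ k) v $ i / fact k) * 0 ^ k) = v $ i" for i
    using powser_zero[of "\<lambda>k. ((*v) A ^^ k) v $ i / fact k"] by simp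
  then show ?thesis by (simp add: mexp_def vec_eq_iff del: times_divide_eq_left)
qed

lemma matrix_power_commute:
  fixes A :: "real^'n^'n"
  shows "((*v) A ^^ k) (A *v v) = A *v ((*v) A ^^ k) v"
  by (simp add: funpow_swap1)

lemma mexp_commute: "mexp A t (A *v v) = A *v mexp A t v"
proof (simp add: vec_eq_iff, intro allI)
  fix i
  let ?c = "\<lambda>j k. (((*v) A ^^ k) v $ j / fact k) * t ^ k"
  have "(A *v mexp A t v) $ i = (\<Sum>j\<in>UNIV. A $ i $ j * (\<Sum>k. ?c j k))"
    by (simp add: matrix_vector_mult_def mexp_def)
  also have "\<dots> = (\<Sum>j\<in>UNIV. \<Sum>k. A $ i $ j * ?c j k)"
    by (intro sum.cong refl suminf_mult[symmetric] mexp_summable)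
  also have "\<dots> = (\<Sum>k. \<Sum>j\<in>UNIV. A $ i $ j * ?c j k)"
    by (intro suminf_sum[symmetric] summable_mult mexp_summable)
  also have "\<dots> = mexp A t (A *v v) $ i"
    unfolding mexp_def matrix_power_commute
    by (simp add: matrix_vector_mult_def sum_divide_distrib sum_distrib_left sum_distrib_right mult_ac)
  finally show "mexp A t (A *v v) $ i = (A *v mexp A t v) $ i" ..
qed

lemma has_vector_derivative_componentwise_cart:
  fixes f :: "real \<Rightarrow> real^'n"
  assumes "\<And>i. ((\<lambda>t. f t $ i) has_real_derivative f' $ i) (at t within S)"
  shows "(f has_vector_derivative f') (at t within S)"
  unfolding has_vector_derivative_def
proof (subst has_derivative_componentwise_within, intro ballI)
  fix b :: "real^'n" assume "b \<in> Basis"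
  then obtain i where b: "b = axis i 1" by (auto simp: Basis_vec_def)
  show "((\<lambda>t. f t \<bullet> b) has_derivative (\<lambda>x. (x *\<^sub>R f') \<bullet> b)) (at t within S)"
    using assms[of i] unfolding has_field_derivative_def b by (simp add: inner_axis mult_commute_abs)
qed

lemma mexp_has_vector_derivative:
  "((\<lambda>t. mexp A t v) has_vector_derivative (A *v mexp A t v)) (at t within S)"
proof (rule has_vector_derivative_at_within, rule has_vector_derivative_componentwise_cart)
  fix i
  let ?c = "\<lambda>k. ((*v) A ^^ k) v $ i / fact k"
  have "((\<lambda>t. \<Sum>k. ?c k * t ^ k) has_real_derivative (\<Sum>k. diffs ?c k * t ^ k)) (at t)"
    by (rule termdiffs_strong_converges_everywhere[OF mexp_summable])
  moreover have "diffs ?c k = ((*v) A ^^ k) (A *v v) $ i / fact k" for k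
    by (simp add: diffs_def matrix_power_commute field_simps del: of_nat_Suc)
  ultimately have "((\<lambda>t. mexp A t v $ i) has_real_derivative mexp A t (A *v v) $ i) (at t)"
    by (simp add: mexp_def)
  then show "((\<lambda>t. mexp A t v $ i) has_real_derivative (A *v mexp A t v) $ i) (at t)"
    by (simp add: mexp_commute)
qed

lemma matrix_power_linear:
  fixes A :: "real^'n^'n"
  shows "linear ((*v) A ^^ k)"
proof (induction k)
  case (Suc k)
  then show ?case using linear_compose[of "(*v) A ^^ k" "(*v) A"] by (simp add: o_def)
qed (simp add: linear_id[unfolded id_def] id_def)

lemma linear_mexp:
  fixes A :: "real^'n^'n"
  shows "linear (mexp A t)"
proof (rule linearI)
  fix v w :: "real^'n" and c :: real
  show "mexp A t (v + w) = mexp A t v + mexp A t w"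
    using suminf_add[OF mexp_summable[of A v] mexp_summable[of A w]]
    by (simp add: mexp_def vec_eq_iff linear_add[OF matrix_power_linear] add_divide_distrib distrib_right)
  show "mexp A t (c *\<^sub>R v) = c *\<^sub>R mexp A t v"
    using suminf_mult[OF mexp_summable[of A v], of c]
    by (simp add: mexp_def vec_eq_iff linear_scale[OF matrix_power_linear] mult.assoc)
qed

lemma inner_matrix_mult_ge:
  fixes A :: "real^'n^'n"
  shows "v \<bullet> (A *v v) \<ge> - onorm ((*v) A) * (v \<bullet> v)"
proof -
  have "\<bar>v \<bullet> (A *v v)\<bar> \<le> norm v * norm (A *v v)" by (rule Cauchy_Schwarz_ineq2)
  also have "\<dots> \<le> norm v * (onorm ((*v) A) * norm v)" by (intro mult_left_mono onorm) auto
  finally show ?thesis by (simp add: dot_square_norm power2_eq_square mult_ac)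
qed

text \<open>The weighted energy exp (2 K s) |x(s)|^2 is nondecreasing, K being the operator norm of
  A; this stands in for the inverse exp (- t A).\<close>

lemma mexp_nonzero:
  assumes "v \<noteq> 0" "t \<ge> 0" shows "mexp A t v \<noteq> 0"
proof
  assume 0: "mexp A t v = 0"
  let ?K = "onorm ((*v) A)"
  let ?F = "\<lambda>s. exp (2 * ?K * s) * (mexp A s v \<bullet> mexp A s v)"
  have "?F 0 \<le> ?F t"
  proof (rule DERIV_nonneg_imp_nondecreasing[OF assms(2)])
    fix s
    let ?x = "mexp A s v"
    have "((\<lambda>s. mexp A s v \<bullet> mexp A s v) has_vector_derivative (?x \<bullet> (A *v ?x) + (A *v ?x) \<bullet> ?x)) (at s)"
      by (rule bounded_bilinear.has_vector_derivative[OF bounded_bilinear_inner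
            mexp_has_vector_derivative mexp_has_vector_derivative])
    then have D: "((\<lambda>s. mexp A s v \<bullet> mexp A s v) has_real_derivative 2 * (?x \<bullet> (A *v ?x))) (at s)"
      by (simp add: has_real_derivative_iff_has_vector_derivative inner_commute)
    have "(?F has_real_derivative exp (2 * ?K * s) * (2 * (?x \<bullet> (A *v ?x) + ?K * (?x \<bullet> ?x)))) (at s)"
      by (rule derivative_eq_intros D refl | simp add: algebra_simps)+
    moreover have "?x \<bullet> (A *v ?x) + ?K * (?x \<bullet> ?x) \<ge> 0" using inner_matrix_mult_ge[where v = ?x and A = A] by simp
    ultimately show "\<exists>y. (?F has_real_derivative y) (at s) \<and> 0 \<le> y" by (auto intro!: exI)
  qed
  then have "v \<bullet> v \<le> 0" using 0 by simp
  moreover have "v \<bullet> v > 0" using assms(1) by simp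
  ultimately show False by linarith
qed

section \<open>Trajectories with piecewise constant matrices\<close>

lemma lipschitz_imp_abs_cont_on:
  assumes "L-lipschitz_on {a..b} x"
  shows "abs_cont_on a b x"
  unfolding abs_cont_on_def
proof (intro allI impI)
  fix e :: real assume e: "e > 0"
  have L: "L \<ge> 0" using assms by (rule lipschitz_on_nonneg)
  show "\<exists>\<delta>>0. \<forall>(n::nat) u v. (\<forall>i<n. a \<le> u i \<and> u i \<le> v i \<and> v i \<le> b) \<longrightarrow>
    (\<forall>i<n. \<forall>j<n. i \<noteq> j \<longrightarrow> v i \<le> u j \<or> v j \<le> u i) \<longrightarrow>
    (\<Sum>i<n. v i - u i) < \<delta> \<longrightarrow> (\<Sum>i<n. norm (x (v i) - x (u i))) < e"
  proof (intro exI[of _ "e / (L + 1)"] conjI allI impI)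
    show "e / (L + 1) > 0" using e L by simp
    fix n :: nat and u v :: "nat \<Rightarrow> real"
    assume uv: "\<forall>i<n. a \<le> u i \<and> u i \<le> v i \<and> v i \<le> b" and s: "(\<Sum>i<n. v i - u i) < e / (L + 1)"
    have "(\<Sum>i<n. norm (x (v i) - x (u i))) \<le> (\<Sum>i<n. L * (v i - u i))"
    proof (rule sum_mono)
      fix i assume "i \<in> {..<n}"
      then have "a \<le> u i" "u i \<le> v i" "v i \<le> b" using uv by auto
      with lipschitz_onD[OF assms, of "v i" "u i"]
      show "norm (x (v i) - x (u i)) \<le> L * (v i - u i)" by (simp add: dist_norm dist_real_def)
    qed
    also have "\<dots> = L * (\<Sum>i<n. v i - u i)" by (simp add: sum_distrib_left)
    also have "\<dots> \<le> L * (e / (L + 1))" using s L by (intro mult_left_mono) auto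
    also have "\<dots> < e" using e L by (simp add: field_simps)
    finally show "(\<Sum>i<n. norm (x (v i) - x (u i))) < e" .
  qed
qed

lemma lipschitz_on_Icc_vector_derivative:
  fixes f :: "real \<Rightarrow> 'a::real_inner"
  assumes der: "\<And>t. (f has_vector_derivative f' t) (at t)"
    and B: "\<And>t. a \<le> t \<Longrightarrow> t \<le> b \<Longrightarrow> norm (f' t) \<le> B" "B \<ge> 0"
  shows "B-lipschitz_on {a..b} f"
proof (rule lipschitz_on_leI)
  fix s t assume st: "s \<in> {a..b}" "t \<in> {a..b}" "s \<le> t"
  show "dist (f s) (f t) \<le> B * dist s t"
  proof (cases "s = t")
    case False
    then have "s < t" using st by simp
    moreover have "continuous_on {s..t} f"
      by (rule continuous_on_vector_derivative[OF has_vector_derivative_at_within[OF der]])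
    ultimately obtain z where z: "z \<in> {s<..<t}" "norm (f t - f s) \<le> norm ((t - s) *\<^sub>R f' z)"
      using mvt_general[of s t f "\<lambda>z h. h *\<^sub>R f' z"] der unfolding has_vector_derivative_def by blast
    have "norm ((t - s) *\<^sub>R f' z) \<le> (t - s) * B"
      using z(1) st by (auto intro!: mult_left_mono B)
    with z(2) st show ?thesis by (simp add: dist_norm norm_minus_commute mult.commute)
  qed simp
qed (rule B)

text \<open>The head of the list is the earliest piece, so appending a list prolongs the
  trajectory.\<close>

primrec flow :: "(real \<times> (real^'n^'n)) list \<Rightarrow> real^'n \<Rightarrow> real^'n" where
  "flow [] v = v"
| "flow (p # l) v = flow l (mexp (snd p) (fst p) v)"

definition duration :: "(real \<times> (real^'n^'n)) list \<Rightarrow> real" where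
  "duration l = sum_list (map fst l)"

definition segments :: "(real^'n^'n) set \<Rightarrow> (real \<times> (real^'n^'n)) list set" where
  "segments \<A> = lists ({0<..} \<times> \<A>)"

lemma flow_append: "flow (l @ l') v = flow l' (flow l v)"
  by (induction l arbitrary: v) auto

lemma duration_simps [simp]:
  "duration [] = 0" "duration (p # l) = fst p + duration l"
  "duration (l @ l') = duration l + duration l'"
  by (simp_all add: duration_def)

lemma linear_flow: "linear (flow l)"
proof (induction l)
  case (Cons p l)
  then show ?case using linear_compose[OF linear_mexp[of "snd p" "fst p"] Cons] by (simp add: o_def)
qed (simp add: linear_id[unfolded id_def])

text \<open>Gluing makes x Lipschitz on bounded intervals, hence absolutely continuous, and the
  differential equation can fail only at the countably many breakpoints. By \<open>unbounded\<close>
  the pieces cover the whole half-line.\<close>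

lemma concatenated_trajectory:
  fixes seg :: "nat \<Rightarrow> real \<times> (real^'n^'n)" and v :: "real^'n"
  defines "T \<equiv> \<lambda>n. duration (map seg [0..<n])"
  assumes seg: "\<And>n. fst (seg n) > 0" "\<And>n. snd (seg n) \<in> \<A>"
    and unbounded: "\<And>B. \<exists>n. B < T n"
  shows "\<exists>x. trajectory \<A> x \<and> (\<forall>n. x (T n) = flow (map seg [0..<n]) v)"
proof -
  have TSuc: "T (Suc n) = T n + fst (seg n)" for n by (simp add: T_def)
  have T0: "T 0 = 0" by (simp add: T_def)
  have mono: "T m \<le> T n" if "m \<le> n" for m n
    using that by (rule lift_Suc_mono_le[of T, rotated]) (simp add: TSuc less_imp_le[OF seg(1)])
  \<comment> \<open>The index of the piece containing t; through \<open>LEAST\<close> its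
    measurability reduces to that of half-lines.\<close>
  define N where "N = (\<lambda>t. LEAST n. t < T (Suc n))"
  define X where "X = (\<lambda>n. flow (map seg [0..<n]) v)"
  have XSuc: "X (Suc n) = mexp (snd (seg n)) (fst (seg n)) (X n)" for n by (simp add: X_def flow_append)
  define x where "x = (\<lambda>t. mexp (snd (seg (N t))) (t - T (N t)) (X (N t)))"
  have N_eq: "N t = n" if "T n \<le> t" "t < T (Suc n)" for n t
    unfolding N_def
  proof (rule Least_equality)
    fix m assume "t < T (Suc m)"
    with that have "T n < T (Suc m)" by simp
    then show "n \<le> m" using mono[of "Suc m" n] by (meson not_le not_less_eq_eq)
  qed (rule that)
  have N_ex: "\<exists>n. T n \<le> t \<and> t < T (Suc n)" if "t \<ge> 0" for t
  proof -
    have ex: "\<exists>n. t < T (Suc n)"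
      using unbounded[of t] mono[of n "Suc n" for n] by (meson less_le_trans le_SucI order_refl)
    have "t < T (Suc (N t))" unfolding N_def by (rule LeastI_ex[OF ex])
    moreover have "T (N t) \<le> t"
    proof (cases "N t")
      case (Suc k)
      then have "\<not> t < T (Suc k)" using not_less_Least[of k "\<lambda>n. t < T (Suc n)"] by (simp add: N_def)
      then show ?thesis using Suc by simp
    qed (use T0 that in simp)
    ultimately show ?thesis by blast
  qed
  \<comment> \<open>The formula of a piece holds at its right end too, where \<open>N\<close> has
    already jumped; neighbouring pieces thus agree at the breakpoint and their Lipschitz bounds can
    be glued.\<close>
  have x_eq: "x t = mexp (snd (seg n)) (t - T n) (X n)" if "T n \<le> t" "t \<le> T (Suc n)" for n t
  proof (cases "t < T (Suc n)")
    case True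
    then show ?thesis using N_eq[OF that(1) True] by (simp add: x_def)
  next
    case False
    then have t: "t = T (Suc n)" using that by simp
    have "N t = Suc n" using t seg(1)[of "Suc n"] by (intro N_eq) (auto simp: TSuc)
    then show ?thesis using t by (simp add: x_def XSuc TSuc)
  qed
  have lip_seg: "\<exists>L. L-lipschitz_on {T n..T (Suc n)} x" for n
  proof -
    let ?f = "\<lambda>t. mexp (snd (seg n)) (t - T n) (X n)"
    have der: "(?f has_vector_derivative snd (seg n) *v ?f t) (at t)" for t
    proof -
      have "((\<lambda>s. mexp (snd (seg n)) s (X n)) \<circ> (\<lambda>t. t - T n) has_vector_derivative
          1 *\<^sub>R (snd (seg n) *v ?f t)) (at t)"
        by (rule vector_diff_chain_at[OF _ mexp_has_vector_derivative]) (auto intro!: derivative_eq_intros)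
      then show ?thesis by (simp add: o_def)
    qed
    have "compact ((\<lambda>t. snd (seg n) *v ?f t) ` {T n..T (Suc n)})"
      by (intro compact_continuous_image bounded_linear.continuous_on[OF matrix_vector_mul_bounded_linear]
          continuous_on_vector_derivative[OF has_vector_derivative_at_within[OF der]] compact_Icc)
    then obtain B where B: "B > 0" "\<And>t. t \<in> {T n..T (Suc n)} \<Longrightarrow> norm (snd (seg n) *v ?f t) \<le> B"
      by (auto dest!: compact_imp_bounded simp: bounded_pos)
    have "B-lipschitz_on {T n..T (Suc n)} ?f"
      using B by (intro lipschitz_on_Icc_vector_derivative[OF der]) auto
    then have "B-lipschitz_on {T n..T (Suc n)} x"
      by (rule lipschitz_on_transform) (auto simp: x_eq)
    then show ?thesis ..
  qed
  have lip: "\<exists>L. L-lipschitz_on {0..T n} x" for n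
  proof (induction n)
    case 0
    show ?case by (auto simp: T0 intro!: exI[of _ 0] lipschitz_onI)
  next
    case (Suc n)
    then obtain L M where "L-lipschitz_on {0..T n} x" "M-lipschitz_on {T n..T (Suc n)} x"
      using lip_seg by blast
    from lipschitz_on_concat_max[OF this refl] show ?case by auto
  qed
  have "abs_cont_on 0 t x" if t: "t \<ge> 0" for t
  proof -
    obtain n where "t < T (Suc n)" using N_ex[OF t] by blast
    moreover obtain L where "L-lipschitz_on {0..T (Suc n)} x" using lip by blast
    ultimately have "L-lipschitz_on {0..t} x" by (auto intro: lipschitz_on_subset)
    then show ?thesis by (rule lipschitz_imp_abs_cont_on)
  qed
  moreover have "(\<lambda>t. snd (seg (N t))) \<in> borel_measurable (restrict_space lebesgue {0..})"
  proof (rule measurable_restrict_space1, rule measurable_compose[where f = N and g = "\<lambda>n. snd (seg n)" and N = "count_space UNIV"])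
    have "Measurable.pred lebesgue (\<lambda>t. t < T (Suc i))" for i
      unfolding pred_def using sets_completionI_sets[of "{..<T (Suc i)}" lborel] by (simp add: lessThan_def)
    then show "N \<in> lebesgue \<rightarrow>\<^sub>M count_space UNIV" unfolding N_def by (rule measurable_Least)
  qed simp
  moreover have "AE t in lebesgue. t \<ge> 0 \<longrightarrow> (x has_vector_derivative (snd (seg (N t)) *v x t)) (at t)"
  proof -
    have "AE t in lborel. t \<notin> range T" by (intro AE_not_in countable_imp_null_set_lborel) simp
    then have "AE t in lebesgue. t \<notin> range T" by (rule AE_completion)
    then show ?thesis
    proof eventually_elim
      case (elim t)
      show ?case
      proof
        assume "t \<ge> 0"
        then obtain n where "T n \<le> t" "t < T (Suc n)" using N_ex by blast
        with elim have t: "T n < t" "t < T (Suc n)" by (auto simp: less_le)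
        let ?f = "\<lambda>t. mexp (snd (seg n)) (t - T n) (X n)"
        have "((\<lambda>s. mexp (snd (seg n)) s (X n)) \<circ> (\<lambda>t. t - T n) has_vector_derivative
            1 *\<^sub>R (snd (seg n) *v ?f t)) (at t)"
          by (rule vector_diff_chain_at[OF _ mexp_has_vector_derivative]) (auto intro!: derivative_eq_intros)
        then have "(?f has_vector_derivative snd (seg n) *v ?f t) (at t)" by (simp add: o_def)
        then have "(x has_vector_derivative snd (seg n) *v ?f t) (at t)"
          by (rule has_vector_derivative_transform_within_open[of _ _ _ "{T n<..<T (Suc n)}"])
            (use t x_eq[of n] in auto)
        moreover have "N t = n" using t by (intro N_eq) auto
        ultimately show "(x has_vector_derivative (snd (seg (N t)) *v x t)) (at t)"
          using t x_eq[of n t] by simp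
      qed
    qed
  qed
  ultimately have "trajectory \<A> x"
    unfolding trajectory_def using seg(2) by blast
  moreover have "x (T n) = X n" for n using x_eq[of n "T n"] seg(1)[of n] by (simp add: TSuc)
  ultimately show ?thesis unfolding X_def by blast
qed

lemma segments_simps [simp]:
  "[] \<in> segments \<A>" "p # l \<in> segments \<A> \<longleftrightarrow> fst p > 0 \<and> snd p \<in> \<A> \<and> l \<in> segments \<A>"
  "l @ l' \<in> segments \<A> \<longleftrightarrow> l \<in> segments \<A> \<and> l' \<in> segments \<A>"
  by (auto simp: segments_def mem_Times_iff)

text \<open>Prefixes are never revised, so the lists have a limit sequence. Each step adds at least
  one piece, hence entry i is present and final in \<open>L (Suc i)\<close>.\<close>

lemma trajectory_of_growing_lists:
  assumes L: "\<And>n. L n \<in> segments \<A>" "\<And>n. real n \<le> duration (L n)"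
    and grow: "\<And>n. \<exists>B. B \<noteq> [] \<and> L (Suc n) = L n @ B"
  shows "\<exists>x. trajectory \<A> x \<and> (\<forall>n. x (duration (L n)) = flow (L n) v)"
proof -
  have len: "n \<le> length (L n)" for n
  proof (induction n)
    case (Suc n)
    obtain B where "B \<noteq> []" "L (Suc n) = L n @ B" using grow by blast
    then show ?case using Suc by (cases B) auto
  qed simp
  have prefix: "take (length (L m)) (L (m + k)) = L m" for m k
  proof (induction k)
    case (Suc k)
    obtain B where B: "L (Suc (m + k)) = L (m + k) @ B" using grow by blast
    have "length (L m) \<le> length (L (m + k))" using Suc by (metis length_take min.cobounded1)
    then show ?case using Suc B by simp
  qed simp
  have nth_eq: "L m ! i = L n ! i" if "m \<le> n" "i < length (L m)" for m n i
    using prefix[of m "n - m"] that by (metis le_add_diff_inverse nth_take)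
  define seg where "seg = (\<lambda>i. L (Suc i) ! i)"
  have seg_eq: "map seg [0..<length (L n)] = L n" for n
  proof (rule nth_equalityI)
    fix i assume "i < length (map seg [0..<length (L n)])"
    then have i: "i < length (L n)" by simp
    have i': "i < length (L (Suc i))" using len[of "Suc i"] by simp
    have "L (Suc i) ! i = L n ! i"
    proof (cases "Suc i \<le> n")
      case True then show ?thesis by (rule nth_eq[OF _ i'])
    next
      case False
      then have "n \<le> Suc i" by simp
      from nth_eq[OF this i] show ?thesis by (rule sym)
    qed
    then show "map seg [0..<length (L n)] ! i = L n ! i" using i by (simp add: seg_def)
  qed simp
  have seg: "fst (seg i) > 0 \<and> snd (seg i) \<in> \<A>" for i
  proof -
    have "seg i \<in> set (L (Suc i))" using len[of "Suc i"] by (simp add: seg_def)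
    with L(1)[of "Suc i"] show ?thesis by (auto simp: segments_def in_lists_conv_set mem_Times_iff)
  qed
  have "\<exists>n. b < duration (map seg [0..<n])" for b
  proof -
    obtain n where "b < real n" using reals_Archimedean2 by blast
    with L(2)[of n] have "b < duration (map seg [0..<length (L n)])" by (simp add: seg_eq)
    then show ?thesis by blast
  qed
  then obtain x where x: "trajectory \<A> x"
    "\<And>n. x (duration (map seg [0..<n])) = flow (map seg [0..<n]) v"
    using concatenated_trajectory[of seg \<A> v] seg by blast
  from x(2)[of "length (L n)" for n] x(1) show ?thesis unfolding seg_eq by blast
qed

section \<open>Uniform growth bound for piecewise constant flows\<close>

definition flow_growth :: "real \<Rightarrow> (real \<times> (real^'n^'n)) list \<Rightarrow> real^'n \<Rightarrow> real" where
  "flow_growth \<beta> l v = exp (\<beta> * duration l) * norm (flow l v)"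

lemma flow_growth_append:
  "flow_growth \<beta> (l @ l') v = exp (\<beta> * duration l) * flow_growth \<beta> l' (flow l v)"
  by (simp add: flow_growth_def flow_append distrib_left exp_add)

text \<open>The vectors on which all flows are uniformly bounded form a subspace that is invariant under the
  injective maps \<open>exp (s A)\<close>, so its complement is invariant too. From a vector outside of it one can
  therefore keep concatenating segments and build a single trajectory violating the bound.\<close>
lemma flow_growth_bounded:
  fixes \<A> :: "(real^'n^'n) set"
  assumes ne: "\<A> \<noteq> {}"
    and decay: "\<And>x. trajectory \<A> x \<Longrightarrow> \<exists>C. \<forall>t\<ge>0. norm (x t) \<le> C * exp (- \<beta> * t)"
  shows "\<exists>C. \<forall>l\<in>segments \<A>. flow_growth \<beta> l v \<le> C"
proof (rule ccontr)
  define W where "W = {v. \<exists>C. \<forall>l\<in>segments \<A>. flow_growth \<beta> l v \<le> C}"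
  assume "\<not> ?thesis"
  then have vW: "v \<notin> W" by (simp add: W_def)
  have subspace: "subspace W"
  proof (rule subspaceI)
    show "0 \<in> W" by (auto simp: W_def flow_growth_def linear_0[OF linear_flow])
  next
    fix u w assume "u \<in> W" "w \<in> W"
    then obtain C D where C: "\<forall>l\<in>segments \<A>. flow_growth \<beta> l u \<le> C" and
      D: "\<forall>l\<in>segments \<A>. flow_growth \<beta> l w \<le> D" by (auto simp: W_def)
    have "flow_growth \<beta> l (u + w) \<le> C + D" if "l \<in> segments \<A>" for l
    proof -
      have "flow_growth \<beta> l (u + w) \<le> exp (\<beta> * duration l) * (norm (flow l u) + norm (flow l w))"
        unfolding flow_growth_def linear_add[OF linear_flow]
        by (intro mult_left_mono norm_triangle_ineq) auto
      also have "\<dots> = flow_growth \<beta> l u + flow_growth \<beta> l w" by (simp add: flow_growth_def distrib_left)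
      finally show ?thesis using C D that by fastforce
    qed
    then show "u + w \<in> W" by (auto simp: W_def)
  next
    fix c u assume "u \<in> W"
    then obtain C where C: "\<forall>l\<in>segments \<A>. flow_growth \<beta> l u \<le> C" by (auto simp: W_def)
    have "flow_growth \<beta> l (c *\<^sub>R u) \<le> \<bar>c\<bar> * C" if "l \<in> segments \<A>" for l
    proof -
      have "flow_growth \<beta> l (c *\<^sub>R u) = \<bar>c\<bar> * flow_growth \<beta> l u"
        by (simp add: flow_growth_def linear_scale[OF linear_flow])
      also have "\<dots> \<le> \<bar>c\<bar> * C" using C that by (intro mult_left_mono) auto
      finally show ?thesis .
    qed
    then show "c *\<^sub>R u \<in> W" by (auto simp: W_def)
  qed
  have inv: "mexp A s u \<in> W" if "u \<in> W" "s > 0" "A \<in> \<A>" for A s u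
  proof -
    obtain C where C: "\<forall>l\<in>segments \<A>. flow_growth \<beta> l u \<le> C" using \<open>u \<in> W\<close> by (auto simp: W_def)
    have "flow_growth \<beta> l (mexp A s u) \<le> exp (- \<beta> * s) * C" if l: "l \<in> segments \<A>" for l
    proof -
      have "(s, A) # l \<in> segments \<A>" using l \<open>s > 0\<close> \<open>A \<in> \<A>\<close> by simp
      then have "flow_growth \<beta> ([(s, A)] @ l) u \<le> C" using C by simp
      then have "exp (- \<beta> * s) * (exp (\<beta> * s) * flow_growth \<beta> l (mexp A s u)) \<le> exp (- \<beta> * s) * C"
        unfolding flow_growth_append by (intro mult_left_mono) simp_all
      moreover have "exp (- \<beta> * s) * (exp (\<beta> * s) * flow_growth \<beta> l (mexp A s u)) =
          flow_growth \<beta> l (mexp A s u)" by (simp add: exp_minus)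
      ultimately show ?thesis by (simp only:)
    qed
    then show ?thesis by (auto simp: W_def)
  qed
  have out: "mexp A s u \<notin> W" if u: "u \<notin> W" "s > 0" "A \<in> \<A>" for A s u
  proof
    assume 1: "mexp A s u \<in> W"
    have lin: "linear (mexp A s)" by (rule linear_mexp)
    have inj: "inj (mexp A s)"
      unfolding linear_injective_0[OF lin] using mexp_nonzero[of _ s A] u(2) by (metis less_imp_le)
    have "mexp A s ` W = W"
    proof (rule subspace_dim_equal)
      show "subspace (mexp A s ` W)" using subspace lin by (rule linear_subspace_image[rotated])
      show "mexp A s ` W \<subseteq> W" using inv u by blast
      have "dim (mexp A s ` W) = dim W"
        using lin by (intro dim_image_eq) (auto intro: inj_on_subset[OF inj])
      then show "dim (mexp A s ` W) \<ge> dim W" by simp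
    qed (rule subspace)
    then obtain w where "w \<in> W" "mexp A s u = mexp A s w" using 1 by blast
    with inj u(1) show False by (auto dest: injD)
  qed
  have outs: "flow l u \<notin> W" if "u \<notin> W" "l \<in> segments \<A>" for l u
    using that by (induction l arbitrary: u) (auto simp: out)
  obtain A0 where A0: "A0 \<in> \<A>" using ne by blast
  \<comment> \<open>The disjunct \<open>n = 0\<close> admits the empty list as a start.\<close>
  define P where "P = (\<lambda>n L. L \<in> segments \<A> \<and> real n \<le> duration L \<and> (n = 0 \<or> real n < flow_growth \<beta> L v))"
  have "\<exists>L. \<forall>n. P n (L n) \<and> (\<exists>B. B \<noteq> [] \<and> L (Suc n) = L n @ B)"
  proof (rule dependent_nat_choice)
    show "\<exists>L. P 0 L" by (auto simp: P_def intro: exI[of _ "[]"])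
  next
    fix L n assume P: "P n L"
    \<comment> \<open>The piece of length 1 drives the total duration to infinity. The state after
      it is still outside \<open>W\<close>, so some continuation exceeds any prescribed
      growth.\<close>
    define L1 where "L1 = L @ [(1, A0)]"
    have L1: "L1 \<in> segments \<A>" using P A0 by (simp add: L1_def P_def)
    have "flow L1 v \<notin> W" by (rule outs[OF vW L1])
    then obtain l where l: "l \<in> segments \<A>"
      "flow_growth \<beta> l (flow L1 v) > real (Suc n) * exp (- \<beta> * duration L1)"
      unfolding W_def by (auto simp: not_le)
    have "exp (\<beta> * duration L1) * (real (Suc n) * exp (- \<beta> * duration L1)) < flow_growth \<beta> (L1 @ l) v"
      unfolding flow_growth_append using l(2) by (intro mult_strict_left_mono) simp_all
    also have "exp (\<beta> * duration L1) * (real (Suc n) * exp (- \<beta> * duration L1)) = real (Suc n)"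
      by (simp add: exp_minus field_simps)
    finally have g: "real (Suc n) < flow_growth \<beta> (L1 @ l) v" .
    have "duration l \<ge> 0"
      using l(1) by (induction l) (auto simp: less_imp_le)
    then have "P (Suc n) (L1 @ l)" using P L1 l(1) g by (auto simp: P_def L1_def)
    moreover have "L1 @ l = L @ ((1, A0) # l)" by (simp add: L1_def)
    ultimately show "\<exists>y. P (Suc n) y \<and> (\<exists>B. B \<noteq> [] \<and> y = L @ B)" by blast
  qed
  then obtain L where L: "\<And>n. P n (L n)" "\<And>n. \<exists>B. B \<noteq> [] \<and> L (Suc n) = L n @ B" by blast
  obtain x where x: "trajectory \<A> x" "\<And>n. x (duration (L n)) = flow (L n) v"
    using trajectory_of_growing_lists[of L \<A> v] L unfolding P_def by blast
  obtain C where C: "\<And>t. t \<ge> 0 \<Longrightarrow> norm (x t) \<le> C * exp (- \<beta> * t)" using decay[OF x(1)] by blast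
  obtain n where n: "C < real n" "n > 0"
    using reals_Archimedean2[of "max C 0"] by (metis max_less_iff_conj of_nat_0_less_iff)
  have "duration (L n) \<ge> 0" "real n < flow_growth \<beta> (L n) v"
    using L(1)[of n] n(2) by (auto simp: P_def)
  then have "norm (flow (L n) v) \<le> C * exp (- \<beta> * duration (L n))" using C x(2) by metis
  then have "flow_growth \<beta> (L n) v \<le> exp (\<beta> * duration (L n)) * (C * exp (- \<beta> * duration (L n)))"
    unfolding flow_growth_def by (intro mult_left_mono) auto
  also have "\<dots> = C" by (simp add: exp_minus field_simps)
  finally show False using n(1) \<open>real n < flow_growth \<beta> (L n) v\<close> by simp
qed

section \<open>Growth of absolutely continuous trajectories\<close>

text \<open>Tagged divisions are sets of pairs, not numbered families, which calls for arbitrary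
  finite index sets.\<close>

lemma abs_cont_on_finite_sum:
  fixes x :: "real \<Rightarrow> 'a::real_normed_vector"
  assumes "abs_cont_on a b x" "e > 0"
  shows "\<exists>\<delta>>0. \<forall>(P :: 'i set) u v. finite P \<longrightarrow> (\<forall>i\<in>P. a \<le> u i \<and> u i \<le> v i \<and> v i \<le> b) \<longrightarrow>
    (\<forall>i\<in>P. \<forall>j\<in>P. i \<noteq> j \<longrightarrow> v i \<le> u j \<or> v j \<le> u i) \<longrightarrow>
    (\<Sum>i\<in>P. v i - u i) < \<delta> \<longrightarrow> (\<Sum>i\<in>P. norm (x (v i) - x (u i))) < e"
proof -
  obtain \<delta> where \<delta>: "\<delta> > 0" "\<And>(n::nat) u v. \<lbrakk>\<forall>i<n. a \<le> u i \<and> u i \<le> v i \<and> v i \<le> b;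
      \<forall>i<n. \<forall>j<n. i \<noteq> j \<longrightarrow> v i \<le> u j \<or> v j \<le> u i; (\<Sum>i<n. v i - u i) < \<delta>\<rbrakk> \<Longrightarrow>
      (\<Sum>i<n. norm (x (v i) - x (u i))) < e"
    using assms unfolding abs_cont_on_def by blast
  show ?thesis
  proof (intro exI[of _ \<delta>] conjI allI impI \<delta>(1))
    fix P :: "'i set" and u v :: "'i \<Rightarrow> real"
    assume P: "finite P" "\<forall>i\<in>P. a \<le> u i \<and> u i \<le> v i \<and> v i \<le> b"
      "\<forall>i\<in>P. \<forall>j\<in>P. i \<noteq> j \<longrightarrow> v i \<le> u j \<or> v j \<le> u i" "(\<Sum>i\<in>P. v i - u i) < \<delta>"
    obtain h where h: "bij_betw h {..<card P} P"
      using ex_bij_betw_nat_finite[OF P(1)] by (auto simp: atLeast0LessThan)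
    have hP: "h i \<in> P" if "i < card P" for i using h that by (auto simp: bij_betw_def)
    have hne: "h i \<noteq> h j" if "i < card P" "j < card P" "i \<noteq> j" for i j
      using h that by (auto simp: bij_betw_def inj_on_def)
    have "(\<Sum>i<card P. v (h i) - u (h i)) < \<delta>"
      using P(4) unfolding sum.reindex_bij_betw[OF h, of "\<lambda>i. v i - u i"] .
    then have "(\<Sum>i<card P. norm (x (v (h i)) - x (u (h i)))) < e"
      using P(2,3) hP hne by (intro \<delta>(2)) auto
    then show "(\<Sum>i\<in>P. norm (x (v i) - x (u i))) < e"
      unfolding sum.reindex_bij_betw[OF h, of "\<lambda>i. norm (x (v i) - x (u i))"] .
  qed
qed

text \<open>By Cousin's lemma there is a tagged division whose intervals are controlled by the derivative when
  the tag is a point of differentiability, and otherwise lie in an open set of small measure, where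
  absolute continuity applies.\<close>
lemma abs_cont_increment_le:
  fixes x :: "real \<Rightarrow> 'a::real_normed_vector"
  assumes ac: "abs_cont_on a b x" and ab: "a \<le> b" and N: "N \<in> null_sets lebesgue"
    and der: "\<And>t. t \<in> {a..b} - N \<Longrightarrow> (x has_vector_derivative x' t) (at t)"
    and bound: "\<And>t. t \<in> {a..b} - N \<Longrightarrow> norm (x' t) \<le> C" and C: "C \<ge> 0"
  shows "norm (x b - x a) \<le> C * (b - a)"
proof (rule field_le_epsilon)
  fix e0 :: real assume e0: "e0 > 0"
  define e where "e = e0 / (b - a + 1)"
  have e: "e > 0" using e0 ab by (simp add: e_def)
  obtain \<delta> where \<delta>: "\<delta> > 0" "\<forall>(P :: (real \<times> real set) set) u v. finite P \<longrightarrow>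
    (\<forall>i\<in>P. a \<le> u i \<and> u i \<le> v i \<and> v i \<le> b) \<longrightarrow>
    (\<forall>i\<in>P. \<forall>j\<in>P. i \<noteq> j \<longrightarrow> v i \<le> u j \<or> v j \<le> u i) \<longrightarrow>
    (\<Sum>i\<in>P. v i - u i) < \<delta> \<longrightarrow> (\<Sum>i\<in>P. norm (x (v i) - x (u i))) < e"
    using abs_cont_on_finite_sum[OF ac e, where 'i = "real \<times> real set"] by (elim exE conjE)
  obtain G where G: "open G" "N \<subseteq> G" "emeasure lebesgue (G - N) < ennreal \<delta>"
    using sets_lebesgue_outer_open[of N \<delta>] N \<delta>(1) by (metis null_setsD2)
  have Gs: "G \<in> sets lebesgue" using G(1) by (simp add: borel_open)
  have G_less: "emeasure lebesgue G < ennreal \<delta>"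
    using G(3) emeasure_Diff_null_set[OF N Gs] by simp
  then have Gfin: "emeasure lebesgue G \<noteq> \<infinity>" by auto
  have Gm: "measure lebesgue G < \<delta>"
    using G_less emeasure_eq_ennreal_measure[of lebesgue G] Gfin by (simp add: ennreal_less_iff)
  have "\<exists>d>0. \<forall>y. \<bar>y - t\<bar> < d \<longrightarrow> norm (x y - x t - (y - t) *\<^sub>R x' t) \<le> e * \<bar>y - t\<bar>"
    if "t \<in> {a..b} - N" for t
    using der[OF that] e unfolding has_vector_derivative_def has_derivative_at_alt by auto
  then obtain d where d: "\<And>t. t \<in> {a..b} - N \<Longrightarrow> d t > 0"
    "\<And>t y. t \<in> {a..b} - N \<Longrightarrow> \<bar>y - t\<bar> < d t \<Longrightarrow> norm (x y - x t - (y - t) *\<^sub>R x' t) \<le> e * \<bar>y - t\<bar>"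
    by metis
  define \<gamma> where "\<gamma> = (\<lambda>t. if t \<in> N then G else if t \<in> {a..b} then ball t (d t) else UNIV)"
  have "gauge \<gamma>" using G d(1) by (auto simp: gauge_def \<gamma>_def)
  then obtain p where p: "p tagged_division_of {a..b}" "\<gamma> fine p" by (rule fine_division_exists_real)
  note pD = tagged_division_ofD[OF p(1)]
  have Icc: "\<exists>u v. K = {u..v} \<and> u \<le> t \<and> t \<le> v \<and> a \<le> u \<and> v \<le> b \<and> Inf K = u \<and> Sup K = v" if K: "(t, K) \<in> p" for t K
  proof -
    obtain u v where uv: "K = {u..v}" using pD(4)[OF K] by auto
    moreover have "t \<in> K" "K \<subseteq> {a..b}" using pD(2,3)[OF K] by auto
    ultimately show ?thesis by (intro exI[of _ u] exI[of _ v]) auto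
  qed
  \<comment> \<open>Degenerate intervals are left out: their increment is 0, and one lying inside
    another interval would violate the non-overlap condition of absolute continuity.\<close>
  define P2 where "P2 = {(t, K) \<in> p. t \<in> N \<and> Inf K < Sup K}"
  define \<Delta> where "\<Delta> = (\<lambda>q::real \<times> real set. Sup (snd q) - Inf (snd q))"
  define \<Phi> where "\<Phi> = (\<lambda>q::real \<times> real set. x (Sup (snd q)) - x (Inf (snd q)))"
  have fin: "finite p" "finite P2" using pD(1) by (auto simp: P2_def intro: finite_subset[of _ p])
  have \<Delta>_nonneg: "\<Delta> q \<ge> 0" if "q \<in> p" for q using Icc[of "fst q" "snd q"] that by (auto simp: \<Delta>_def)
  have good: "norm (\<Phi> q) \<le> (C + e) * \<Delta> q" if q: "q \<in> p" "q \<notin> P2" for q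
  proof -
    obtain t K where tK: "q = (t, K)" by (cases q)
    obtain u v where uv: "K = {u..v}" "u \<le> t" "t \<le> v" "a \<le> u" "v \<le> b" "Inf K = u" "Sup K = v"
      using Icc q tK by blast
    show ?thesis
    proof (cases "u = v")
      case True then show ?thesis by (simp add: \<Phi>_def \<Delta>_def tK uv(6,7))
    next
      case False
      then have tN: "t \<in> {a..b} - N" using q uv tK by (auto simp: P2_def)
      have "K \<subseteq> \<gamma> t" using p(2) q(1) tK unfolding fine_def by blast
      then have "K \<subseteq> ball t (d t)" using tN by (simp add: \<gamma>_def)
      moreover have "u \<in> K" "v \<in> K" using uv by auto
      ultimately have "\<bar>u - t\<bar> < d t" "\<bar>v - t\<bar> < d t" by (auto simp: dist_real_def abs_minus_commute subset_iff)
      then have n: "norm (x u - x t - (u - t) *\<^sub>R x' t) \<le> e * (t - u)" "norm (x v - x t - (v - t) *\<^sub>R x' t) \<le> e * (v - t)"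
        using d(2)[OF tN, of u] d(2)[OF tN, of v] uv by auto
      have "x v - x u = (v - u) *\<^sub>R x' t + ((x v - x t - (v - t) *\<^sub>R x' t) - (x u - x t - (u - t) *\<^sub>R x' t))"
        by (simp add: algebra_simps)
      then have "norm (x v - x u) \<le> norm ((v - u) *\<^sub>R x' t) +
          (norm (x v - x t - (v - t) *\<^sub>R x' t) + norm (x u - x t - (u - t) *\<^sub>R x' t))"
        using norm_triangle_ineq norm_triangle_ineq4 order_trans add_left_mono by metis
      also have "\<dots> \<le> (v - u) * C + (e * (v - t) + e * (t - u))"
        using n bound[OF tN] uv by (intro add_mono) (auto intro!: mult_left_mono)
      finally show ?thesis by (simp add: \<Phi>_def \<Delta>_def tK uv(6,7) algebra_simps)
    qed
  qed
  have "(\<Sum>q\<in>P2. \<Delta> q) < \<delta>"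
  proof -
    have Ioo: "interior (snd q) = {Inf (snd q)<..<Sup (snd q)}" "snd q \<subseteq> G" if "q \<in> P2" for q
    proof -
      have "(fst q, snd q) \<in> p" "fst q \<in> N" using that by (auto simp: P2_def)
      then show "snd q \<subseteq> G" using fineD[OF p(2), of "fst q" "snd q"] by (simp add: \<gamma>_def)
      obtain u v where "snd q = {u..v}" "Inf (snd q) = u" "Sup (snd q) = v"
        using Icc[OF \<open>(fst q, snd q) \<in> p\<close>] by blast
      then show "interior (snd q) = {Inf (snd q)<..<Sup (snd q)}" by (metis interior_atLeastAtMost_real)
    qed
    have "(\<Sum>q\<in>P2. \<Delta> q) = (\<Sum>q\<in>P2. measure lebesgue (interior (snd q)))"
      by (intro sum.cong) (auto simp: Ioo \<Delta>_def P2_def)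
    also have "\<dots> = measure lebesgue (\<Union>q\<in>P2. interior (snd q))"
    proof (rule measure_finite_Union[symmetric])
      show "disjoint_family_on (\<lambda>q. interior (snd q)) P2"
        using pD(5) by (fastforce simp: disjoint_family_on_def P2_def)
      show "emeasure lebesgue (interior (snd q)) \<noteq> \<infinity>" if "q \<in> P2" for q
        using Ioo(1)[OF that] that emeasure_lborel_Ioo[of "Inf (snd q)" "Sup (snd q)"] by (auto simp: P2_def)
    qed (use fin in \<open>auto intro: borel_open\<close>)
    also have "\<dots> \<le> measure lebesgue G"
    proof (rule measure_mono_fmeasurable)
      show "(\<Union>q\<in>P2. interior (snd q)) \<subseteq> G" using Ioo(2) interior_subset by blast
      show "(\<Union>q\<in>P2. interior (snd q)) \<in> sets lebesgue" using fin by (auto intro!: sets.finite_UN borel_open)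
      show "G \<in> lmeasurable" using Gs Gfin by (auto intro: fmeasurableI simp: less_top)
    qed
    finally show ?thesis using Gm by simp
  qed
  then have bad: "(\<Sum>q\<in>P2. norm (\<Phi> q)) < e"
    unfolding \<Delta>_def \<Phi>_def
  proof (rule \<delta>(2)[rule_format, OF fin(2), rotated 2])
    fix q assume "q \<in> P2"
    then show "a \<le> Inf (snd q) \<and> Inf (snd q) \<le> Sup (snd q) \<and> Sup (snd q) \<le> b"
      using Icc[of "fst q" "snd q"] by (auto simp: P2_def)
  next
    fix q r assume qr: "q \<in> P2" "r \<in> P2" "q \<noteq> r"
    then have m: "(fst q, snd q) \<in> p" "(fst r, snd r) \<in> p" "(fst q, snd q) \<noteq> (fst r, snd r)"
      and l: "Inf (snd q) < Sup (snd q)" "Inf (snd r) < Sup (snd r)" by (auto simp: P2_def)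
    obtain u v where q: "snd q = {u..v}" "Inf (snd q) = u" "Sup (snd q) = v" using Icc[OF m(1)] by blast
    obtain u' v' where r: "snd r = {u'..v'}" "Inf (snd r) = u'" "Sup (snd r) = v'" using Icc[OF m(2)] by blast
    have "{u<..<v} \<inter> {u'<..<v'} = {}"
      using pD(5)[OF m] by (simp add: q r interior_atLeastAtMost_real)
    then have "(max u u' + min v v') / 2 \<notin> {u<..<v} \<inter> {u'<..<v'}" by blast
    then show "Sup (snd q) \<le> Inf (snd r) \<or> Sup (snd r) \<le> Inf (snd q)"
      using l unfolding q(2,3) r(2,3) by (auto simp: max_def min_def split: if_splits)
  qed
  have "x b - x a = (\<Sum>q\<in>p. \<Phi> q)"
    using additive_tagged_division_1[OF ab p(1), of x] by (simp add: \<Phi>_def case_prod_unfold)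
  then have "norm (x b - x a) \<le> (\<Sum>q\<in>p. norm (\<Phi> q))" by (simp add: norm_sum)
  also have "\<dots> = (\<Sum>q\<in>p - P2. norm (\<Phi> q)) + (\<Sum>q\<in>P2. norm (\<Phi> q))"
    using fin by (intro sum.subset_diff) (auto simp: P2_def)
  also have "\<dots> \<le> (\<Sum>q\<in>p - P2. (C + e) * \<Delta> q) + e"
    using bad by (intro add_mono sum_mono good) auto
  also have "(\<Sum>q\<in>p - P2. (C + e) * \<Delta> q) \<le> (\<Sum>q\<in>p. (C + e) * \<Delta> q)"
    using fin C e \<Delta>_nonneg by (intro sum_mono2) auto
  also have "(\<Sum>q\<in>p. (C + e) * \<Delta> q) = (C + e) * (b - a)"
    using additive_tagged_division_1[OF ab p(1), of "\<lambda>t. t"]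
    by (simp add: \<Delta>_def case_prod_unfold flip: sum_distrib_left)
  finally have "norm (x b - x a) \<le> C * (b - a) + e * (b - a + 1)" by (simp add: algebra_simps)
  also have "e * (b - a + 1) = e0" using ab by (simp add: e_def)
  finally show "norm (x b - x a) \<le> C * (b - a) + e0" by simp
qed

lemma abs_cont_on_imp_continuous_on:
  assumes "abs_cont_on a b x"
  shows "continuous_on {a..b} x"
  unfolding continuous_on_iff
proof (intro ballI allI impI)
  fix s e :: real assume s: "s \<in> {a..b}" and e: "e > 0"
  obtain \<delta> where \<delta>: "\<delta> > 0" "\<forall>(P :: unit set) u v. finite P \<longrightarrow>
    (\<forall>i\<in>P. a \<le> u i \<and> u i \<le> v i \<and> v i \<le> b) \<longrightarrow>
    (\<forall>i\<in>P. \<forall>j\<in>P. i \<noteq> j \<longrightarrow> v i \<le> u j \<or> v j \<le> u i) \<longrightarrow>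
    (\<Sum>i\<in>P. v i - u i) < \<delta> \<longrightarrow> (\<Sum>i\<in>P. norm (x (v i) - x (u i))) < e"
    using abs_cont_on_finite_sum[OF assms e, where 'i = unit] by (elim exE conjE)
  have "dist (x t) (x s) < e" if t: "t \<in> {a..b}" "dist t s < \<delta>" for t
  proof (cases "s \<le> t")
    case True
    then show ?thesis using \<delta>(2)[rule_format, of "{()}" "\<lambda>_. s" "\<lambda>_. t"] s t
      by (auto simp: dist_norm)
  next
    case False
    then show ?thesis using \<delta>(2)[rule_format, of "{()}" "\<lambda>_. t" "\<lambda>_. s"] s t
      by (auto simp: dist_norm norm_minus_commute)
  qed
  with \<delta>(1) show "\<exists>d>0. \<forall>t\<in>{a..b}. dist t s < d \<longrightarrow> dist (x t) (x s) < e" by blast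
qed

lemma abs_cont_on_subset:
  assumes "abs_cont_on a b x" "a \<le> c" "d \<le> b"
  shows "abs_cont_on c d x"
proof -
  have "(\<forall>i<n. a \<le> u i \<and> u i \<le> v i \<and> v i \<le> b)" if "\<forall>i<n. c \<le> u i \<and> u i \<le> v i \<and> v i \<le> d"
    for n :: nat and u v :: "nat \<Rightarrow> real"
    using that assms(2,3) by force
  note sub = this
  show ?thesis
    unfolding abs_cont_on_def
  proof (intro allI impI)
    fix e :: real assume "e > 0"
    then obtain \<delta> where \<delta>: "\<delta> > 0" "\<And>(n::nat) u v. \<lbrakk>\<forall>i<n. a \<le> u i \<and> u i \<le> v i \<and> v i \<le> b;
        \<forall>i<n. \<forall>j<n. i \<noteq> j \<longrightarrow> v i \<le> u j \<or> v j \<le> u i; (\<Sum>i<n. v i - u i) < \<delta>\<rbrakk> \<Longrightarrow>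
        (\<Sum>i<n. norm (x (v i) - x (u i))) < e"
      using assms(1) unfolding abs_cont_on_def by blast
    show "\<exists>\<delta>>0. \<forall>(n::nat) u v. (\<forall>i<n. c \<le> u i \<and> u i \<le> v i \<and> v i \<le> d) \<longrightarrow>
        (\<forall>i<n. \<forall>j<n. i \<noteq> j \<longrightarrow> v i \<le> u j \<or> v j \<le> u i) \<longrightarrow>
        (\<Sum>i<n. v i - u i) < \<delta> \<longrightarrow> (\<Sum>i<n. norm (x (v i) - x (u i))) < e"
      by (rule exI[of _ \<delta>], rule conjI[OF \<delta>(1)], intro allI impI, rule \<delta>(2), rule sub)
  qed
qed

text \<open>This makes the set in \<open>lyap_exp\<close> non-empty, so that its \<open>Inf\<close>
  is meaningful. On a window of length h the largest norm exceeds the initial one by at most K h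
  \<le> 1/2 times itself, so the norm at most doubles per window.\<close>

lemma trajectory_exp_bounded:
  fixes \<A> :: "(real^'n^'n) set"
  assumes K: "\<And>A v. A \<in> \<A> \<Longrightarrow> norm (A *v v) \<le> K * norm v" and "K \<ge> 0"
  shows "\<exists>\<alpha>. \<forall>x. trajectory \<A> x \<longrightarrow> (\<exists>C. \<forall>t\<ge>0. norm (x t) \<le> C * exp (\<alpha> * t))"
proof -
  define h where "h = 1 / (2 * (K + 1))"
  have h: "h > 0" "K * h \<le> 1 / 2" using \<open>K \<ge> 0\<close> by (auto simp: h_def field_simps)
  have "\<exists>C. \<forall>t\<ge>0. norm (x t) \<le> C * exp (ln 2 / h * t)" if x: "trajectory \<A> x" for x
  proof -
    obtain A where ac: "\<And>T. T \<ge> 0 \<Longrightarrow> abs_cont_on 0 T x" and A: "\<And>t. t \<ge> 0 \<Longrightarrow> A t \<in> \<A>"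
      and ae: "AE t in lebesgue. t \<ge> 0 \<longrightarrow> (x has_vector_derivative (A t *v x t)) (at t)"
      using x unfolding trajectory_def by blast
    obtain N where N: "\<And>t. t \<in> space lebesgue - N \<Longrightarrow> t \<ge> 0 \<longrightarrow> (x has_vector_derivative (A t *v x t)) (at t)"
      "N \<in> null_sets lebesgue" using AE_E3[OF ae] by blast
    have step: "norm (x t) \<le> 2 * norm (x a)" if a: "a \<ge> 0" "t \<in> {a..a + h}" for a t
    proof -
      have ac': "abs_cont_on a s x" if "s \<in> {a..a + h}" for s
        by (rule abs_cont_on_subset[of 0 s x]) (use ac[of s] a that in auto)
      have "continuous_on {a..a + h} (\<lambda>s. norm (x s))"
        using ac'[of "a + h"] h(1) by (intro continuous_on_norm abs_cont_on_imp_continuous_on) auto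
      then obtain s where s: "s \<in> {a..a + h}" "\<And>u. u \<in> {a..a + h} \<Longrightarrow> norm (x u) \<le> norm (x s)"
        using continuous_attains_sup[of "{a..a + h}" "\<lambda>s. norm (x s)"] h(1) by auto
      have "norm (x s - x a) \<le> K * norm (x s) * (s - a)"
      proof (rule abs_cont_increment_le[OF ac'[OF s(1)] _ N(2)])
        fix u assume u: "u \<in> {a..s} - N"
        then show "(x has_vector_derivative (A u *v x u)) (at u)" using N(1)[of u] a(1) by auto
        have "norm (A u *v x u) \<le> K * norm (x u)" using u a(1) by (intro K A) auto
        also have "\<dots> \<le> K * norm (x s)" using u s \<open>K \<ge> 0\<close> by (intro mult_left_mono) auto
        finally show "norm (A u *v x u) \<le> K * norm (x s)" .
      qed (use s \<open>K \<ge> 0\<close> in auto)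
      also have "\<dots> \<le> K * norm (x s) * h" using s(1) \<open>K \<ge> 0\<close> by (intro mult_left_mono) auto
      also have "\<dots> = (K * h) * norm (x s)" by simp
      also have "\<dots> \<le> 1 / 2 * norm (x s)" using h(2) by (intro mult_right_mono) auto
      finally have "norm (x s) \<le> 2 * norm (x a)" using norm_triangle_sub[of "x s" "x a"] by simp
      with s(2)[OF a(2)] show ?thesis by simp
    qed
    have pow: "norm (x t) \<le> 2 ^ n * norm (x 0)" if "t \<ge> 0" "t \<le> real n * h" for n t
      using that
    proof (induction n arbitrary: t)
      case (Suc n)
      show ?case
      proof (cases "t \<le> real n * h")
        case True
        have "2 ^ n * norm (x 0) \<le> 2 ^ Suc n * norm (x 0)" by (intro mult_right_mono) auto
        with Suc.IH[OF Suc.prems(1) True] show ?thesis by (rule order_trans)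
      next
        case False
        have "norm (x t) \<le> 2 * norm (x (real n * h))"
          using False Suc.prems h(1) by (intro step) (auto simp: algebra_simps)
        also have "\<dots> \<le> 2 * (2 ^ n * norm (x 0))" using h(1) by (intro mult_left_mono Suc.IH) auto
        finally show ?thesis by simp
      qed
    qed simp
    have "norm (x t) \<le> (2 * norm (x 0)) * exp (ln 2 / h * t)" if t: "t \<ge> 0" for t
    proof -
      define n where "n = nat \<lceil>t / h\<rceil>"
      have "t / h \<ge> 0" using t h(1) by simp
      then have n: "t / h \<le> real n" "real n \<le> t / h + 1" unfolding n_def by linarith+
      have "norm (x t) \<le> 2 ^ n * norm (x 0)" using n(1) t h(1) by (intro pow) (auto simp: field_simps)
      also have "(2::real) ^ n = exp (real n * ln 2)" by (simp add: exp_of_nat_mult)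
      also have "\<dots> \<le> exp ((t / h + 1) * ln 2)" using n(2) by simp
      also have "\<dots> = 2 * exp (ln 2 / h * t)" by (simp add: distrib_right exp_add)
      finally show ?thesis by (simp add: mult_right_mono algebra_simps)
    qed
    then show ?thesis by blast
  qed
  then show ?thesis by blast
qed

section \<open>Annihilating polynomials with real roots\<close>

text \<open>The vector q(M) v by Horner's scheme; acting on vectors avoids powers of matrices, whose
  type multiplies componentwise.\<close>

definition mat_poly :: "complex^'n^'n \<Rightarrow> complex poly \<Rightarrow> complex^'n \<Rightarrow> complex^'n" where
  "mat_poly M q v = foldr (\<lambda>c w. c *s v + M *v w) (coeffs q) 0"

lemma mat_poly_0 [simp]: "mat_poly M 0 v = 0"
  by (simp add: mat_poly_def)

lemma mat_poly_pCons [simp]: "mat_poly M (pCons c q) v = c *s v + M *v mat_poly M q v"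
  by (simp add: mat_poly_def coeffs_pCons_eq_cCons cCons_def)

lemma mat_poly_add: "mat_poly M (p + q) v = mat_poly M p v + mat_poly M q v"
  by (induction p q rule: poly_induct2)
    (simp_all add: vector_sadd_rdistrib matrix_vector_right_distrib)

lemma mat_poly_sum: "mat_poly M (\<Sum>i\<in>I. q i) v = (\<Sum>i\<in>I. mat_poly M (q i) v)"
  by (induction I rule: infinite_finite_induct) (simp_all add: mat_poly_add)

lemma mat_poly_smult: "mat_poly M (smult c q) v = c *s mat_poly M q v"
  by (induction q)
    (simp_all add: vector_add_ldistrib vector_smult_assoc vector_scalar_commute)

lemma mat_poly_diff_vector: "mat_poly M q (v - w) = mat_poly M q v - mat_poly M q w"
  by (induction q)
    (simp_all add: vector_ssub_ldistrib matrix_vector_mult_diff_distrib add_diff_add)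

lemma mat_poly_smult_vector: "mat_poly M q (c *s v) = c *s mat_poly M q v"
  by (induction q)
    (simp_all add: vector_add_ldistrib vector_smult_assoc vector_scalar_commute mult.commute)

lemma mat_poly_mult_vector: "mat_poly M q (M *v v) = M *v mat_poly M q v"
  by (induction q)
    (simp_all add: vector_scalar_commute matrix_vector_right_distrib)

lemma mat_poly_linear_factor:
  "mat_poly M ([:- a, 1:] * q) v = M *v mat_poly M q v - a *s mat_poly M q v"
proof -
  have "[:- a, 1:] * q = smult (- a) q + pCons 0 q" by simp
  then show ?thesis by (simp only: mat_poly_add mat_poly_smult mat_poly_pCons) (simp add: vec_eq_iff)
qed

lemma mat_poly_monom: "mat_poly M (monom c k) v = c *s ((*v) M ^^ k) v"
  by (induction k) (simp_all add: monom_Suc monom_0 vector_scalar_commute)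

definition cvec :: "real^'n \<Rightarrow> complex^'n" where
  "cvec x = (\<chi> i. complex_of_real (x $ i))"

lemma cmat_mult_cvec: "cmat A *v cvec x = cvec (A *v x)"
  by (simp add: cmat_def cvec_def matrix_vector_mult_def vec_eq_iff)

lemma cmat_power_cvec: "((*v) (cmat A) ^^ k) (cvec x) = cvec (((*v) A ^^ k) x)"
  by (induction k) (simp_all add: cmat_mult_cvec)

text \<open>The n + 1 vectors x, A x, ..., A^n x are linearly dependent in dimension n; this yields
  the degree bound for each single vector x.\<close>

lemma exists_annihilating_poly:
  fixes A :: "real^'n^'n"
  shows "\<exists>q. q \<noteq> 0 \<and> degree q \<le> CARD('n) \<and> mat_poly (cmat A) q (cvec x) = 0"
proof -
  let ?n = "CARD('n)"
  define w where "w = (\<lambda>k. ((*v) A ^^ k) x)"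
  have "\<exists>c. (\<exists>i\<le>?n. c i \<noteq> 0) \<and> (\<Sum>i\<le>?n. c i *\<^sub>R w i) = 0"
  proof (cases "inj_on w {..?n}")
    case True
    then have "card (w ` {..?n}) > DIM(real^'n)" by (simp add: card_image)
    then have "dependent (w ` {..?n})" by (intro dependent_biggerset)
    then obtain u where u: "\<exists>v\<in>w ` {..?n}. u v \<noteq> 0" "(\<Sum>v\<in>w ` {..?n}. u v *\<^sub>R v) = 0"
      by (auto simp: dependent_finite)
    then have "(\<Sum>i\<le>?n. u (w i) *\<^sub>R w i) = 0" by (simp add: sum.reindex[OF True])
    with u(1) show ?thesis by (intro exI[of _ "\<lambda>i. u (w i)"]) auto
  next
    case False
    then obtain i j where ij: "i \<le> ?n" "j \<le> ?n" "i \<noteq> j" "w i = w j" by (auto simp: inj_on_def)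
    \<comment> \<open>\<open>dependent\<close> speaks of sets and does not see a repeated vector, so
      w i = w j is turned into the relation w i - w j = 0 by hand.\<close>
    let ?c = "\<lambda>k. (if k = i then 1 else 0) - (if k = j then 1 else (0::real))"
    have "(\<Sum>k\<le>?n. ?c k *\<^sub>R w k) =
        (\<Sum>k\<le>?n. (if k = i then w k else 0)) - (\<Sum>k\<le>?n. (if k = j then w k else 0))"
      by (simp add: scaleR_diff_left if_distrib[where f = "\<lambda>c. c *\<^sub>R _"] sum_subtractf cong: if_cong)
    also have "\<dots> = 0" using ij by simp
    finally have "(\<Sum>k\<le>?n. ?c k *\<^sub>R w k) = 0" .
    then show ?thesis using ij by (intro exI[of _ ?c]) auto
  qed
  then obtain c i where c: "i \<le> ?n" "c i \<noteq> 0" "(\<Sum>i\<le>?n. c i *\<^sub>R w i) = 0" by blast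
  define q where "q = (\<Sum>i\<le>?n. monom (complex_of_real (c i)) i)"
  have "coeff q i = complex_of_real (c i)" using c(1) by (simp add: q_def coeff_sum)
  then have "q \<noteq> 0" using c(2) by auto
  moreover have "degree q \<le> ?n"
    unfolding q_def by (intro degree_sum_le) (auto intro: order_trans[OF degree_monom_le])
  moreover have "mat_poly (cmat A) q (cvec x) = (\<Sum>i\<le>?n. complex_of_real (c i) *s cvec (w i))"
    by (simp add: q_def mat_poly_sum mat_poly_monom cmat_power_cvec w_def)
  moreover have "(\<Sum>i\<le>?n. complex_of_real (c i) *s cvec (w i)) = cvec (\<Sum>i\<le>?n. c i *\<^sub>R w i)"
    by (simp add: cvec_def vec_eq_iff)
  ultimately show ?thesis using c(3) by (intro exI[of _ q]) (simp add: cvec_def vec_eq_iff)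
qed

lemma eigenvalues_eigenvector:
  "c \<in> eigenvalues A \<longleftrightarrow> (\<exists>w. w \<noteq> 0 \<and> cmat A *v w = c *s w)"
proof -
  have mv: "(mat c - cmat A) *v w = c *s w - cmat A *v w" for w
    by (simp add: vec_eq_iff matrix_vector_mult_def mat_def left_diff_distrib sum_subtractf
        if_distrib[where f = "\<lambda>x. x * _"] cong: if_cong)
  have "c \<in> eigenvalues A \<longleftrightarrow> \<not> invertible (mat c - cmat A)"
    by (simp add: eigenvalues_def invertible_det_nz)
  also have "\<dots> \<longleftrightarrow> (\<exists>w. w \<noteq> 0 \<and> (mat c - cmat A) *v w = 0)"
    unfolding invertible_left_inverse matrix_left_invertible_ker by blast
  finally show ?thesis by (simp add: mv) metis
qed

lemma eigenvalue_le_spec_rad: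
  assumes "c \<in> eigenvalues A" shows "cmod c \<le> spec_rad A"
  unfolding spec_rad_def
proof (rule cSup_upper)
  show "bdd_above (cmod ` eigenvalues A)"
  proof (rule bdd_aboveI2)
    fix c assume "c \<in> eigenvalues A"
    then obtain w where w: "w \<noteq> 0" "cmat A *v w = c *s w" by (auto simp: eigenvalues_eigenvector)
    have "norm (c *s w) = cmod c * norm w"
      by (simp add: norm_vec_def norm_mult L2_set_right_distrib)
    moreover have "norm (cmat A *v w) \<le> onorm ((*v) (cmat A)) * norm w" by (simp add: onorm)
    ultimately show "cmod c \<le> onorm ((*v) (cmat A))" using w by simp
  qed
qed (use assms in simp)

text \<open>With A and \<mu> real, the real and imaginary parts of a complex eigenvector satisfy the
  equation separately, and one of them is nonzero.\<close>

lemma real_eigenvector: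
  assumes "complex_of_real \<mu> \<in> eigenvalues A"
  shows "\<exists>e. e \<noteq> 0 \<and> A *v e = \<mu> *\<^sub>R e"
proof -
  obtain w where w: "w \<noteq> 0" "cmat A *v w = complex_of_real \<mu> *s w"
    using assms by (auto simp: eigenvalues_eigenvector)
  have "A *v (\<chi> i. Re (w $ i)) = \<mu> *\<^sub>R (\<chi> i. Re (w $ i))"
    using arg_cong[OF w(2), of "\<lambda>v. Re (v $ i)" for i]
    by (simp add: vec_eq_iff matrix_vector_mult_def cmat_def)
  moreover have "A *v (\<chi> i. Im (w $ i)) = \<mu> *\<^sub>R (\<chi> i. Im (w $ i))"
    using arg_cong[OF w(2), of "\<lambda>v. Im (v $ i)" for i]
    by (simp add: vec_eq_iff matrix_vector_mult_def cmat_def)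
  moreover have "(\<chi> i. Re (w $ i)) \<noteq> 0 \<or> (\<chi> i. Im (w $ i)) \<noteq> (0 :: real^'a)"
    using w(1) by (auto simp: vec_eq_iff complex_eq_iff)
  ultimately show ?thesis by blast
qed

text \<open>The product of the commuting maps A - \<mu>, applied to x. Recursion through the vector
  mirrors the removal of operators in \<open>exp_sol\<close>.\<close>

primrec apply_factors :: "real^'n^'n \<Rightarrow> real list \<Rightarrow> real^'n \<Rightarrow> real^'n" where
  "apply_factors A [] x = x"
| "apply_factors A (\<mu> # \<mu>s) x = apply_factors A \<mu>s (A *v x - \<mu> *\<^sub>R x)"

text \<open>A root \<open>a\<close> of an annihilating polynomial \<open>(X - a) q\<close> of \<open>x\<close> is either superfluous, when \<open>q\<close> already
  annihilates \<open>x\<close>, or an eigenvalue with eigenvector \<open>q(A) x\<close>.\<close>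
lemma annihilating_poly_imp_factors:
  assumes real: "only_real_eigenvalues A"
  shows "q \<noteq> 0 \<Longrightarrow> mat_poly (cmat A) q (cvec x) = 0 \<Longrightarrow>
    \<exists>\<mu>s. length \<mu>s \<le> degree q \<and> apply_factors A \<mu>s x = 0 \<and> (\<forall>\<mu>\<in>set \<mu>s. complex_of_real \<mu> \<in> eigenvalues A)"
proof (induction "degree q" arbitrary: q x rule: less_induct)
  case less
  show ?case
  proof (cases "degree q = 0")
    case True
    then obtain c where c: "q = [:c:]" "c \<noteq> 0" using less.prems(1) by (metis degree_eq_zeroE pCons_eq_0_iff)
    then have "x = 0" using less.prems(2) by (simp add: vec_eq_iff cvec_def)
    then show ?thesis by (intro exI[of _ "[]"]) simp
  next
    case False
    then have "\<not> constant (poly q)" by (simp add: constant_degree)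
    then obtain a where "poly q a = 0" using fundamental_theorem_of_algebra by blast
    then obtain p where p: "q = [:- a, 1:] * p" by (auto simp: poly_eq_0_iff_dvd dvd_def)
    have p0: "p \<noteq> 0" using p less.prems(1) by auto
    then have deg: "degree q = Suc (degree p)" unfolding p by (subst degree_mult_eq) auto
    let ?w = "mat_poly (cmat A) p (cvec x)"
    have w: "cmat A *v ?w = a *s ?w"
      using less.prems(2) unfolding p mat_poly_linear_factor by simp
    show ?thesis
    proof (cases "?w = 0")
      case True
      then obtain \<mu>s where "length \<mu>s \<le> degree p" "apply_factors A \<mu>s x = 0"
        "\<forall>\<mu>\<in>set \<mu>s. complex_of_real \<mu> \<in> eigenvalues A"
        using less.hyps[of p x] p0 deg by auto
      then show ?thesis using deg by (intro exI[of _ \<mu>s]) simp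
    next
      case False
      then have ev: "a \<in> eigenvalues A" using w by (auto simp: eigenvalues_eigenvector)
      then have a: "a = complex_of_real (Re a)"
        using real by (auto simp: only_real_eigenvalues_def elim!: Reals_cases)
      have "cvec (A *v x - Re a *\<^sub>R x) = cmat A *v cvec x - a *s cvec x"
        unfolding cmat_mult_cvec by (subst (2) a) (simp add: cvec_def vec_eq_iff)
      then have "mat_poly (cmat A) p (cvec (A *v x - Re a *\<^sub>R x)) = 0"
        using w by (simp add: mat_poly_diff_vector mat_poly_mult_vector mat_poly_smult_vector)
      then obtain \<mu>s where "length \<mu>s \<le> degree p" "apply_factors A \<mu>s (A *v x - Re a *\<^sub>R x) = 0"
        "\<forall>\<mu>\<in>set \<mu>s. complex_of_real \<mu> \<in> eigenvalues A"
        using less.hyps[of p] p0 deg by auto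
      then show ?thesis using deg ev a by (intro exI[of _ "Re a # \<mu>s"]) auto
    qed
  qed
qed

lemma exists_real_factors:
  fixes A :: "real^'n^'n"
  assumes "only_real_eigenvalues A"
  shows "\<exists>\<mu>s. length \<mu>s \<le> CARD('n) \<and> apply_factors A \<mu>s x = 0 \<and>
    (\<forall>\<mu>\<in>set \<mu>s. \<bar>\<mu>\<bar> \<le> spec_rad A \<and> (\<exists>e. e \<noteq> 0 \<and> A *v e = \<mu> *\<^sub>R e))"
proof -
  obtain q where q: "q \<noteq> 0" "degree q \<le> CARD('n)" "mat_poly (cmat A) q (cvec x) = 0"
    using exists_annihilating_poly by blast
  obtain \<mu>s where \<mu>s: "length \<mu>s \<le> degree q" "apply_factors A \<mu>s x = 0"
    "\<forall>\<mu>\<in>set \<mu>s. complex_of_real \<mu> \<in> eigenvalues A"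
    using annihilating_poly_imp_factors[OF assms q(1,3)] by blast
  moreover have "\<bar>\<mu>\<bar> \<le> spec_rad A" if "\<mu> \<in> set \<mu>s" for \<mu>
    using eigenvalue_le_spec_rad[of "complex_of_real \<mu>" A] \<mu>s(3) that by simp
  moreover have "\<exists>e. e \<noteq> 0 \<and> A *v e = \<mu> *\<^sub>R e" if "\<mu> \<in> set \<mu>s" for \<mu>
    using real_eigenvector \<mu>s(3) that by blast
  ultimately show ?thesis using q(2) by (meson order_trans)
qed

text \<open>A commutes with exp (t A), so A - \<mu> on the initial vector acts as D - \<mu> on the
  function; hence the sign change in \<open>map uminus\<close>.\<close>

lemma mexp_exp_sol:
  fixes y :: "real^'n \<Rightarrow> real"
  assumes y: "bounded_linear y"
  shows "apply_factors A \<mu>s x = 0 \<Longrightarrow> exp_sol (map uminus \<mu>s) (\<lambda>t. y (mexp A t x))"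
proof (induction \<mu>s arbitrary: x)
  case Nil
  then show ?case by (simp add: linear_0[OF linear_mexp] linear_0[OF bounded_linear.linear[OF y]])
next
  case (Cons \<mu> \<mu>s)
  then have IH: "exp_sol (map uminus \<mu>s) (\<lambda>t. y (mexp A t (A *v x - \<mu> *\<^sub>R x)))" by simp
  have "((\<lambda>t. y (mexp A t x)) has_vector_derivative y (A *v mexp A t x)) (at t)" for t
    by (rule bounded_linear.has_vector_derivative[OF y mexp_has_vector_derivative])
  moreover have "y (A *v mexp A t x) = y (mexp A t (A *v x - \<mu> *\<^sub>R x)) - (- \<mu>) * y (mexp A t x)" for t
    using linear_mexp[of A t] bounded_linear.linear[OF y]
    by (simp add: linear_diff linear_scale mexp_commute)
  ultimately show ?case unfolding list.map
    by (intro exp_sol_ConsI[OF IH]) (simp add: has_real_derivative_iff_has_vector_derivative)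
qed

lemma matrix_power_eigenvector:
  fixes A :: "real^'n^'n"
  assumes "A *v e = \<mu> *\<^sub>R e"
  shows "((*v) A ^^ k) e = \<mu> ^ k *\<^sub>R e"
  by (induction k) (simp_all add: assms matrix_vector_mult_scaleR mult.commute)

lemma mexp_eigenvector:
  assumes "A *v e = \<mu> *\<^sub>R e"
  shows "mexp A t e = exp (\<mu> * t) *\<^sub>R e"
proof -
  have "(\<Sum>k. (((*v) A ^^ k) e $ i / fact k) * t ^ k) = exp (\<mu> * t) * e $ i" for i
  proof -
    have "(\<lambda>k. (((*v) A ^^ k) e $ i / fact k) * t ^ k) = (\<lambda>k. (inverse (fact k) * (\<mu> * t) ^ k) * e $ i)"
      by (simp add: matrix_power_eigenvector[OF assms] fun_eq_iff power_mult_distrib field_simps)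
    then show ?thesis
      using suminf_mult2[OF summable_exp[of "\<mu> * t"], of "e $ i"] by (simp add: exp_def divide_inverse mult.commute)
  qed
  then show ?thesis by (simp add: mexp_def vec_eq_iff del: times_divide_eq_left)
qed

section \<open>Contraction of the Euler step\<close>

text \<open>The exponential weight \<open>exp (\<epsilon> t)\<close> shifts all exponents by \<open>\<epsilon>\<close>, which improves the constant
  \<open>r\<^sup>2\<close> to \<open>(r - \<epsilon>)\<^sup>2\<close>; the Euler step for \<open>p\<close> of length \<open>\<tau>\<close> is, up to the factor \<open>1 - \<epsilon> \<tau>\<close>, the Euler
  step for the weighted function of length \<open>\<tau> / (1 - \<epsilon> \<tau>)\<close>.\<close>
lemma exp_sol_euler_step_weighted:
  fixes p :: "real \<Rightarrow> real"
  assumes p: "exp_sol (map uminus \<mu>s) p" "length \<mu>s \<le> CARD('n::finite)"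
    and \<mu>: "\<forall>\<mu>\<in>set \<mu>s. - r \<le> \<mu> \<and> \<mu> < - \<epsilon>" and r: "\<epsilon> < r"
    and bd: "\<And>t. t \<ge> 0 \<Longrightarrow> \<bar>p t\<bar> \<le> B * exp (- \<epsilon> * t)" and B: "B > 0"
    and \<tau>: "0 < \<tau>" "\<epsilon> * \<tau> < 1"
  shows "\<bar>p 0 + \<tau> * deriv p 0\<bar> \<le>
    ((1 - \<epsilon> * \<tau>) + \<tau> ^ 2 * M2 CARD('n) * (r - \<epsilon>) ^ 2 / (2 * (1 - \<epsilon> * \<tau>))) * B"
proof -
  define g where "g = (\<lambda>t. exp (\<epsilon> * t) * p t)"
  have g: "exp_sol (map (\<lambda>a. a - \<epsilon>) (map uminus \<mu>s)) g"
    unfolding g_def by (rule exp_sol_exp_mult[OF p(1)])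
  have gB: "\<bar>g t\<bar> \<le> B" if "t \<ge> 0" for t
  proof -
    have "\<bar>g t\<bar> \<le> exp (\<epsilon> * t) * (B * exp (- \<epsilon> * t))"
      unfolding g_def abs_mult using bd[OF that] by (intro mult_mono) auto
    then show ?thesis by (simp add: exp_minus field_simps)
  qed
  have g2: "\<bar>deriv (deriv g) t\<bar> \<le> M2 CARD('n) * (r - \<epsilon>) ^ 2 * B" if "t \<ge> 0" for t
    by (rule exp_sol_second_deriv_le_M2[OF g]) (use p(2) \<mu> r gB B that in auto)
  define s where "s = \<tau> / (1 - \<epsilon> * \<tau>)"
  have s: "s > 0" using \<tau> by (simp add: s_def)
  \<comment> \<open>Taylor's formula is used backwards: g(0) + s g'(0) is g(s) minus the remainder,
    and both are bounded.\<close>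
  have "\<exists>t>0. t < s \<and> g s = (\<Sum>m<2. (deriv ^^ m) g 0 / fact m * s ^ m) + (deriv ^^ 2) g t / fact 2 * s ^ 2"
  proof (rule Maclaurin[OF s], safe)
    fix m :: nat and t assume "m < 2"
    then have "m = 0 \<or> m = 1" by auto
    then show "((deriv ^^ m) g has_real_derivative (deriv ^^ Suc m) g t) (at t)"
      using exp_sol_DERIV[OF g] exp_sol_DERIV[OF exp_sol_deriv[OF g]] by auto
  qed auto
  then obtain t where t: "t > 0" "g s = g 0 + s * deriv g 0 + deriv (deriv g) t / 2 * s ^ 2"
    by (auto simp: numeral_2_eq_2 mult_ac)
  have "\<bar>deriv (deriv g) t / 2 * s ^ 2\<bar> \<le> M2 CARD('n) * (r - \<epsilon>) ^ 2 * B / 2 * s ^ 2"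
    unfolding abs_mult using g2[of t] t(1) by (intro mult_mono) auto
  moreover have "\<bar>g s\<bar> \<le> B" using gB s by simp
  ultimately have *: "\<bar>g 0 + s * deriv g 0\<bar> \<le> B + M2 CARD('n) * (r - \<epsilon>) ^ 2 * B / 2 * s ^ 2"
    using t(2) by linarith
  have dg: "deriv g 0 = \<epsilon> * p 0 + deriv p 0"
    unfolding g_def
    by (rule DERIV_imp_deriv) (rule derivative_eq_intros exp_sol_DERIV[OF p(1)] refl | simp)+
  have pos: "1 - \<epsilon> * \<tau> > 0" using \<tau> by simp
  have alg: "q * (B + W * B / 2 * (\<tau> / q) ^ 2) = (q + \<tau> ^ 2 * W / (2 * q)) * B" if "q \<noteq> 0" for q W
    using that by (simp add: field_simps power2_eq_square)
  have "p 0 + \<tau> * deriv p 0 = (1 - \<epsilon> * \<tau>) * (g 0 + s * deriv g 0)"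
    using pos unfolding dg by (simp add: s_def g_def field_simps)
  then have "\<bar>p 0 + \<tau> * deriv p 0\<bar> = (1 - \<epsilon> * \<tau>) * \<bar>g 0 + s * deriv g 0\<bar>" using pos by (simp add: abs_mult)
  also have "\<dots> \<le> (1 - \<epsilon> * \<tau>) * (B + M2 CARD('n) * (r - \<epsilon>) ^ 2 * B / 2 * s ^ 2)"
    using * pos by (intro mult_left_mono) auto
  also have "\<dots> = ((1 - \<epsilon> * \<tau>) + \<tau> ^ 2 * M2 CARD('n) * (r - \<epsilon>) ^ 2 / (2 * (1 - \<epsilon> * \<tau>))) * B"
    using alg[of "1 - \<epsilon> * \<tau>" "M2 CARD('n) * (r - \<epsilon>) ^ 2"] pos by (simp only: s_def mult.assoc)
  finally show ?thesis .
qed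

text \<open>The second claim amounts to \<tau> (M (r - \<epsilon>)^2 + 2 \<epsilon>^2) < 2
  \<epsilon>. For M \<ge> 2 and \<epsilon> < r the bracket is at most M r^2, since \<epsilon> (M +
  2) \<le> 2 M r, and the bound on \<tau> applies.\<close>

lemma euler_step_factor_less_1:
  fixes M r \<epsilon> \<tau> :: real
  assumes "M \<ge> 2" "0 < \<epsilon>" "\<epsilon> < r" "0 < \<tau>" "\<tau> < 2 * \<epsilon> / (M * r ^ 2)"
  shows "\<epsilon> * \<tau> < 1" "(1 - \<epsilon> * \<tau>) + \<tau> ^ 2 * M * (r - \<epsilon>) ^ 2 / (2 * (1 - \<epsilon> * \<tau>)) < 1"
proof -
  have r: "r > 0" using assms by simp
  have t: "\<tau> * (M * r ^ 2) < 2 * \<epsilon>" using assms r by (simp add: pos_less_divide_eq)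
  have "\<epsilon> ^ 2 < r ^ 2" using assms by (intro power_strict_mono) auto
  then have e: "2 * \<epsilon> ^ 2 \<le> M * r ^ 2" using assms by (intro mult_mono) auto
  have "\<epsilon> * \<tau> * (M * r ^ 2) = \<epsilon> * (\<tau> * (M * r ^ 2))" by simp
  also have "\<dots> < \<epsilon> * (2 * \<epsilon>)" using t assms by (intro mult_strict_left_mono) auto
  also have "\<dots> \<le> M * r ^ 2" using e by (simp add: power2_eq_square)
  finally show et: "\<epsilon> * \<tau> < 1" using assms r by (simp add: mult_less_cancel_right1)
  then have pos: "1 - \<epsilon> * \<tau> > 0" by simp
  have "\<epsilon> * (M + 2) \<le> r * (2 * M)" using assms by (intro mult_mono) auto
  then have "\<epsilon> * (\<epsilon> * (M + 2)) \<le> \<epsilon> * (r * (2 * M))" using assms by (intro mult_left_mono) auto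
  then have "M * (r - \<epsilon>) ^ 2 + 2 * \<epsilon> ^ 2 \<le> M * r ^ 2" by (simp add: power2_eq_square algebra_simps)
  then have "\<tau> * (M * (r - \<epsilon>) ^ 2 + 2 * \<epsilon> ^ 2) \<le> \<tau> * (M * r ^ 2)" using assms by (intro mult_left_mono) auto
  with t have "\<tau> * M * (r - \<epsilon>) ^ 2 < 2 * \<epsilon> * (1 - \<epsilon> * \<tau>)"
    by (simp add: power2_eq_square algebra_simps)
  then have "\<tau> * (\<tau> * M * (r - \<epsilon>) ^ 2) < \<tau> * (2 * \<epsilon> * (1 - \<epsilon> * \<tau>))"
    using assms by (intro mult_strict_left_mono) auto
  then have "\<tau> ^ 2 * M * (r - \<epsilon>) ^ 2 < (\<epsilon> * \<tau>) * (2 * (1 - \<epsilon> * \<tau>))"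
    by (simp add: power2_eq_square mult_ac)
  then have "\<tau> ^ 2 * M * (r - \<epsilon>) ^ 2 / (2 * (1 - \<epsilon> * \<tau>)) < \<epsilon> * \<tau>"
    using pos by (subst pos_divide_less_eq) auto
  then show "(1 - \<epsilon> * \<tau>) + \<tau> ^ 2 * M * (r - \<epsilon>) ^ 2 / (2 * (1 - \<epsilon> * \<tau>)) < 1" by simp
qed

text \<open>In order 1 the Euler step multiplies by 1 + \<tau> \<mu>, whose modulus is controlled by
  the two ends of the range of \<mu>.\<close>

lemma exp_sol_euler_step_1:
  fixes p :: "real \<Rightarrow> real"
  assumes p: "exp_sol (map uminus \<mu>s) p" "length \<mu>s \<le> 1"
    and \<mu>: "\<forall>\<mu>\<in>set \<mu>s. - r \<le> \<mu> \<and> \<mu> < - \<epsilon>" and bd: "\<bar>p 0\<bar> \<le> B" and \<tau>: "0 < \<tau>"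
  shows "\<bar>p 0 + \<tau> * deriv p 0\<bar> \<le> max 0 (max (1 - \<tau> * \<epsilon>) (\<tau> * r - 1)) * B"
proof (cases \<mu>s)
  case Nil
  then have p0: "p = (\<lambda>_. 0)" using p(1) by simp
  then have "deriv p 0 = 0" by simp
  then show ?thesis using bd by (simp add: p0)
next
  case (Cons \<mu> \<mu>s')
  then have "\<mu>s = [\<mu>]" using p(2) by simp
  then have "deriv p 0 = \<mu> * p 0" using exp_sol_ConsD[of "- \<mu>" "[]" p] p(1)
    by (auto dest: fun_cong[of _ _ 0] simp del: exp_sol.simps(2))
  then have "\<bar>p 0 + \<tau> * deriv p 0\<bar> = \<bar>1 + \<tau> * \<mu>\<bar> * \<bar>p 0\<bar>"
    by (simp add: algebra_simps flip: abs_mult)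
  also have "\<dots> \<le> max 0 (max (1 - \<tau> * \<epsilon>) (\<tau> * r - 1)) * B"
  proof (intro mult_mono bd)
    have "\<tau> * \<mu> \<le> \<tau> * (- \<epsilon>)" "\<tau> * (- r) \<le> \<tau> * \<mu>"
      using \<mu> Cons \<tau> by (intro mult_left_mono; simp)+
    then show "\<bar>1 + \<tau> * \<mu>\<bar> \<le> max 0 (max (1 - \<tau> * \<epsilon>) (\<tau> * r - 1))" by (auto simp: abs_le_iff)
  qed auto
  finally show ?thesis .
qed

text \<open>The weighted estimate serves dimension at least 2, the direct one dimension 1. \<gamma>
  is chosen before p, so the contraction is uniform over matrices, functionals and starting
  vectors.\<close>

lemma exp_sol_euler_step_contraction:
  fixes r \<epsilon> \<tau> :: real
  assumes r: "0 < \<epsilon>" "\<epsilon> < r" and \<tau>: "0 < \<tau>" "\<tau> < 2 * \<epsilon> / (M2 CARD('n::finite) * r ^ 2)"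
  shows "\<exists>\<gamma>. 0 \<le> \<gamma> \<and> \<gamma> < 1 \<and> (\<forall>p \<mu>s B. exp_sol (map uminus \<mu>s) p \<longrightarrow> length \<mu>s \<le> CARD('n) \<longrightarrow>
    (\<forall>\<mu>\<in>set \<mu>s. - r \<le> \<mu> \<and> \<mu> < - \<epsilon>) \<longrightarrow> B > 0 \<longrightarrow> (\<forall>t\<ge>0. \<bar>p t\<bar> \<le> B * exp (- \<epsilon> * t)) \<longrightarrow>
    \<bar>p 0 + \<tau> * deriv p 0\<bar> \<le> \<gamma> * B)"
proof (cases "CARD('n) \<ge> 2")
  case True
  have M: "M2 CARD('n) \<ge> 2" using M2_ge_3[OF True] by simp
  define \<gamma> where "\<gamma> = (1 - \<epsilon> * \<tau>) + \<tau> ^ 2 * M2 CARD('n) * (r - \<epsilon>) ^ 2 / (2 * (1 - \<epsilon> * \<tau>))"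
  have et: "\<epsilon> * \<tau> < 1" and \<gamma>1: "\<gamma> < 1"
    unfolding \<gamma>_def using euler_step_factor_less_1[OF M r \<tau>] by auto
  have "\<gamma> \<ge> 0" using et M by (auto simp: \<gamma>_def intro!: add_nonneg_nonneg divide_nonneg_nonneg)
  with \<gamma>1 show ?thesis
    using exp_sol_euler_step_weighted[where 'n = 'n and r = r and \<epsilon> = \<epsilon> and \<tau> = \<tau>] r(2) \<tau>(1) et
    unfolding \<gamma>_def[symmetric] by (intro exI[of _ \<gamma>]) blast
next
  case False
  then have n: "CARD('n) = 1" using zero_less_card_finite[where 'a = 'n] by linarith
  define \<gamma> where "\<gamma> = max 0 (max (1 - \<tau> * \<epsilon>) (\<tau> * r - 1))"
  have "\<tau> * r ^ 2 \<le> \<tau> * (M2 CARD('n) * r ^ 2)"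
    using M2_ge_1[where 'n = 'n] \<tau>(1) by (intro mult_left_mono) (auto simp: mult_le_cancel_right1)
  also have "\<dots> < 2 * \<epsilon>" using \<tau> r M2_ge_1[where 'n = 'n] by (simp add: pos_less_divide_eq)
  also have "\<dots> < 2 * r" using r by simp
  finally have "\<tau> * r < 2" using r by (simp add: power2_eq_square)
  then have "\<gamma> < 1" "\<gamma> \<ge> 0" using \<tau>(1) r by (auto simp: \<gamma>_def)
  moreover have "\<bar>p 0 + \<tau> * deriv p 0\<bar> \<le> \<gamma> * B"
    if "exp_sol (map uminus \<mu>s) p" "length \<mu>s \<le> CARD('n)" "\<forall>\<mu>\<in>set \<mu>s. - r \<le> \<mu> \<and> \<mu> < - \<epsilon>"
      "\<forall>t\<ge>0. \<bar>p t\<bar> \<le> B * exp (- \<epsilon> * t)" for p \<mu>s B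
    unfolding \<gamma>_def using that(2) that(4)[rule_format, of 0] \<tau>(1)
    by (intro exp_sol_euler_step_1[OF that(1) _ that(3)]) (auto simp: n)
  ultimately show ?thesis by blast
qed

text \<open>Fekete's lemma in multiplicative form, with the infimum of the roots as limit. Division
  of n by a good m splits a(n) into a power of a(m) and one of finitely many remainders; working
  without logarithms admits a(k) = 0.\<close>

lemma submultiplicative_root_convergent:
  fixes a :: "nat \<Rightarrow> real"
  assumes nonneg: "\<And>k. a k \<ge> 0" and sub: "\<And>m n. a (m + n) \<le> a m * a n"
  shows "convergent (\<lambda>k. root k (a k))"
proof -
  define L where "L = Inf ((\<lambda>k. root k (a k)) ` {1..})"
  have bdd: "bdd_below ((\<lambda>k. root k (a k)) ` {1..})" using nonneg by (intro bdd_belowI2[of _ 0]) simp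
  have L: "L \<le> root k (a k)" if "k \<ge> 1" for k unfolding L_def using that bdd by (intro cInf_lower) auto
  have L0: "L \<ge> 0" unfolding L_def using nonneg by (intro cInf_greatest) auto
  have pow: "a (q * m + k) \<le> a m ^ q * a k" for q m k
  proof (induction q)
    case (Suc q)
    have "a (Suc q * m + k) \<le> a m * a (q * m + k)" using sub[of m "q * m + k"] by (simp add: add_ac)
    also have "\<dots> \<le> a m * (a m ^ q * a k)" by (intro mult_left_mono Suc nonneg)
    finally show ?case by (simp add: mult_ac)
  qed simp
  have "(\<lambda>k. root k (a k)) \<longlonglongrightarrow> L"
  proof (rule order_tendstoI)
    fix l assume "l < L"
    then show "\<forall>\<^sub>F k in sequentially. l < root k (a k)"
      using L by (intro eventually_sequentiallyI[of 1]) (metis less_le_trans)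
  next
    fix c assume "L < c"
    then obtain c1 where c1: "L < c1" "c1 < c" using dense by blast
    then have c1_pos: "c1 > 0" using L0 by simp
    obtain m where m: "m \<ge> 1" "root m (a m) < c1"
      using cInf_lessD[of "(\<lambda>k. root k (a k)) ` {1..}" c1] c1(1) by (auto simp: L_def)
    have am: "a m \<le> c1 ^ m"
    proof -
      have "a m = root m (a m) ^ m" using m(1) nonneg by simp
      also have "\<dots> \<le> c1 ^ m" using m nonneg by (intro power_mono) auto
      finally show ?thesis .
    qed
    \<comment> \<open>Bounds all remainders at once; the summand 1 makes it positive, so its n-th
      roots tend to 1.\<close>
    define D where "D = (\<Sum>k<m. a k / c1 ^ k) + 1"
    have D: "D > 0" unfolding D_def using nonneg c1_pos by (intro add_nonneg_pos sum_nonneg) auto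
    have bound: "a n \<le> c1 ^ n * D" for n
    proof -
      have "a n \<le> a m ^ (n div m) * a (n mod m)" using pow[of "n div m" m "n mod m"] by simp
      also have "\<dots> \<le> (c1 ^ m) ^ (n div m) * a (n mod m)"
        by (intro mult_right_mono power_mono am nonneg)
      also have "\<dots> = c1 ^ n * (a (n mod m) / c1 ^ (n mod m))"
      proof -
        have "c1 ^ n = c1 ^ (m * (n div m) + n mod m)" by simp
        also have "\<dots> = (c1 ^ m) ^ (n div m) * c1 ^ (n mod m)" by (simp only: power_add power_mult)
        finally show ?thesis using c1_pos by simp
      qed
      also have "a (n mod m) / c1 ^ (n mod m) \<le> (\<Sum>k<m. a k / c1 ^ k)"
        using m(1) nonneg c1_pos by (intro member_le_sum) auto
      also have "\<dots> \<le> D" by (simp add: D_def)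
      finally show ?thesis using c1_pos by simp
    qed
    have "(\<lambda>n. c1 * root n D) \<longlonglongrightarrow> c1 * 1" by (intro tendsto_mult tendsto_const LIMSEQ_root_const D)
    then have "\<forall>\<^sub>F n in sequentially. c1 * root n D < c" using c1(2) by (intro order_tendstoD(2)) auto
    then show "\<forall>\<^sub>F n in sequentially. root n (a n) < c"
      using eventually_ge_at_top[of 1]
    proof eventually_elim
      case (elim n)
      have "root n (a n) \<le> root n (c1 ^ n * D)" using elim(2) bound by (intro real_root_le_mono) auto
      also have "\<dots> = c1 * root n D" using elim(2) c1_pos by (simp add: real_root_mult real_root_power_cancel)
      finally show ?case using elim(1) by simp
    qed
  qed
  then show ?thesis by (auto simp: convergent_def)
qed

lemma norm_matrix_matrix_mult_le:
  fixes A B :: "real^'n^'n"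
  shows "norm (A ** B) \<le> norm A * norm B"
proof (rule power2_le_imp_le)
  have sq: "norm C ^ 2 = (\<Sum>i\<in>UNIV. \<Sum>j\<in>UNIV. (C $ i $ j) ^ 2)" for C :: "real^'n^'n"
    by (simp add: norm_vec_def L2_set_def sum_nonneg)
  have "(A ** B) $ i $ j ^ 2 \<le> (\<Sum>k\<in>UNIV. (A $ i $ k) ^ 2) * (\<Sum>k\<in>UNIV. (B $ k $ j) ^ 2)" for i j
    unfolding matrix_matrix_mult_def by (simp add: Cauchy_Schwarz_ineq_sum)
  then have "norm (A ** B) ^ 2 \<le> (\<Sum>i\<in>UNIV. \<Sum>j\<in>UNIV. (\<Sum>k\<in>UNIV. (A $ i $ k) ^ 2) * (\<Sum>k\<in>UNIV. (B $ k $ j) ^ 2))"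
    unfolding sq by (intro sum_mono) auto
  also have "\<dots> = (\<Sum>i\<in>UNIV. \<Sum>k\<in>UNIV. (A $ i $ k) ^ 2) * (\<Sum>j\<in>UNIV. \<Sum>k\<in>UNIV. (B $ k $ j) ^ 2)"
    by (simp add: sum_product)
  also have "(\<Sum>j\<in>UNIV. \<Sum>k\<in>UNIV. (B $ k $ j) ^ 2) = (\<Sum>k\<in>UNIV. \<Sum>j\<in>UNIV. (B $ k $ j) ^ 2)"
    by (rule sum.swap)
  finally show "norm (A ** B) ^ 2 \<le> (norm A * norm B) ^ 2" by (simp add: power_mult_distrib sq)
qed simp

lemma foldr_matrix_mult_append:
  "foldr (**) (xs @ ys) (mat 1 :: real^'n^'n) = foldr (**) xs (mat 1) ** foldr (**) ys (mat 1)"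
  by (induction xs) (simp_all add: matrix_mul_assoc)

text \<open>Since \<open>jsr\<close> is a \<open>lim\<close>, convergence has to be secured first;
  it comes from submultiplicativity of the norm, the suprema being finite by
  \<open>bd\<close>.\<close>

lemma jsr_le:
  fixes \<M> :: "(real^'n^'n) set"
  assumes ne: "\<M> \<noteq> {}" and \<gamma>: "\<gamma> \<ge> 0"
    and bd: "\<And>Ms. set Ms \<subseteq> \<M> \<Longrightarrow> norm (foldr (**) Ms (mat 1)) \<le> C * \<gamma> ^ length Ms"
  shows "jsr \<M> \<le> \<gamma>"
proof -
  define S where "S = (\<lambda>k. {Ms. length Ms = k \<and> set Ms \<subseteq> \<M>})"
  define a where "a = (\<lambda>k. SUP Ms\<in>S k. norm (foldr (**) Ms (mat 1)))"
  obtain M0 where "M0 \<in> \<M>" using ne by blast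
  then have Sne: "replicate k M0 \<in> S k" for k by (auto simp: S_def)
  have bdd: "bdd_above ((\<lambda>Ms. norm (foldr (**) Ms (mat 1))) ` S k)" for k
    using bd by (intro bdd_aboveI2[of _ _ "C * \<gamma> ^ k"]) (auto simp: S_def)
  have upper: "norm (foldr (**) Ms (mat 1)) \<le> a k" if "Ms \<in> S k" for Ms k
    unfolding a_def by (rule cSUP_upper[OF that bdd])
  have least: "a k \<le> B" if "\<And>Ms. Ms \<in> S k \<Longrightarrow> norm (foldr (**) Ms (mat 1)) \<le> B" for k B
    unfolding a_def using Sne[of k] that by (intro cSUP_least) auto
  have nonneg: "a k \<ge> 0" for k using upper[OF Sne[of k]] norm_ge_zero order_trans by blast
  have "a (m + n) \<le> a m * a n" for m n
  proof (rule least)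
    fix Ms assume Ms: "Ms \<in> S (m + n)"
    then have "take m Ms \<in> S m" "drop m Ms \<in> S n"
      by (auto simp: S_def dest: in_set_takeD in_set_dropD)
    then have "norm (foldr (**) (take m Ms) (mat 1)) * norm (foldr (**) (drop m Ms) (mat 1)) \<le> a m * a n"
      by (intro mult_mono upper nonneg) auto
    moreover have "norm (foldr (**) Ms (mat 1)) \<le>
        norm (foldr (**) (take m Ms) (mat 1)) * norm (foldr (**) (drop m Ms) (mat 1))"
      using foldr_matrix_mult_append[of "take m Ms" "drop m Ms"] norm_matrix_matrix_mult_le by simp
    ultimately show "norm (foldr (**) Ms (mat 1)) \<le> a m * a n" by simp
  qed
  then have "convergent (\<lambda>k. root k (a k))" by (intro submultiplicative_root_convergent nonneg)
  then have lim: "(\<lambda>k. root k (a k)) \<longlonglongrightarrow> jsr \<M>"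
    unfolding jsr_def a_def S_def by (simp add: convergent_LIMSEQ_iff)
  define D where "D = max C 1"
  have ak: "a k \<le> D * \<gamma> ^ k" for k
  proof (rule least)
    fix Ms assume "Ms \<in> S k"
    then have "norm (foldr (**) Ms (mat 1)) \<le> C * \<gamma> ^ k" using bd[of Ms] by (simp add: S_def)
    also have "\<dots> \<le> D * \<gamma> ^ k" using \<gamma> by (intro mult_right_mono) (auto simp: D_def)
    finally show "norm (foldr (**) Ms (mat 1)) \<le> D * \<gamma> ^ k" .
  qed
  have "(\<lambda>k. root k D * \<gamma>) \<longlonglongrightarrow> 1 * \<gamma>"
    by (intro tendsto_mult tendsto_const LIMSEQ_root_const) (simp add: D_def)
  moreover have "root k (a k) \<le> root k D * \<gamma>" if "k \<ge> 1" for k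
  proof -
    have "root k (a k) \<le> root k (D * \<gamma> ^ k)" using that ak by (intro real_root_le_mono) auto
    also have "\<dots> = root k D * \<gamma>" using that \<gamma> by (simp add: real_root_mult real_root_power_cancel)
    finally show ?thesis .
  qed
  ultimately show ?thesis using LIMSEQ_le[OF lim] by auto
qed

lemma norm_matrix_vector_mult_le:
  fixes A :: "real^'n^'n"
  shows "norm (A *v v) \<le> norm A * norm v"
proof (rule power2_le_imp_le)
  have "(A *v v) $ i ^ 2 \<le> (\<Sum>k\<in>UNIV. (A $ i $ k) ^ 2) * (\<Sum>k\<in>UNIV. (v $ k) ^ 2)" for i
    unfolding matrix_vector_mult_def by (simp add: Cauchy_Schwarz_ineq_sum)
  then have "(\<Sum>i\<in>UNIV. (A *v v) $ i ^ 2) \<le> (\<Sum>i\<in>UNIV. (\<Sum>k\<in>UNIV. (A $ i $ k) ^ 2) * (\<Sum>k\<in>UNIV. (v $ k) ^ 2))"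
    by (intro sum_mono) auto
  then show "norm (A *v v) ^ 2 \<le> (norm A * norm v) ^ 2"
    by (simp add: norm_vec_def L2_set_def sum_nonneg power_mult_distrib sum_distrib_right)
qed simp

lemma norm_le_sum_columns:
  fixes P :: "real^'n^'n"
  shows "norm P \<le> real CARD('n) * (\<Sum>j\<in>UNIV. norm (P *v axis j 1))"
proof -
  have "norm P \<le> (\<Sum>i\<in>UNIV. norm (P $ i))" by (simp add: norm_vec_def L2_set_le_sum)
  also have "\<dots> \<le> (\<Sum>i\<in>(UNIV :: 'n set). \<Sum>j\<in>UNIV. norm (P *v axis j 1))"
  proof (rule sum_mono)
    fix i
    have "norm (P $ i) \<le> (\<Sum>j\<in>UNIV. \<bar>P $ i $ j\<bar>)" by (rule norm_le_l1_cart)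
    also have "\<dots> \<le> (\<Sum>j\<in>UNIV. norm (P *v axis j 1))"
    proof (rule sum_mono)
      fix j
      have "P $ i $ j = (P *v axis j 1) $ i" by (simp add: matrix_vector_mult_basis column_def)
      then show "\<bar>P $ i $ j\<bar> \<le> norm (P *v axis j 1)" using component_le_norm_cart by metis
    qed
    finally show "norm (P $ i) \<le> (\<Sum>j\<in>UNIV. norm (P *v axis j 1))" .
  qed
  finally show ?thesis by simp
qed

section \<open>From the Lyapunov exponent to a contracting norm\<close>

lemma exp_growth_imp_le:
  assumes "\<And>t. t \<ge> 0 \<Longrightarrow> exp (a * t) \<le> (c::real)"
  shows "a \<le> 0"
proof (rule ccontr)
  assume "\<not> a \<le> 0"
  then have a: "a > 0" by simp
  have "c \<ge> 1" using assms[of 0] by simp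
  then have "exp (a * (c / a)) \<le> c" using a by (intro assms) simp
  moreover have "exp c \<ge> 1 + c" by simp
  ultimately show False using a by simp
qed

lemma lyap_exp_less_imp_decay:
  fixes \<A> :: "(real^'n^'n) set"
  assumes "compact \<A>" "lyap_exp \<A> < b"
  shows "\<exists>\<alpha><b. \<forall>x. trajectory \<A> x \<longrightarrow> (\<exists>C. \<forall>t\<ge>0. norm (x t) \<le> C * exp (\<alpha> * t))"
proof -
  obtain K where K: "K > 0" "\<And>A. A \<in> \<A> \<Longrightarrow> norm A \<le> K"
    using compact_imp_bounded[OF assms(1)] by (auto simp: bounded_pos)
  have "norm (A *v v) \<le> K * norm v" if "A \<in> \<A>" for A v
    using norm_matrix_vector_mult_le[of A v] mult_right_mono[OF K(2)[OF that] norm_ge_zero[of v]] by linarith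
  then have "{\<alpha>. \<forall>x. trajectory \<A> x \<longrightarrow> (\<exists>C. \<forall>t\<ge>0. norm (x t) \<le> C * exp (\<alpha> * t))} \<noteq> {}"
    using trajectory_exp_bounded[of \<A> K] K(1) by auto
  from cInf_lessD[OF this] assms(2) show ?thesis unfolding lyap_exp_def by blast
qed

text \<open>\<open>V\<close> dominates the Euclidean norm and is finite on the basis vectors, so its
  contraction under single Euler steps becomes a geometric bound for matrix products.\<close>

lemma euler_products_bound:
  fixes \<A> :: "(real^'n^'n) set" and r \<epsilon> \<tau> \<beta> :: real
  assumes \<epsilon>: "0 < \<epsilon>" "\<epsilon> < \<beta>" and \<tau>: "0 < \<tau>" "\<tau> < 2 * \<epsilon> / (M2 CARD('n) * r ^ 2)"
    and ne: "\<A> \<noteq> {}" and real: "\<forall>A\<in>\<A>. only_real_eigenvalues A" and rad: "\<forall>A\<in>\<A>. spec_rad A \<le> r"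
    and decay: "\<And>x. trajectory \<A> x \<Longrightarrow> \<exists>C. \<forall>t\<ge>0. norm (x t) \<le> C * exp (- \<beta> * t)"
  shows "\<exists>C \<gamma>. 0 \<le> \<gamma> \<and> \<gamma> < 1 \<and> (\<forall>Ms. set Ms \<subseteq> (\<lambda>A. mat 1 + \<tau> *\<^sub>R A) ` \<A> \<longrightarrow>
    norm (foldr (**) Ms (mat 1)) \<le> C * \<gamma> ^ length Ms)"
proof -
  define V where "V = (\<lambda>v. SUP l\<in>segments \<A>. flow_growth \<beta> l v)"
  have V_upper: "flow_growth \<beta> l v \<le> V v" if "l \<in> segments \<A>" for l v
    unfolding V_def using flow_growth_bounded[OF ne decay, of v] that
    by (intro cSUP_upper) (auto intro: bdd_aboveI2)
  have V_least: "V v \<le> B" if "\<And>l. l \<in> segments \<A> \<Longrightarrow> flow_growth \<beta> l v \<le> B" for v B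
    unfolding V_def using segments_simps(1)[of \<A>] that by (intro cSUP_least) blast+
  have V_norm: "norm v \<le> V v" for v using V_upper[of "[]" v] by (simp add: flow_growth_def)
  have V_mexp: "flow_growth \<beta> l (mexp A t x) \<le> V x * exp (- \<beta> * t)"
    if l: "l \<in> segments \<A>" and A: "A \<in> \<A>" and t: "t \<ge> 0" for l A t x
  proof (cases "t = 0")
    case True
    then show ?thesis using V_upper[OF l] by simp
  next
    case False
    then have "(t, A) # l \<in> segments \<A>" using l A t by simp
    from V_upper[OF this, of x] have "exp (\<beta> * t) * flow_growth \<beta> l (mexp A t x) \<le> V x"
      using flow_growth_append[of \<beta> "[(t, A)]" l x] by simp
    then show ?thesis by (simp add: exp_minus field_simps)
  qed
  \<comment> \<open>Along an eigenvector the flow is exp (\<mu> t) e, and the decay measured by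
    \<open>V\<close> leaves no room for a larger \<mu>.\<close>
  have eig: "\<mu> \<le> - \<beta>" if A: "A \<in> \<A>" and e: "A *v e = \<mu> *\<^sub>R e" "e \<noteq> 0" for A e \<mu>
  proof -
    have "exp ((\<mu> + \<beta>) * t) \<le> V e / norm e" if t: "t \<ge> 0" for t
    proof -
      have "exp (\<mu> * t) * norm e \<le> V e * exp (- \<beta> * t)"
        using V_mexp[of "[]" A t e] A t by (simp add: flow_growth_def mexp_eigenvector[OF e(1)])
      then show ?thesis using e(2) by (simp add: exp_add exp_minus field_simps)
    qed
    from exp_growth_imp_le[OF this] show ?thesis by simp
  qed
  have factors: "\<exists>\<mu>s. length \<mu>s \<le> CARD('n) \<and> apply_factors A \<mu>s x = 0 \<and> (\<forall>\<mu>\<in>set \<mu>s. - r \<le> \<mu> \<and> \<mu> < - \<epsilon>)"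
    if A: "A \<in> \<A>" for A x
  proof -
    obtain \<mu>s where \<mu>s: "length \<mu>s \<le> CARD('n)" "apply_factors A \<mu>s x = 0"
      "\<forall>\<mu>\<in>set \<mu>s. \<bar>\<mu>\<bar> \<le> spec_rad A \<and> (\<exists>e. e \<noteq> 0 \<and> A *v e = \<mu> *\<^sub>R e)"
      using exists_real_factors real A by blast
    have "- r \<le> \<mu> \<and> \<mu> < - \<epsilon>" if \<mu>: "\<mu> \<in> set \<mu>s" for \<mu>
    proof -
      have "\<bar>\<mu>\<bar> \<le> r" using \<mu>s(3) \<mu> rad A by force
      moreover obtain e where "e \<noteq> 0" "A *v e = \<mu> *\<^sub>R e" using \<mu>s(3) \<mu> by blast
      then have "\<mu> \<le> - \<beta>" using eig A by blast
      ultimately show ?thesis using \<epsilon> by linarith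
    qed
    with \<mu>s show ?thesis by blast
  qed
  \<comment> \<open>For a nonzero vector the list of factors is non-empty, and each of its entries
    lies in [- r, - \<epsilon>).\<close>
  have r: "\<epsilon> < r"
  proof -
    obtain A where A: "A \<in> \<A>" using ne by blast
    obtain \<mu>s where \<mu>s: "apply_factors A \<mu>s (axis undefined 1) = 0" "\<forall>\<mu>\<in>set \<mu>s. - r \<le> \<mu> \<and> \<mu> < - \<epsilon>"
      using factors[OF A] by blast
    then have "\<mu>s \<noteq> []" by (auto simp: axis_eq_0_iff)
    then have "hd \<mu>s \<in> set \<mu>s" by simp
    with \<mu>s(2) show ?thesis by force
  qed
  obtain \<gamma> where \<gamma>: "0 \<le> \<gamma>" "\<gamma> < 1" "\<And>p \<mu>s B. exp_sol (map uminus \<mu>s) p \<Longrightarrow> length \<mu>s \<le> CARD('n) \<Longrightarrow>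
    \<forall>\<mu>\<in>set \<mu>s. - r \<le> \<mu> \<and> \<mu> < - \<epsilon> \<Longrightarrow> B > 0 \<Longrightarrow> \<forall>t\<ge>0. \<bar>p t\<bar> \<le> B * exp (- \<epsilon> * t) \<Longrightarrow>
    \<bar>p 0 + \<tau> * deriv p 0\<bar> \<le> \<gamma> * B"
    using exp_sol_euler_step_contraction[OF \<epsilon>(1) r \<tau>] by metis
  have step: "V ((mat 1 + \<tau> *\<^sub>R A) *v x) \<le> \<gamma> * V x" if A: "A \<in> \<A>" for A x
  proof (rule V_least)
    fix l assume l: "l \<in> segments \<A>"
    let ?z = "(mat 1 + \<tau> *\<^sub>R A) *v x"
    have z: "?z = x + \<tau> *\<^sub>R (A *v x)" by (simp add: matrix_vector_mult_add_rdistrib scaleR_matrix_vector_assoc)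
    show "flow_growth \<beta> l ?z \<le> \<gamma> * V x"
    proof (cases "x = 0")
      case True
      have "V x \<ge> 0" using V_norm[of x] norm_ge_zero order_trans by blast
      then show ?thesis using True \<gamma>(1) by (simp add: flow_growth_def linear_0[OF linear_flow])
    next
      case False
      \<comment> \<open>A norming functional: it equals \<open>flow_growth\<close> at
        \<open>?z\<close> and is dominated by it elsewhere. Being linear, it turns the flow of A
        through x into a scalar exponential sum.\<close>
      define y where "y = (\<lambda>v. exp (\<beta> * duration l) * (sgn (flow l ?z) \<bullet> flow l v))"
      have "linear y"
        unfolding y_def using linear_flow[of l]
        by (intro linearI) (simp_all add: linear_add linear_scale inner_add_right algebra_simps)
      then have y: "bounded_linear y" by (simp add: linear_conv_bounded_linear)
      have y_le: "\<bar>y v\<bar> \<le> flow_growth \<beta> l v" for v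
      proof -
        have "\<bar>sgn (flow l ?z) \<bullet> flow l v\<bar> \<le> norm (sgn (flow l ?z)) * norm (flow l v)"
          by (rule Cauchy_Schwarz_ineq2)
        also have "\<dots> \<le> 1 * norm (flow l v)" by (intro mult_right_mono) (auto simp: norm_sgn)
        finally show ?thesis by (simp add: y_def flow_growth_def abs_mult)
      qed
      have y_z: "y ?z = flow_growth \<beta> l ?z"
        by (cases "flow l ?z = 0") (simp_all add: y_def flow_growth_def sgn_div_norm dot_square_norm power2_eq_square)
      define p where "p = (\<lambda>t. y (mexp A t x))"
      obtain \<mu>s where \<mu>s: "length \<mu>s \<le> CARD('n)" "apply_factors A \<mu>s x = 0"
        "\<forall>\<mu>\<in>set \<mu>s. - r \<le> \<mu> \<and> \<mu> < - \<epsilon>" using factors[OF A] by blast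
      have Vx: "V x > 0" using V_norm[of x] False by (meson less_le_trans zero_less_norm_iff)
      have "\<bar>p t\<bar> \<le> V x * exp (- \<epsilon> * t)" if t: "t \<ge> 0" for t
      proof -
        have "\<bar>p t\<bar> \<le> V x * exp (- \<beta> * t)"
          unfolding p_def using y_le V_mexp[OF l A t] by (rule order_trans)
        also have "\<dots> \<le> V x * exp (- \<epsilon> * t)"
          using Vx t \<epsilon> by (intro mult_left_mono) (auto intro: mult_right_mono)
        finally show ?thesis .
      qed
      then have "\<bar>p 0 + \<tau> * deriv p 0\<bar> \<le> \<gamma> * V x"
        using \<gamma>(3)[OF _ \<mu>s(1,3) Vx] mexp_exp_sol[OF y \<mu>s(2)] unfolding p_def by blast
      moreover have "deriv p 0 = y (A *v x)"
      proof (rule DERIV_imp_deriv)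
        have "(p has_vector_derivative y (A *v mexp A 0 x)) (at 0)"
          unfolding p_def by (rule bounded_linear.has_vector_derivative[OF y mexp_has_vector_derivative])
        then show "(p has_real_derivative y (A *v x)) (at 0)"
          by (simp add: has_real_derivative_iff_has_vector_derivative)
      qed
      moreover have "y ?z = p 0 + \<tau> * y (A *v x)"
        unfolding z p_def using \<open>linear y\<close> by (simp add: linear_add linear_scale)
      ultimately show ?thesis using y_z by simp
    qed
  qed
  have prod: "V (foldr (**) Ms (mat 1) *v x) \<le> \<gamma> ^ length Ms * V x"
    if "set Ms \<subseteq> (\<lambda>A. mat 1 + \<tau> *\<^sub>R A) ` \<A>" for Ms x
    using that
  proof (induction Ms)
    case (Cons M Ms)
    then obtain A where A: "A \<in> \<A>" "M = mat 1 + \<tau> *\<^sub>R A" by auto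
    have "V (foldr (**) (M # Ms) (mat 1) *v x) = V (M *v (foldr (**) Ms (mat 1) *v x))"
      by (simp add: matrix_vector_mul_assoc)
    also have "\<dots> \<le> \<gamma> * V (foldr (**) Ms (mat 1) *v x)" unfolding A(2) by (rule step[OF A(1)])
    also have "\<dots> \<le> \<gamma> * (\<gamma> ^ length Ms * V x)" using Cons \<gamma>(1) by (intro mult_left_mono) auto
    finally show ?case by (simp add: mult.assoc)
  qed simp
  define C where "C = real CARD('n) * (\<Sum>j\<in>(UNIV :: 'n set). V (axis j 1))"
  have "norm (foldr (**) Ms (mat 1)) \<le> C * \<gamma> ^ length Ms"
    if Ms: "set Ms \<subseteq> (\<lambda>A. mat 1 + \<tau> *\<^sub>R A) ` \<A>" for Ms
  proof -
    let ?P = "foldr (**) Ms (mat 1) :: real^'n^'n"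
    have "norm (?P *v axis j 1) \<le> \<gamma> ^ length Ms * V (axis j 1)" for j
      using V_norm prod[OF Ms] by (rule order_trans)
    then have "(\<Sum>j\<in>UNIV. norm (?P *v axis j 1)) \<le> (\<Sum>j\<in>UNIV. \<gamma> ^ length Ms * V (axis j 1))"
      by (intro sum_mono)
    then have "real CARD('n) * (\<Sum>j\<in>UNIV. norm (?P *v axis j 1)) \<le> C * \<gamma> ^ length Ms"
      by (simp add: C_def sum_distrib_left[symmetric] mult_ac)
    with norm_le_sum_columns[of ?P] show ?thesis by linarith
  qed
  with \<gamma> show ?thesis by blast
qed

theorem theorem3:
  fixes \<A> :: "(real^'n^'n) set" and r \<epsilon> \<tau> :: real
  assumes "r > 0" and "\<epsilon> > 0"
    and "0 < \<tau>" and "\<tau> < 2 * \<epsilon> / (M2 CARD('n) * r ^ 2)"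
    and "compact \<A>" and "\<A> \<noteq> {}"
    and "\<forall>A\<in>\<A>. only_real_eigenvalues A"
    and "\<forall>A\<in>\<A>. spec_rad A \<le> r"
    and "jsr ((\<lambda>A. mat 1 + \<tau> *\<^sub>R A) ` \<A>) \<ge> 1"
  shows "lyap_exp \<A> \<ge> - \<epsilon>"
proof (rule ccontr)
  assume "\<not> lyap_exp \<A> \<ge> - \<epsilon>"
  then have "lyap_exp \<A> < - \<epsilon>" by simp
  from lyap_exp_less_imp_decay[OF assms(5) this] obtain \<alpha> where \<alpha>: "\<alpha> < - \<epsilon>"
    "\<And>x. trajectory \<A> x \<Longrightarrow> \<exists>C. \<forall>t\<ge>0. norm (x t) \<le> C * exp (\<alpha> * t)" by blast
  have "\<epsilon> < - \<alpha>" using \<alpha>(1) by simp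
  moreover have "\<exists>C. \<forall>t\<ge>0. norm (x t) \<le> C * exp (- (- \<alpha>) * t)" if "trajectory \<A> x" for x
    using \<alpha>(2)[OF that] by simp
  ultimately obtain C \<gamma> where \<gamma>: "0 \<le> \<gamma>" "\<gamma> < 1"
    "\<And>Ms. set Ms \<subseteq> (\<lambda>A. mat 1 + \<tau> *\<^sub>R A) ` \<A> \<Longrightarrow> norm (foldr (**) Ms (mat 1)) \<le> C * \<gamma> ^ length Ms"
    using euler_products_bound[OF assms(2) _ assms(3,4,6,7,8), of "- \<alpha>"] by blast
  have "jsr ((\<lambda>A. mat 1 + \<tau> *\<^sub>R A) ` \<A>) \<le> \<gamma>"
    using assms(6) by (intro jsr_le[OF _ \<gamma>(1,3)]) auto
  then show False using assms(9) \<gamma>(2) by simp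
qed

end
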